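(* Assume the setup below, with the sequence $(d_n)$ satisfying $0<d_n\le 1$ for all $n$ and $d_n\ge C|n|^{-\zeta}$ for all $n\neq 0$, for some constants $C>0$ and $\zeta<\tfrac12$. Then for $\mu$-almost every $\omega\in\Omega$, the operator $J_\omega$ has purely pure point spectrum.
   Context: Setup: $r:\mathbb R\to[0,\infty)$ is bounded, measurable, compactly supported, with $\int_{\mathbb R} r(x)\,dx=1$. $(d_n)_{n\in\mathbb Z}$ is a fixed sequence of positive reals and $r_n(x)=d_n^{-1}r(d_n^{-1}x)$. $c\in\ell^\infty(\mathbb Z)$ is a real sequence (background potential). $a\in\ell^\infty(\mathbb Z)$ is real with $a(n)\ge\delta>0$ for all $n$. $\Omega=\mathbb R^{\mathbb Z}$ and $\mu$ is the product probability measure $d\mu(\omega)=\prod_{n\in\mathbb Z} r_n(\omega(n)-c(n))\,d\omega(n)$, i.e. the coordinates $\omega(n)$ are independent and $\omega(n)-c(n)$ has density $r_n$. For $\omega\in\Omega$, $J_\omega$ is the operator on $\ell^2(\mathbb Z)$ given by $(J_\omega\phi)(n)=a(n)\phi(n+1)+a(n-1)\phi(n-1)+\omega(n)\phi(n)$. *)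

theory Defs
  imports "HOL-Probability.Probability"
begin

definition ell2 :: "(int \<Rightarrow> complex) set" where
  "ell2 = {\<phi>. (\<lambda>n. (cmod (\<phi> n))^2) summable_on UNIV}"

definition l2norm :: "(int \<Rightarrow> complex) \<Rightarrow> real" where
  "l2norm \<phi> = sqrt (\<Sum>\<^sub>\<infinity>n. (cmod (\<phi> n))^2)"

definition jacobi :: "(int \<Rightarrow> real) \<Rightarrow> (int \<Rightarrow> real) \<Rightarrow> (int \<Rightarrow> complex) \<Rightarrow> (int \<Rightarrow> complex)" where
  "jacobi a \<omega> \<phi> = (\<lambda>n. complex_of_real (a n) * \<phi> (n + 1)
                        + complex_of_real (a (n - 1)) * \<phi> (n - 1)
                        + complex_of_real (\<omega> n) * \<phi> n)"

definition is_eigenvector :: "((int \<Rightarrow> complex) \<Rightarrow> (int \<Rightarrow> complex)) \<Rightarrow> (int \<Rightarrow> complex) \<Rightarrow> bool" where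
  "is_eigenvector T \<phi> \<longleftrightarrow> \<phi> \<in> ell2 \<and> \<phi> \<noteq> (\<lambda>_. 0) \<and> (\<exists>E::complex. T \<phi> = (\<lambda>n. E * \<phi> n))"

text \<open>Pure point spectrum: the eigenvectors span a dense subspace of l2(Z)
  (i.e. the pure point subspace, the closed span of the eigenvectors, is all of l2(Z)).\<close>
definition pure_point_spectrum :: "((int \<Rightarrow> complex) \<Rightarrow> (int \<Rightarrow> complex)) \<Rightarrow> bool" where
  "pure_point_spectrum T \<longleftrightarrow>
     (\<forall>\<psi>\<in>ell2. \<forall>\<epsilon>>0. \<exists>F coef. finite F \<and> F \<subseteq> {\<phi>. is_eigenvector T \<phi>} \<and>
        l2norm (\<lambda>n. \<psi> n - (\<Sum>\<phi>\<in>F. coef \<phi> * \<phi> n)) < \<epsilon>)"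

text \<open>The product measure mu: coordinates independent, omega(n) - c(n) has density r_n,
  where r_n(x) = r(x / d_n) / d_n.\<close>
definition anderson_measure :: "(real \<Rightarrow> real) \<Rightarrow> (int \<Rightarrow> real) \<Rightarrow> (int \<Rightarrow> real) \<Rightarrow> (int \<Rightarrow> real) measure" where
  "anderson_measure r d c =
     PiM UNIV (\<lambda>n. density lborel (\<lambda>x. ennreal (r ((x - c n) / d n) / d n)))"

end

theory Submission
  imports Defs "HOL-Computational_Algebra.Polynomial"
begin

text \<open>
  A version of the Kunz-Souillard argument. Restrict \<open>J\<close> to the box of radius \<open>L\<close> around \<open>k\<close> and let \<open>\<phi>\<close>
  run over its orthonormal eigenbasis. If the expectation of \<open>\<Sum>\<phi>. \<bar>\<phi> k * \<phi> (k \<plusminus> n)\<bar>\<close> is bounded by a summable sequence in \<open>n\<close>,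
  uniformly in \<open>L\<close>, then almost surely, up to a small error, only a number of eigenvectors independent of \<open>L\<close> contribute
  to the expansion of the unit vector at \<open>k\<close>, and by compactness these converge to eigenvectors of \<open>J\<close> as \<open>L\<close> grows.

  Averaging over \<open>\<omega> k\<close> turns the sum over eigenvectors into an integral over energies \<open>E\<close>, and for fixed \<open>E\<close> the ratio
  \<open>\<phi> (k \<plusminus> n) / \<phi> k\<close> is a product of Riccati variables. Integrating out the potential site by site, one has to
  bound a product of operators on \<open>L\<^sup>2(\<real>)\<close>, each of which is an inversion \<open>f \<mapsto> \<alpha> / \<bar>z\<bar> * f (\<alpha>\<^sup>2 / z)\<close>, which is isometric, followed by
  averaging translates with the law of the potential, which is a contraction. If the averaging at scale \<open>d\<close> decreases the norm
  by less than a factor \<open>1 - const * d\<^sup>2\<close>, then the function is almost translation invariant and has little mass near the origin;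
  the next inversion concentrates it near the origin, so the averaging after that does decrease the norm. As
  the partial sums of \<open>n powr (- 2 * \<zeta>)\<close> grow like \<open>n powr (1 - 2 * \<zeta>)\<close>, the product decays like a stretched exponential.
\<close>

section \<open>Averaged translations and inversions of the line\<close>

text \<open>One site contributes the factor \<alpha> / \<bar>z\<bar> to the ratio of eigenfunction
  values, exactly the square root of the Jacobian of the inversion. Hence the first power of the
  eigenfunction calls for L2; its square would lead to L1, where averaging preserves the integral of
  a nonnegative function and nothing is gained. The iteration starts from an approximate Dirac mass,
  which has no L2 bound uniform in its width. Averaging over \<omega> k with a bounded density
  provides one, and the last averaging turns L2 back into a supremum bound; each costs a factor sqrt
  \<beta>. The other half-line enters only through its Riccati variable at k, a shift of the energy
  that is independent of the sites integrated out. Riccati variables have poles and eigenvectors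
  have zeros. Therefore the integral over energies is only compared from below with the sum over
  eigenvectors, locally at each eigenvalue and with a smeared Dirac mass; Fatou's lemma removes the
  smearing. At distance n all factors are estimated by the worst density bound up to that distance,
  which still gives the exponent 1 - 2 \<zeta> when \<zeta> \<ge> 0.\<close>

definition nonneg_L2 :: "(real \<Rightarrow> real) \<Rightarrow> bool" where
  "nonneg_L2 f \<longleftrightarrow> f \<in> borel_measurable borel \<and> (\<forall>x. 0 \<le> f x) \<and> integrable lborel (\<lambda>x. (f x)\<^sup>2)"

definition sqnorm :: "(real \<Rightarrow> real) \<Rightarrow> real" where
  "sqnorm f = (\<integral>x. (f x)\<^sup>2 \<partial>lborel)"

lemma nonneg_L2D:
  assumes "nonneg_L2 f"
  shows "f \<in> borel_measurable borel" "\<And>x. 0 \<le> f x" "integrable lborel (\<lambda>x. (f x)\<^sup>2)"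
  using assms by (auto simp: nonneg_L2_def)

lemma sqnorm_nonneg [simp]: "0 \<le> sqnorm f"
  by (simp add: sqnorm_def)

lemma nn_integral_sq:
  assumes "nonneg_L2 f"
  shows "(\<integral>\<^sup>+x. ennreal ((f x)\<^sup>2) \<partial>lborel) = ennreal (sqnorm f)"
  unfolding sqnorm_def by (rule nn_integral_eq_integral) (use assms in \<open>auto simp: nonneg_L2_def\<close>)

lemma nonneg_L2I:
  assumes "f \<in> borel_measurable borel" "\<And>x. 0 \<le> f x"
    and "(\<integral>\<^sup>+x. ennreal ((f x)\<^sup>2) \<partial>lborel) \<le> ennreal q" "0 \<le> q"
  shows "nonneg_L2 f" "sqnorm f \<le> q"
proof -
  have "integrable lborel (\<lambda>x. (f x)\<^sup>2)"
    using assms by (intro integrableI_nonneg) (auto simp: le_less_trans)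
  then show *: "nonneg_L2 f" using assms by (simp add: nonneg_L2_def)
  from nn_integral_sq[OF this] assms show "sqnorm f \<le> q" by simp
qed

lemma nonneg_L2_restrict:
  assumes f: "nonneg_L2 f" and A [measurable]: "A \<in> sets borel"
  shows "nonneg_L2 (\<lambda>x. f x * indicator A x)" "sqnorm (\<lambda>x. f x * indicator A x) \<le> sqnorm f"
proof -
  note [measurable] = nonneg_L2D(1)[OF f]
  have "(\<integral>\<^sup>+x. ennreal ((f x * indicator A x)\<^sup>2) \<partial>lborel) \<le> (\<integral>\<^sup>+x. ennreal ((f x)\<^sup>2) \<partial>lborel)"
    by (intro nn_integral_mono) (auto split: split_indicator)
  then have *: "(\<integral>\<^sup>+x. ennreal ((f x * indicator A x)\<^sup>2) \<partial>lborel) \<le> ennreal (sqnorm f)"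
    using nn_integral_sq[OF f] by simp
  have m: "(\<lambda>x. f x * indicator A x) \<in> borel_measurable borel" by measurable
  have p: "0 \<le> f x * indicator A x" for x using nonneg_L2D(2)[OF f] by simp
  show "nonneg_L2 (\<lambda>x. f x * indicator A x)" "sqnorm (\<lambda>x. f x * indicator A x) \<le> sqnorm f"
    using nonneg_L2I[OF m p *] by auto
qed

lemma sqnorm_split:
  assumes f: "nonneg_L2 f" and A [measurable]: "A \<in> sets borel"
  shows "sqnorm f = sqnorm (\<lambda>x. f x * indicator A x) + sqnorm (\<lambda>x. f x * indicator (- A) x)"
proof -
  have "integrable lborel (\<lambda>x. (f x * indicator A x)\<^sup>2)"
    "integrable lborel (\<lambda>x. (f x * indicator (- A) x)\<^sup>2)"
    using nonneg_L2_restrict(1)[OF f, of A] nonneg_L2_restrict(1)[OF f, of "- A"]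
    by (auto simp: nonneg_L2_def)
  from Bochner_Integration.integral_add[OF this] show ?thesis unfolding sqnorm_def
    by (subst (asm) eq_commute) (auto intro!: Bochner_Integration.integral_cong split: split_indicator)
qed

text \<open>With \<open>t\<close> the energy, \<open>x\<close> the potential and \<open>y\<close>
  the Riccati variable there, \<open>t - x - y\<close> has the form of the denominators in the
  Riccati recursion. Averaging over \<open>x\<close> turns a function of such a denominator into a
  function of \<open>y\<close>; up to a reflection this averages translates.\<close>

definition avg :: "real measure \<Rightarrow> real \<Rightarrow> (real \<Rightarrow> real) \<Rightarrow> real \<Rightarrow> real" where
  "avg N t g y = (\<integral>x. g (t - x - y) \<partial>N)"

text \<open>\<open>dominated\<close> expresses a density bounded by \<beta> through integrals. For
  the potential at a site with scale \<open>d\<close>, \<beta> will be of order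
  \<open>1 / d\<close>.\<close>

locale bounded_law = prob_space N for N :: "real measure" +
  fixes \<beta> V :: real
  assumes sets_N [simp, measurable_cong]: "sets N = sets borel"
    and dominated: "h \<in> borel_measurable borel \<Longrightarrow> (\<integral>\<^sup>+x. h x \<partial>N) \<le> ennreal \<beta> * (\<integral>\<^sup>+x. h x \<partial>lborel)"
    and supported: "AE x in N. \<bar>x\<bar> \<le> V"
    and beta: "1 \<le> \<beta>"
begin

lemma space_N [simp]: "space N = UNIV"
  using sets_eq_imp_space_eq[OF sets_N] by simp

lemma nn_integral_reflect:
  fixes g :: "real \<Rightarrow> ennreal"
  assumes "g \<in> borel_measurable borel"
  shows "(\<integral>\<^sup>+y. g (s - y) \<partial>lborel) = (\<integral>\<^sup>+y. g y \<partial>lborel)"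
  using nn_integral_real_affine[OF assms, of "-1" s] by simp

text \<open>Jensen's inequality appears as nonnegativity of the variance. The bound by
  \<open>sqrt (\<beta> * sqnorm g)\<close> is where a bounded density converts an L2 bound into a
  supremum bound.\<close>

lemma avg_facts:
  assumes g: "nonneg_L2 g"
  shows "integrable N (\<lambda>x. (g (t - x - y))\<^sup>2)" "integrable N (\<lambda>x. g (t - x - y))"
    "(\<integral>x. (g (t - x - y))\<^sup>2 \<partial>N) \<le> \<beta> * sqnorm g"
    "(avg N t g y)\<^sup>2 \<le> (\<integral>x. (g (t - x - y))\<^sup>2 \<partial>N)"
    "0 \<le> avg N t g y" "avg N t g y \<le> sqrt (\<beta> * sqnorm g)"
    "ennreal (avg N t g y) = (\<integral>\<^sup>+x. ennreal (g (t - x - y)) \<partial>N)"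
proof -
  note [measurable] = nonneg_L2D(1)[OF g]
  note pos = nonneg_L2D(2)[OF g]
  have "(\<integral>\<^sup>+x. ennreal ((g (t - x - y))\<^sup>2) \<partial>N) \<le> ennreal \<beta> * (\<integral>\<^sup>+x. ennreal ((g (t - x - y))\<^sup>2) \<partial>lborel)"
    by (rule dominated) measurable
  also have "(\<integral>\<^sup>+x. ennreal ((g (t - x - y))\<^sup>2) \<partial>lborel) = (\<integral>\<^sup>+x. ennreal ((g x)\<^sup>2) \<partial>lborel)"
    using nn_integral_reflect[of "\<lambda>x. ennreal ((g x)\<^sup>2)" "t - y"] by (simp add: algebra_simps)
  finally have *: "(\<integral>\<^sup>+x. ennreal ((g (t - x - y))\<^sup>2) \<partial>N) \<le> ennreal (\<beta> * sqnorm g)"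
    using nn_integral_sq[OF g] beta by (simp add: ennreal_mult)
  show i2: "integrable N (\<lambda>x. (g (t - x - y))\<^sup>2)"
    using * by (intro integrableI_nonneg) (auto simp: le_less_trans)
  show i1: "integrable N (\<lambda>x. g (t - x - y))"
    by (rule square_integrable_imp_integrable[OF _ i2]) measurable
  show b: "(\<integral>x. (g (t - x - y))\<^sup>2 \<partial>N) \<le> \<beta> * sqnorm g"
    using * beta by (subst (asm) nn_integral_eq_integral[OF i2]) auto
  show v: "(avg N t g y)\<^sup>2 \<le> (\<integral>x. (g (t - x - y))\<^sup>2 \<partial>N)"
    using variance_eq[OF i1 i2] variance_positive[of "\<lambda>x. g (t - x - y)"] by (simp add: avg_def)
  show "0 \<le> avg N t g y" using pos by (simp add: avg_def)
  show "avg N t g y \<le> sqrt (\<beta> * sqnorm g)"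
    using order_trans[OF v b] by (simp add: real_le_rsqrt)
  show "ennreal (avg N t g y) = (\<integral>\<^sup>+x. ennreal (g (t - x - y)) \<partial>N)"
    unfolding avg_def by (rule nn_integral_eq_integral[symmetric, OF i1]) (use pos in auto)
qed

lemma avg_measurable [measurable]:
  assumes [measurable]: "g \<in> borel_measurable borel"
  shows "avg N t g \<in> borel_measurable borel"
  unfolding avg_def by measurable

lemma nn_integral_swap_reflect:
  fixes h :: "real \<Rightarrow> ennreal"
  assumes [measurable]: "h \<in> borel_measurable borel"
  shows "(\<integral>\<^sup>+y. (\<integral>\<^sup>+x. h (t - x - y) \<partial>N) \<partial>lborel) = (\<integral>\<^sup>+y. h y \<partial>lborel)"
proof -
  interpret pair_sigma_finite lborel N ..
  have "(\<integral>\<^sup>+y. (\<integral>\<^sup>+x. h (t - x - y) \<partial>N) \<partial>lborel) = (\<integral>\<^sup>+x. (\<integral>\<^sup>+y. h (t - x - y) \<partial>lborel) \<partial>N)"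
    by (rule Fubini'[symmetric]) measurable
  then show ?thesis
    using emeasure_space_1 by (simp add: nn_integral_reflect)
qed

lemma avg_L2:
  assumes g: "nonneg_L2 g"
  shows "nonneg_L2 (avg N t g)" "sqnorm (avg N t g) \<le> sqnorm g"
proof -
  note [measurable] = nonneg_L2D(1)[OF g]
  have "(\<integral>\<^sup>+y. ennreal ((avg N t g y)\<^sup>2) \<partial>lborel) \<le> (\<integral>\<^sup>+y. (\<integral>\<^sup>+x. ennreal ((g (t - x - y))\<^sup>2) \<partial>N) \<partial>lborel)"
    using avg_facts[OF g]
    by (intro nn_integral_mono) (auto simp: nn_integral_eq_integral intro!: ennreal_leI)
  also have "\<dots> = ennreal (sqnorm g)"
    using nn_integral_swap_reflect[of "\<lambda>x. ennreal ((g x)\<^sup>2)" t] nn_integral_sq[OF g] by simp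
  finally show "nonneg_L2 (avg N t g)" "sqnorm (avg N t g) \<le> sqnorm g"
    using nonneg_L2I[of "avg N t g" "sqnorm g"] avg_facts(5)[OF g] by auto
qed

text \<open>Finite range: the law lives on \<open>{-V..V}\<close>, so the average at a point of
  \<open>{-b'..b'}\<close> reads \<open>g\<close> only inside \<open>{-b..b}\<close>.\<close>

lemma avg_L2_local:
  assumes g: "nonneg_L2 g" and b: "\<bar>t\<bar> + V + b' \<le> b"
  shows "sqnorm (\<lambda>y. avg N t g y * indicator {-b'..b'} y) \<le> sqnorm (\<lambda>z. g z * indicator {-b..b} z)"
proof -
  note [measurable] = nonneg_L2D(1)[OF g]
  let ?h = "\<lambda>z. g z * indicator {-b..b} z"
  have h: "nonneg_L2 ?h" by (rule nonneg_L2_restrict[OF g]) auto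
  have eq: "avg N t g y = avg N t ?h y" if "y \<in> {-b'..b'}" for y
    unfolding avg_def
  proof (rule integral_cong_AE)
    show "AE x in N. g (t - x - y) = ?h (t - x - y)"
      using supported by eventually_elim (use that b in \<open>auto split: split_indicator\<close>)
  qed measurable
  have "sqnorm (\<lambda>y. avg N t g y * indicator {-b'..b'} y) = sqnorm (\<lambda>y. avg N t ?h y * indicator {-b'..b'} y)"
    by (rule arg_cong[where f = sqnorm]) (auto simp: fun_eq_iff eq split: split_indicator)
  also have "\<dots> \<le> sqnorm (avg N t ?h)"
    by (rule nonneg_L2_restrict(2)[OF avg_L2(1)[OF h]]) auto
  also have "\<dots> \<le> sqnorm ?h" by (rule avg_L2(2)[OF h])
  finally show ?thesis .
qed


text \<open>A density bounded by \<beta> gives an interval of length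
  \<open>1 / (2 * \<beta>)\<close> at most mass one half.\<close>

lemma emeasure_far:
  "ennreal (1 / 2) \<le> emeasure N {x'. 1 / (4 * \<beta>) \<le> \<bar>x - x'\<bar>}"
proof -
  let ?h = "1 / (4 * \<beta>)"
  have h: "0 < ?h" using beta by simp
  have "emeasure N {x - ?h<..<x + ?h} = (\<integral>\<^sup>+y. indicator {x - ?h<..<x + ?h} y \<partial>N)"
    by (rule nn_integral_indicator[symmetric]) simp
  also have "\<dots> \<le> ennreal \<beta> * (\<integral>\<^sup>+y. indicator {x - ?h<..<x + ?h} y \<partial>lborel)"
    by (rule dominated) simp
  also have "\<dots> = ennreal (1 / 2)"
    using h beta by (simp add: ennreal_mult[symmetric])
  finally have "measure N {x - ?h<..<x + ?h} \<le> 1 / 2"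
    unfolding emeasure_eq_measure by (subst (asm) ennreal_le_iff) auto
  then have "1 / 2 \<le> measure N (space N - {x - ?h<..<x + ?h})"
    by (subst prob_compl) auto
  also have "space N - {x - ?h<..<x + ?h} = {x'. ?h \<le> \<bar>x - x'\<bar>}"
    by auto
  finally show ?thesis
    unfolding emeasure_eq_measure by (rule ennreal_leI)
qed

text \<open>The loss of norm is the variance integrated over \<open>y\<close>, that is, half the
  mean squared L2 distance between the translates belonging to two independent copies of the
  potential. With probability at least one half the copies are \<open>1 / (4 * \<beta>)\<close>
  apart; if all such shifts cost more than \<open>4 * e\<close>, the loss would be at least
  \<open>e\<close>.\<close>

lemma ex_small_shift:
  assumes g: "nonneg_L2 g" and e: "sqnorm g - sqnorm (avg N t g) < e"
  shows "\<exists>h. 1 / (4 * \<beta>) \<le> \<bar>h\<bar> \<and> (\<integral>\<^sup>+y. ennreal ((g y - g (y + h))\<^sup>2) \<partial>lborel) \<le> ennreal (4 * e)"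
proof (rule ccontr)
  note [measurable] = nonneg_L2D(1)[OF g]
  let ?D = "\<lambda>h. \<integral>\<^sup>+y. ennreal ((g y - g (y + h))\<^sup>2) \<partial>lborel"
  let ?I = "\<integral>\<^sup>+x. (\<integral>\<^sup>+x'. (\<integral>\<^sup>+y. ennreal ((g (t - x - y) - g (t - x' - y))\<^sup>2) \<partial>lborel) \<partial>N) \<partial>N"
  assume "\<not> ?thesis"
  then have big: "ennreal (4 * e) \<le> ?D h" if "1 / (4 * \<beta>) \<le> \<bar>h\<bar>" for h
    using that by fastforce
  have e0: "0 < e" using e avg_L2(2)[OF g, of t] by simp
  have D: "(\<integral>\<^sup>+y. ennreal ((g (t - x - y) - g (t - x' - y))\<^sup>2) \<partial>lborel) = ?D (x - x')" for x x'
    using nn_integral_reflect[of "\<lambda>y. ennreal ((g y - g (y + (x - x')))\<^sup>2)" "t - x"]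
    by (simp add: algebra_simps)
  have "ennreal (2 * e) = (\<integral>\<^sup>+x. ennreal (4 * e) * ennreal (1 / 2) \<partial>N)"
    using e0 emeasure_space_1 by (subst ennreal_mult[symmetric]) auto
  also have "\<dots> \<le> (\<integral>\<^sup>+x. ennreal (4 * e) * emeasure N {x'. 1 / (4 * \<beta>) \<le> \<bar>x - x'\<bar>} \<partial>N)"
    by (intro nn_integral_mono mult_left_mono emeasure_far) auto
  also have "\<dots> = (\<integral>\<^sup>+x. (\<integral>\<^sup>+x'. ennreal (4 * e) * indicator {x'. 1 / (4 * \<beta>) \<le> \<bar>x - x'\<bar>} x' \<partial>N) \<partial>N)"
    by (simp add: nn_integral_cmult_indicator)
  also have "\<dots> \<le> ?I"
    unfolding D by (intro nn_integral_mono) (auto split: split_indicator intro!: big)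
  finally have lower: "ennreal (2 * e) \<le> ?I" .
  interpret P: pair_sigma_finite lborel N ..
  have "?I = (\<integral>\<^sup>+x. (\<integral>\<^sup>+y. (\<integral>\<^sup>+x'. ennreal ((g (t - x - y) - g (t - x' - y))\<^sup>2) \<partial>N) \<partial>lborel) \<partial>N)"
    by (intro nn_integral_cong P.Fubini') measurable
  also have "\<dots> = (\<integral>\<^sup>+y. (\<integral>\<^sup>+x. (\<integral>\<^sup>+x'. ennreal ((g (t - x - y) - g (t - x' - y))\<^sup>2) \<partial>N) \<partial>N) \<partial>lborel)"
    by (rule P.Fubini') measurable
  also have "\<dots> = (\<integral>\<^sup>+y. ennreal (2 * ((\<integral>x. (g (t - x - y))\<^sup>2 \<partial>N) - (avg N t g y)\<^sup>2)) \<partial>lborel)"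
  proof (intro nn_integral_cong)
    fix y
    let ?G = "\<lambda>x. g (t - x - y)"
    let ?s = "\<integral>x. (?G x)\<^sup>2 \<partial>N" and ?m = "avg N t g y"
    note i = avg_facts(1,2)[OF g, of t y]
    have 1: "(\<integral>\<^sup>+x'. ennreal ((?G x - ?G x')\<^sup>2) \<partial>N) = ennreal ((?G x)\<^sup>2 - 2 * ?G x * ?m + ?s)" for x
    proof -
      have "integrable N (\<lambda>x'. (?G x - ?G x')\<^sup>2)"
        unfolding power2_diff using i by (intro Bochner_Integration.integrable_add Bochner_Integration.integrable_diff) auto
      moreover have "(\<integral>x'. (?G x - ?G x')\<^sup>2 \<partial>N) = (?G x)\<^sup>2 - 2 * ?G x * ?m + ?s"
        unfolding power2_diff avg_def using i prob_space by simp
      ultimately show ?thesis by (simp add: nn_integral_eq_integral)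
    qed
    have nn: "0 \<le> (?G x)\<^sup>2 - 2 * ?G x * ?m + ?s" for x
      using avg_facts(4)[OF g, of t y] zero_le_power2[of "?G x - ?m"] unfolding power2_diff by linarith
    have "integrable N (\<lambda>x. (?G x)\<^sup>2 - 2 * ?G x * ?m + ?s)"
      using i by (intro Bochner_Integration.integrable_add Bochner_Integration.integrable_diff) auto
    moreover have "(\<integral>x. (?G x)\<^sup>2 - 2 * ?G x * ?m + ?s \<partial>N) = 2 * (?s - ?m\<^sup>2)"
      using i prob_space by (simp add: avg_def power2_eq_square)
    ultimately show "(\<integral>\<^sup>+x. (\<integral>\<^sup>+x'. ennreal ((?G x - ?G x')\<^sup>2) \<partial>N) \<partial>N) = ennreal (2 * (?s - ?m\<^sup>2))"
      unfolding 1 using nn by (simp add: nn_integral_eq_integral)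
  qed
  finally have I: "?I = (\<integral>\<^sup>+y. ennreal (2 * ((\<integral>x. (g (t - x - y))\<^sup>2 \<partial>N) - (avg N t g y)\<^sup>2)) \<partial>lborel)" .
  \<comment> \<open>The identity loss = ?I / 2 is kept in additive form, because subtraction in
    \<open>ennreal\<close> is truncated.\<close>
  have "?I + ennreal (2 * sqnorm (avg N t g))
      = ?I + (\<integral>\<^sup>+y. 2 * ennreal ((avg N t g y)\<^sup>2) \<partial>lborel)"
    using nn_integral_sq[OF avg_L2(1)[OF g]] by (simp add: nn_integral_cmult ennreal_mult)
  also have "\<dots> = (\<integral>\<^sup>+y. 2 * (\<integral>\<^sup>+x. ennreal ((g (t - x - y))\<^sup>2) \<partial>N) \<partial>lborel)"
    unfolding I using avg_facts[OF g]
    by (subst nn_integral_add[symmetric])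
      (auto simp: nn_integral_eq_integral ennreal_mult[symmetric] ennreal_plus[symmetric] algebra_simps
        simp del: ennreal_plus simp flip: ennreal_numeral intro!: nn_integral_cong)
  also have "\<dots> = ennreal (2 * sqnorm g)"
    using nn_integral_swap_reflect[of "\<lambda>x. ennreal ((g x)\<^sup>2)" t] nn_integral_sq[OF g]
    by (simp add: nn_integral_cmult ennreal_mult)
  finally have eq: "?I + ennreal (2 * sqnorm (avg N t g)) = ennreal (2 * sqnorm g)" .
  have "ennreal (2 * e) + ennreal (2 * sqnorm (avg N t g)) \<le> ennreal (2 * sqnorm g)"
    using add_right_mono[OF lower, of "ennreal (2 * sqnorm (avg N t g))"] unfolding eq .
  then show False using e e0 by (simp add: ennreal_plus[symmetric] del: ennreal_plus)
qed

end


text \<open>Triangle inequality for \<open>j\<close> successive shifts: Cauchy-Schwarz on the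
  telescoping sum gives the factor j^2.\<close>

lemma nn_integral_shift_multiple:
  fixes g :: "real \<Rightarrow> real"
  assumes [measurable]: "g \<in> borel_measurable borel"
  shows "(\<integral>\<^sup>+y. ennreal ((g y - g (y + real j * h))\<^sup>2) \<partial>lborel)
     \<le> ennreal ((real j)\<^sup>2) * (\<integral>\<^sup>+y. ennreal ((g y - g (y + h))\<^sup>2) \<partial>lborel)"
proof -
  let ?d = "\<lambda>i y. g (y + real i * h) - g (y + real (Suc i) * h)"
  have pw: "(g y - g (y + real j * h))\<^sup>2 \<le> real j * (\<Sum>i<j. (?d i y)\<^sup>2)" for y
  proof -
    have "g y - g (y + real j * h) = (\<Sum>i<j. ?d i y)"
      using sum_lessThan_telescope'[of "\<lambda>i. g (y + real i * h)" j] by simp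
    then show ?thesis
      using sum_squared_le_sum_of_squares[of "\<lambda>i. ?d i y" "{..<j}"] by (simp add: mult.commute)
  qed
  have sh: "(\<integral>\<^sup>+y. ennreal ((?d i y)\<^sup>2) \<partial>lborel) = (\<integral>\<^sup>+y. ennreal ((g y - g (y + h))\<^sup>2) \<partial>lborel)" for i
    using nn_integral_real_affine[of "\<lambda>y. ennreal ((g y - g (y + h))\<^sup>2)" 1 "real i * h"]
    by (simp add: algebra_simps)
  have "(\<integral>\<^sup>+y. ennreal ((g y - g (y + real j * h))\<^sup>2) \<partial>lborel)
      \<le> (\<integral>\<^sup>+y. ennreal (real j) * (\<Sum>i<j. ennreal ((?d i y)\<^sup>2)) \<partial>lborel)"
  proof (intro nn_integral_mono)
    fix y
    show "ennreal ((g y - g (y + real j * h))\<^sup>2) \<le> ennreal (real j) * (\<Sum>i<j. ennreal ((?d i y)\<^sup>2))"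
      using pw[of y] by (simp add: sum_ennreal ennreal_mult[symmetric] sum_nonneg del: of_nat_Suc)
  qed
  also have "\<dots> = ennreal (real j) * (\<Sum>i<j. (\<integral>\<^sup>+y. ennreal ((g y - g (y + h))\<^sup>2) \<partial>lborel))"
    by (simp add: nn_integral_cmult nn_integral_sum sh del: of_nat_Suc sum_ennreal)
  also have "\<dots> = ennreal ((real j)\<^sup>2) * (\<integral>\<^sup>+y. ennreal ((g y - g (y + h))\<^sup>2) \<partial>lborel)"
    by (simp add: power2_eq_square ennreal_mult mult.assoc ennreal_of_nat_eq_real_of_nat)
  finally show ?thesis .
qed

text \<open>A function that barely changes under the shift by \<open>h\<close> carries comparable mass on 32 disjoint
  translates of \<open>{-b..b}\<close>.\<close>
lemma small_shift_spread:
  assumes g: "nonneg_L2 g" and b: "0 < b" and beta: "1 \<le> \<beta>" and h: "1 / (4 * \<beta>) \<le> \<bar>h\<bar>"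
    and D: "(\<integral>\<^sup>+y. ennreal ((g y - g (y + h))\<^sup>2) \<partial>lborel) \<le> ennreal (4 * e)"
    and e: "0 \<le> e" "131072 * (8 * b + 2)\<^sup>2 * \<beta>\<^sup>2 * e \<le> sqnorm g"
  shows "sqnorm (\<lambda>y. g y * indicator {-b..b} y) \<le> sqnorm g / 8"
proof -
  note [measurable] = nonneg_L2D(1)[OF g]
  \<comment> \<open>\<open>p\<close> shifts by \<open>h\<close> move \<open>{-b..b}\<close> off
    itself, and \<open>\<bar>h\<bar> \<ge> 1 / (4 * \<beta>)\<close> keeps \<open>p\<close> of order
    \<beta>. The square of this count is the origin of the loss of order 1 / \<beta>^2 in each pair
    of steps.\<close>
  define p where "p = nat \<lceil>2 * b / \<bar>h\<bar>\<rceil> + 1"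
  have h0: "0 < \<bar>h\<bar>" using h beta by (smt (verit) divide_pos_pos)
  have p1: "2 * b < real p * \<bar>h\<bar>"
  proof -
    have "2 * b / \<bar>h\<bar> < real p" unfolding p_def by linarith
    then show ?thesis using h0 by (simp add: field_simps)
  qed
  have p2: "real p \<le> (8 * b + 2) * \<beta>"
  proof -
    have "2 * b / \<bar>h\<bar> \<ge> 0" using b by simp
    then have "real p \<le> 2 * b / \<bar>h\<bar> + 2" unfolding p_def by linarith
    also have "2 * b / \<bar>h\<bar> \<le> 2 * b / (1 / (4 * \<beta>))"
      using h b beta h0 by (intro divide_left_mono mult_pos_pos) auto
    also have "\<dots> + 2 \<le> (8 * b + 2) * \<beta>" using beta by (simp add: algebra_simps)
    finally show ?thesis by simp
  qed
  define m where "m = sqnorm (\<lambda>y. g y * indicator {-b..b} y)"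
  let ?I = "\<lambda>k::nat. {y. y - real (k * p) * h \<in> {-b..b}}"
  have m: "ennreal m = (\<integral>\<^sup>+y. ennreal ((g y * indicator {-b..b} y)\<^sup>2) \<partial>lborel)"
    unfolding m_def by (rule nn_integral_sq[symmetric, OF nonneg_L2_restrict(1)[OF g]]) simp
  \<comment> \<open>By u^2 \<le> 2 v^2 + 2 (u - v)^2, the mass on \<open>{-b..b}\<close> is at most
    twice the mass on the translate plus twice the cost of at most \<open>32 * p\<close>
    shifts.\<close>
  have k: "ennreal m \<le> 2 * (\<integral>\<^sup>+y. ennreal ((g y)\<^sup>2) * indicator (?I k) y \<partial>lborel) + ennreal (8 * (32 * real p)\<^sup>2 * e)"
    if "k \<le> 32" for k
  proof -
    let ?s = "real (k * p) * h"
    have "(\<integral>\<^sup>+y. ennreal ((g y * indicator {-b..b} y)\<^sup>2) \<partial>lborel)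
       \<le> (\<integral>\<^sup>+y. 2 * (ennreal ((g (y + ?s))\<^sup>2) * indicator {-b..b} y) + 2 * ennreal ((g y - g (y + ?s))\<^sup>2) \<partial>lborel)"
    proof (intro nn_integral_mono)
      fix y
      have "(g y)\<^sup>2 \<le> 2 * (g (y + ?s))\<^sup>2 + 2 * (g y - g (y + ?s))\<^sup>2"
        using zero_le_power2[of "g y - 2 * g (y + ?s)"] by (simp add: power2_eq_square algebra_simps)
      then show "ennreal ((g y * indicator {-b..b} y)\<^sup>2) \<le>
         2 * (ennreal ((g (y + ?s))\<^sup>2) * indicator {-b..b} y) + 2 * ennreal ((g y - g (y + ?s))\<^sup>2)"
        by (auto split: split_indicator simp: ennreal_mult[symmetric] ennreal_plus[symmetric]
            simp del: ennreal_plus simp flip: ennreal_numeral)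
    qed
    also have "\<dots> = 2 * (\<integral>\<^sup>+y. ennreal ((g (y + ?s))\<^sup>2) * indicator {-b..b} y \<partial>lborel)
        + 2 * (\<integral>\<^sup>+y. ennreal ((g y - g (y + ?s))\<^sup>2) \<partial>lborel)"
      by (simp add: nn_integral_add nn_integral_cmult)
    also have "(\<integral>\<^sup>+y. ennreal ((g (y + ?s))\<^sup>2) * indicator {-b..b} y \<partial>lborel)
        = (\<integral>\<^sup>+y. ennreal ((g y)\<^sup>2) * indicator (?I k) y \<partial>lborel)"
    proof -
      have "(\<integral>\<^sup>+y. ennreal ((g y)\<^sup>2) * indicator (?I k) y \<partial>lborel)
          = (\<integral>\<^sup>+y. ennreal ((g (?s + 1 * y))\<^sup>2) * indicator (?I k) (?s + 1 * y) \<partial>lborel)"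
        using nn_integral_real_affine[of "\<lambda>y. ennreal ((g y)\<^sup>2) * indicator (?I k) y" 1 ?s] by simp
      also have "\<dots> = (\<integral>\<^sup>+y. ennreal ((g (y + ?s))\<^sup>2) * indicator {-b..b} y \<partial>lborel)"
      proof (intro nn_integral_cong arg_cong2[where f = "(*)"])
        fix y :: real
        show "ennreal ((g (?s + 1 * y))\<^sup>2) = ennreal ((g (y + ?s))\<^sup>2)" by (simp add: add.commute)
        show "indicator (?I k) (?s + 1 * y) = (indicator {-b..b} y :: ennreal)"
          by (simp add: indicator_def)
      qed
      finally show ?thesis by simp
    qed
    also have "2 * (\<integral>\<^sup>+y. ennreal ((g y - g (y + ?s))\<^sup>2) \<partial>lborel) \<le> ennreal (8 * (32 * real p)\<^sup>2 * e)"
    proof -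
      have "(\<integral>\<^sup>+y. ennreal ((g y - g (y + ?s))\<^sup>2) \<partial>lborel) \<le> ennreal ((real (k * p))\<^sup>2) * ennreal (4 * e)"
        by (rule order_trans[OF nn_integral_shift_multiple mult_left_mono[OF D]]) auto
      also have "\<dots> = ennreal ((real (k * p))\<^sup>2 * (4 * e))" using e by (simp add: ennreal_mult)
      also have "\<dots> \<le> ennreal ((32 * real p)\<^sup>2 * (4 * e))"
        using that e by (intro ennreal_leI mult_right_mono power_mono) (auto intro: mult_right_mono)
      finally have "2 * (\<integral>\<^sup>+y. ennreal ((g y - g (y + ?s))\<^sup>2) \<partial>lborel) \<le> ennreal 2 * ennreal ((32 * real p)\<^sup>2 * (4 * e))"
        unfolding ennreal_numeral[symmetric] by (intro mult_left_mono) auto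
      also have "\<dots> = ennreal (8 * (32 * real p)\<^sup>2 * e)"
        using e by (subst ennreal_mult[symmetric]) (auto simp: mult_ac)
      finally show ?thesis .
    qed
    finally show ?thesis unfolding m by (simp add: add_left_mono)
  qed
  have disj: "disjoint_family_on ?I {1..32}"
    unfolding disjoint_family_on_def
  proof (intro ballI impI)
    fix i j :: nat assume ij: "i \<noteq> j"
    have "real p * \<bar>h\<bar> \<le> \<bar>real (i * p) * h - real (j * p) * h\<bar>"
    proof -
      have "\<bar>real (i * p) * h - real (j * p) * h\<bar> = \<bar>real i - real j\<bar> * (real p * \<bar>h\<bar>)"
        unfolding of_nat_mult abs_mult[symmetric] abs_abs left_diff_distrib[symmetric] mult.assoc
        by (simp add: abs_mult)
      moreover have "1 \<le> \<bar>real i - real j\<bar>" using ij by linarith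
      ultimately show ?thesis using mult_right_mono[of 1 "\<bar>real i - real j\<bar>" "real p * \<bar>h\<bar>"] by simp
    qed
    then show "?I i \<inter> ?I j = {}" using p1 by auto
  qed
  have "(\<Sum>k\<in>{1..32::nat}. (\<integral>\<^sup>+y. ennreal ((g y)\<^sup>2) * indicator (?I k) y \<partial>lborel))
      = (\<integral>\<^sup>+y. ennreal ((g y)\<^sup>2) * (\<Sum>k\<in>{1..32::nat}. indicator (?I k) y) \<partial>lborel)"
    by (subst nn_integral_sum[symmetric]) (auto simp: sum_distrib_left)
  also have "\<dots> \<le> (\<integral>\<^sup>+y. ennreal ((g y)\<^sup>2) * 1 \<partial>lborel)"
    by (subst indicator_UN_disjoint[symmetric, OF _ disj]) (auto intro!: nn_integral_mono mult_left_mono split: split_indicator)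
  finally have s: "(\<Sum>k\<in>{1..32::nat}. (\<integral>\<^sup>+y. ennreal ((g y)\<^sup>2) * indicator (?I k) y \<partial>lborel)) \<le> ennreal (sqnorm g)"
    using nn_integral_sq[OF g] by simp
  have "32 * ennreal m = (\<Sum>k\<in>{1..32::nat}. ennreal m)" by simp
  also have "\<dots> \<le> (\<Sum>k\<in>{1..32::nat}. 2 * (\<integral>\<^sup>+y. ennreal ((g y)\<^sup>2) * indicator (?I k) y \<partial>lborel) + ennreal (8 * (32 * real p)\<^sup>2 * e))"
    by (intro sum_mono k) auto
  also have "\<dots> = 2 * (\<Sum>k\<in>{1..32::nat}. (\<integral>\<^sup>+y. ennreal ((g y)\<^sup>2) * indicator (?I k) y \<partial>lborel)) + 32 * ennreal (8 * (32 * real p)\<^sup>2 * e)"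
    by (simp add: sum.distrib sum_distrib_left)
  also have "\<dots> \<le> 2 * ennreal (sqnorm g) + 32 * ennreal (8 * (32 * real p)\<^sup>2 * e)"
    by (intro add_mono mult_left_mono s) auto
  finally have "32 * m \<le> 2 * sqnorm g + 32 * (8 * (32 * real p)\<^sup>2 * e)"
    using e by (simp add: ennreal_mult[symmetric] ennreal_plus[symmetric] m_def del: ennreal_plus flip: ennreal_numeral)
  \<comment> \<open>With q = \<open>sqnorm g\<close>, the preceding inequality reads 32 m \<le> 2 q
    + 2^18 p^2 e. As 131072 = 2^17, the error is at most 2 q, hence m \<le> q / 8.\<close>
  moreover have "131072 * (real p)\<^sup>2 * e \<le> sqnorm g"
  proof -
    have "(real p)\<^sup>2 \<le> ((8 * b + 2) * \<beta>)\<^sup>2" using p2 by (intro power_mono) auto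
    then have "131072 * (real p)\<^sup>2 * e \<le> 131072 * ((8 * b + 2) * \<beta>)\<^sup>2 * e"
      using e by (intro mult_right_mono mult_left_mono) auto
    then show ?thesis using e by (simp add: power_mult_distrib mult.assoc)
  qed
  ultimately show ?thesis unfolding m_def[symmetric] by (simp add: power_mult_distrib)
qed

section \<open>Inversions and the two-step contraction\<close>

definition inversion :: "real \<Rightarrow> (real \<Rightarrow> real) \<Rightarrow> real \<Rightarrow> real" where
  "inversion \<alpha> f z = \<alpha> / \<bar>z\<bar> * f (\<alpha>\<^sup>2 / z)"

text \<open>Change of variables on the punctured line. It is carried out for the completed Lebesgue
  measure and transferred to \<open>lborel\<close> by Borel measurability.\<close>

lemma inversion_L2:
  assumes f: "nonneg_L2 f" and \<alpha>: "0 < \<alpha>"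
  shows "nonneg_L2 (inversion \<alpha> f)" "sqnorm (inversion \<alpha> f) = sqnorm f"
proof -
  note [measurable] = nonneg_L2D(1)[OF f]
  let ?S = "UNIV - {0::real}"
  let ?F = "\<lambda>x. (f x)\<^sup>2" and ?G = "\<lambda>x. (inversion \<alpha> f x)\<^sup>2"
  have Fint: "integrable lebesgue ?F" "integral\<^sup>L lebesgue ?F = sqnorm f"
    using nonneg_L2D(3)[OF f] by (auto simp: integrable_completion integral_completion sqnorm_def)
  have Gm [measurable]: "inversion \<alpha> f \<in> borel_measurable borel"
    unfolding inversion_def by measurable
  have img: "(\<lambda>x. \<alpha>\<^sup>2 / x) ` ?S = ?S"
  proof (intro equalityI subsetI)
    fix y assume "y \<in> ?S"
    then have "y = \<alpha>\<^sup>2 / (\<alpha>\<^sup>2 / y)" "\<alpha>\<^sup>2 / y \<in> ?S" using \<alpha> by auto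
    then show "y \<in> (\<lambda>x. \<alpha>\<^sup>2 / x) ` ?S" by blast
  qed (use \<alpha> in auto)
  have SF: "?F absolutely_integrable_on ?S"
    using Fint(1) set_integrable_subset[of lebesgue UNIV ?F ?S] by (simp add: set_integrable_def)
  have IF: "integral ?S ?F = sqnorm f"
  proof -
    have "integral ?S ?F = integral UNIV ?F"
      by (rule integral_spike_set) (auto intro: negligible_subset[of "{0}"])
    also have "\<dots> = sqnorm f"
      using Fint set_lebesgue_integral_eq_integral(2)[of UNIV ?F]
      by (simp add: set_integrable_def set_lebesgue_integral_def)
    finally show ?thesis .
  qed
  have der: "((\<lambda>x. \<alpha>\<^sup>2 / x) has_field_derivative - \<alpha>\<^sup>2 / x\<^sup>2) (at x within ?S)" if "x \<in> ?S" for x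
    using that by (auto intro!: derivative_eq_intros simp: power2_eq_square)
  have inj: "inj_on (\<lambda>x. \<alpha>\<^sup>2 / x) ?S" using \<alpha> by (auto simp: inj_on_def field_simps)
  have "(\<lambda>x. \<bar>- \<alpha>\<^sup>2 / x\<^sup>2\<bar> * ?F (\<alpha>\<^sup>2 / x)) absolutely_integrable_on ?S \<and>
     integral ?S (\<lambda>x. \<bar>- \<alpha>\<^sup>2 / x\<^sup>2\<bar> * ?F (\<alpha>\<^sup>2 / x)) = sqnorm f"
    using has_absolute_integral_change_of_variables_1'[of ?S "\<lambda>x. \<alpha>\<^sup>2 / x" "\<lambda>x. - \<alpha>\<^sup>2 / x\<^sup>2" ?F "sqnorm f"]
      der inj SF IF img by auto
  moreover have eq: "(\<lambda>x. \<bar>- \<alpha>\<^sup>2 / x\<^sup>2\<bar> * ?F (\<alpha>\<^sup>2 / x)) = ?G"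
    by (auto simp: fun_eq_iff inversion_def power_mult_distrib power_divide abs_divide)
  ultimately have G: "?G absolutely_integrable_on ?S" "integral ?S ?G = sqnorm f" by simp_all
  \<comment> \<open>At 0 the inverted function is 0, as \<open>\<alpha> / \<bar>0\<bar> = 0\<close>,
    so removing this point changes nothing.\<close>
  have ind: "(\<lambda>x. indicat_real ?S x *\<^sub>R ?G x) = ?G"
    by (auto simp: fun_eq_iff inversion_def split: split_indicator)
  have Gint: "integrable lebesgue ?G" using G(1) unfolding set_integrable_def ind .
  have Gl: "integrable lborel ?G" using Gint by (subst (asm) integrable_completion) auto
  show "nonneg_L2 (inversion \<alpha> f)"
    using Gl nonneg_L2D(2)[OF f] \<alpha> by (auto simp: nonneg_L2_def inversion_def)
  have "sqnorm (inversion \<alpha> f) = integral\<^sup>L lebesgue ?G"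
    unfolding sqnorm_def by (rule integral_completion[symmetric]) simp
  also have "\<dots> = integral ?S ?G"
    using set_lebesgue_integral_eq_integral(2)[OF G(1)] unfolding set_lebesgue_integral_def ind .
  finally show "sqnorm (inversion \<alpha> f) = sqnorm f" using G(2) by simp
qed

text \<open>The radius b = R + V + A serves twice: averaging on \<open>{-A..A}\<close> reads only
  \<open>{-b..b}\<close>, and the second inversion maps the outside of \<open>{-b..b}\<close> into
  \<open>{-A..A}\<close>, as \<open>\<alpha>2\<close> is at most \<open>A\<close> and A <
  \<bar>z\<bar>. If the conclusion failed, both averagings would lose little, so one eighth bounds
  would hold inside \<open>{-b..b}\<close> for both inverted functions. The second would then have
  squared norm at most its own eighth plus an eighth of that of \<open>f\<close>, far below the 3/4
  that a small loss leaves.\<close>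

lemma two_step_contraction:
  assumes N1: "bounded_law N1 \<beta> V" and N2: "bounded_law N2 \<beta> V" and f: "nonneg_L2 f"
    and \<alpha>1: "0 < \<alpha>1" and \<alpha>2: "0 < \<alpha>2" "\<alpha>2 \<le> A" and t: "\<bar>t\<bar> \<le> R" and V: "0 \<le> V"
    and \<epsilon>: "\<epsilon> = 1 / (131072 * (8 * (R + V + A) + 2)\<^sup>2)"
  shows "sqnorm (avg N2 t (inversion \<alpha>2 (avg N1 t (inversion \<alpha>1 f)))) \<le> (1 - \<epsilon> / \<beta>\<^sup>2) * sqnorm f"
proof -
  interpret N1: bounded_law N1 \<beta> V by fact
  interpret N2: bounded_law N2 \<beta> V by fact
  define b where "b = R + V + A"
  define g1 where "g1 = inversion \<alpha>1 f"
  define f1 where "f1 = avg N1 t g1"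
  define g2 where "g2 = inversion \<alpha>2 f1"
  define f2 where "f2 = avg N2 t g2"
  define \<theta> where "\<theta> = \<epsilon> / \<beta>\<^sup>2"
  have g1: "nonneg_L2 g1" "sqnorm g1 = sqnorm f" unfolding g1_def by (rule inversion_L2[OF f \<alpha>1])+
  have f1: "nonneg_L2 f1" "sqnorm f1 \<le> sqnorm g1" unfolding f1_def by (rule N1.avg_L2[OF g1(1)])+
  have g2: "nonneg_L2 g2" "sqnorm g2 = sqnorm f1" unfolding g2_def by (rule inversion_L2[OF f1(1) \<alpha>2(1)])+
  have f2: "sqnorm f2 \<le> sqnorm g2" unfolding f2_def by (rule N2.avg_L2[OF g2(1)])
  have b: "0 < b" "A < b \<or> A = b" "0 < A" using t V \<alpha>2 by (auto simp: b_def)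
  have \<theta>: "0 < \<theta>" "\<theta> \<le> 1 / 4"
  proof -
    have "\<epsilon> > 0" unfolding \<epsilon> using b(1) by (simp add: b_def)
    then show "0 < \<theta>" unfolding \<theta>_def using N1.beta by simp
    have "1 \<le> (8 * b + 2)\<^sup>2" using b(1) by (intro one_le_power) auto
    then have "\<epsilon> \<le> 1 / 4" unfolding \<epsilon> b_def[symmetric] by (intro frac_le) auto
    moreover have "1 \<le> \<beta>\<^sup>2" using N1.beta by (intro one_le_power) auto
    then have "\<theta> \<le> \<epsilon>" unfolding \<theta>_def using \<open>\<epsilon> > 0\<close> by (simp add: divide_le_eq)
    ultimately show "\<theta> \<le> 1 / 4" by simp
  qed
  have key: "131072 * (8 * b + 2)\<^sup>2 * \<beta>\<^sup>2 * (\<theta> * q) = q" for q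
    unfolding \<theta>_def \<epsilon> b_def[symmetric] using b(1) N1.beta by simp
  have spread: "sqnorm (\<lambda>y. g y * indicator {-b..b} y) \<le> sqnorm g / 8"
    if N: "bounded_law N \<beta> V" and g: "nonneg_L2 g" and gt: "(1 - \<theta>) * sqnorm g < sqnorm (avg N t g)" for N g
  proof -
    interpret N: bounded_law N \<beta> V by fact
    have "sqnorm g - sqnorm (avg N t g) < \<theta> * sqnorm g" using gt by (simp add: algebra_simps)
    from N.ex_small_shift[OF g this] obtain h where
      "1 / (4 * \<beta>) \<le> \<bar>h\<bar>" "(\<integral>\<^sup>+y. ennreal ((g y - g (y + h))\<^sup>2) \<partial>lborel) \<le> ennreal (4 * (\<theta> * sqnorm g))" by blast
    then show ?thesis
      by (rule small_shift_spread[OF g b(1) N.beta]) (use \<theta> in \<open>auto simp: key\<close>)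
  qed
  have "sqnorm f2 \<le> (1 - \<theta>) * sqnorm f"
  proof (rule ccontr)
    assume "\<not> ?thesis"
    then have c: "(1 - \<theta>) * sqnorm f < sqnorm f2" by simp
    have a1: "(1 - \<theta>) * sqnorm g1 < sqnorm (avg N1 t g1)"
      using c f2 g2 g1 by (simp add: f1_def)
    have "(1 - \<theta>) * sqnorm g2 \<le> (1 - \<theta>) * sqnorm f"
      using g2 f1 g1 \<theta> by (intro mult_left_mono) auto
    then have a2: "(1 - \<theta>) * sqnorm g2 < sqnorm (avg N2 t g2)" using c by (simp add: f2_def)
    have s1: "sqnorm (\<lambda>y. g1 y * indicator {-b..b} y) \<le> sqnorm f / 8"
      using spread[OF N1 g1(1) a1] g1 by simp
    have s2: "sqnorm (\<lambda>y. g2 y * indicator {-b..b} y) \<le> sqnorm g2 / 8"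
      using spread[OF N2 g2(1) a2] .
    have s3: "sqnorm (\<lambda>y. f1 y * indicator {-A..A} y) \<le> sqnorm f / 8"
      using N1.avg_L2_local[OF g1(1), of t A b] s1 t by (simp add: f1_def b_def)
    let ?k = "\<lambda>y. f1 y * indicator {-A..A} y"
    have k: "nonneg_L2 ?k" by (rule nonneg_L2_restrict[OF f1(1)]) simp
    have pw: "g2 z * indicator (- {-b..b}) z = inversion \<alpha>2 ?k z * indicator (- {-b..b}) z" for z
    proof -
      have "\<alpha>2\<^sup>2 / z \<in> {-A..A}" if "z \<notin> {-b..b}"
      proof -
        have z: "b < \<bar>z\<bar>" using that by auto
        have "\<alpha>2\<^sup>2 \<le> A * A" unfolding power2_eq_square using \<alpha>2 by (intro mult_mono) auto
        also have "\<dots> \<le> A * \<bar>z\<bar>" using z b by (intro mult_left_mono) auto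
        finally have "\<bar>\<alpha>2\<^sup>2 / z\<bar> \<le> A" using z b by (simp add: abs_divide divide_le_eq)
        then have "\<alpha>2\<^sup>2 / z \<le> A" "- (\<alpha>2\<^sup>2 / z) \<le> A" unfolding abs_le_iff by blast+
        then show ?thesis by (intro atLeastAtMost_iff[THEN iffD2] conjI) linarith+
      qed
      then show ?thesis by (simp add: g2_def inversion_def split: split_indicator)
    qed
    have "sqnorm (\<lambda>z. g2 z * indicator (- {-b..b}) z) \<le> sqnorm (inversion \<alpha>2 ?k)"
      unfolding pw by (rule nonneg_L2_restrict(2)[OF inversion_L2(1)[OF k \<alpha>2(1)]]) simp
    also have "\<dots> \<le> sqnorm f / 8" using inversion_L2(2)[OF k \<alpha>2(1)] s3 by simp
    finally have "sqnorm g2 \<le> sqnorm g2 / 8 + sqnorm f / 8"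
      using sqnorm_split[OF g2(1), of "{-b..b}"] s2 by (simp only: borel_closed closed_atLeastAtMost)
    moreover have "(1 - \<theta>) * sqnorm f < sqnorm g2" using c f2 by simp
    moreover have "(3 / 4) * sqnorm f \<le> (1 - \<theta>) * sqnorm f" using \<theta> by (intro mult_right_mono) auto
    ultimately show False using sqnorm_nonneg[of f] by linarith
  qed
  then show ?thesis by (simp add: f2_def g2_def f1_def g1_def \<theta>_def)
qed

section \<open>Riccati variables and iterated kernels\<close>

text \<open>If \<open>\<psi>\<close> solves \<open>\<alpha> (i + 1) * \<psi> (i + 1) + \<alpha> i * \<psi> (i - 1) = v i * \<psi> i\<close> and vanishes at \<open>m + j + 1\<close>, then
  \<open>riccati \<alpha> v j m\<close> is \<open>\<alpha> (m + 1) * \<psi> (m + 1) / \<psi> m\<close>, provided that \<open>\<psi>\<close> has no zero in between.\<close>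
fun riccati :: "(nat \<Rightarrow> real) \<Rightarrow> (nat \<Rightarrow> real) \<Rightarrow> nat \<Rightarrow> nat \<Rightarrow> real" where
  "riccati \<alpha> v 0 m = 0"
| "riccati \<alpha> v (Suc j) m = (\<alpha> (Suc m))\<^sup>2 / (v (Suc m) - riccati \<alpha> v j (Suc m))"

lemma riccati_cong: "(\<And>i. m < i \<Longrightarrow> v i = v' i) \<Longrightarrow> riccati \<alpha> v j m = riccati \<alpha> v' j m"
  by (induction j arbitrary: m) simp_all

lemma riccati_measurable [measurable]:
  assumes [measurable]: "\<And>i. (\<lambda>x. v x i) \<in> borel_measurable M"
  shows "(\<lambda>x. riccati \<alpha> (v x) j m) \<in> borel_measurable M"
  by (induction j arbitrary: m) simp_all

text \<open>For the solution \<psi> described at \<open>riccati\<close> with \<psi> (L + 1) = 0 and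
  without zeros in between, this is \<bar>\<psi> n / \<psi> m\<bar>. The depth \<open>L - i\<close>
  at \<open>i\<close> makes all Riccati variables refer to the same boundary point.\<close>

definition decay_factor :: "(nat \<Rightarrow> real) \<Rightarrow> (nat \<Rightarrow> real) \<Rightarrow> nat \<Rightarrow> nat \<Rightarrow> nat \<Rightarrow> real" where
  "decay_factor \<alpha> v L m n = (\<Prod>i\<in>{Suc m..n}. \<alpha> i / \<bar>v i - riccati \<alpha> v (L - i) i\<bar>)"

lemma decay_factor_Suc:
  assumes "m < n"
  shows "decay_factor \<alpha> v L m n = \<alpha> (Suc m) / \<bar>v (Suc m) - riccati \<alpha> v (L - Suc m) (Suc m)\<bar> * decay_factor \<alpha> v L (Suc m) n"
  unfolding decay_factor_def using assms by (subst prod.atLeast_Suc_atMost) auto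

lemma decay_factor_cong:
  assumes "\<And>i. m < i \<Longrightarrow> v i = v' i"
  shows "decay_factor \<alpha> v L m n = decay_factor \<alpha> v' L m n"
  unfolding decay_factor_def using assms
  by (intro prod.cong) (auto cong: riccati_cong intro!: arg_cong2[where f = "(/)"] arg_cong[where f = abs] arg_cong2[where f = "(-)"] riccati_cong)

lemma decay_factor_nonneg: "(\<And>i. 0 \<le> \<alpha> i) \<Longrightarrow> 0 \<le> decay_factor \<alpha> v L m n"
  unfolding decay_factor_def by (intro prod_nonneg) auto

lemma decay_factor_measurable [measurable]:
  assumes [measurable]: "\<And>i. (\<lambda>x. v x i) \<in> borel_measurable M"
  shows "(\<lambda>x. decay_factor \<alpha> (v x) L m n) \<in> borel_measurable M"
  unfolding decay_factor_def by measurable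

text \<open>A coordinate of a product measure may be replaced by an independent copy. In this form a
  site is integrated out while the ambient measure stays the full product, so the index set is never
  split.\<close>

lemma nn_integral_resample:
  fixes N :: "'i \<Rightarrow> 'a measure"
  assumes N: "\<And>i. prob_space (N i)" and [measurable]: "G \<in> borel_measurable (PiM UNIV N)"
  shows "(\<integral>\<^sup>+w. G w \<partial>PiM UNIV N) = (\<integral>\<^sup>+w. (\<integral>\<^sup>+x. G (w(i := x)) \<partial>N i) \<partial>PiM UNIV N)"
proof -
  interpret Ni: prob_space "N i" by (rule N)
  interpret P: prob_space "PiM UNIV N" by (rule prob_space_PiM) (rule N)
  interpret pair_sigma_finite "N i" "PiM UNIV N" ..
  have eq: "PiM UNIV N = distr (N i \<Otimes>\<^sub>M PiM UNIV N) (PiM UNIV N) (\<lambda>(x, X). X(i := x))"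
    using distr_pair_PiM_eq_PiM[of UNIV N i] N by simp
  have m [measurable]: "(\<lambda>(x, X). X(i := x)) \<in> measurable (N i \<Otimes>\<^sub>M PiM UNIV N) (PiM UNIV N)"
    using measurable_add_dim[of i UNIV N] measurable_pair_swap_iff[of "\<lambda>(x, X). X(i := x)" "N i" "PiM UNIV N"]
    by (simp add: case_prod_beta' insert_UNIV)
  have "(\<integral>\<^sup>+w. G w \<partial>PiM UNIV N) = (\<integral>\<^sup>+p. G ((snd p)(i := fst p)) \<partial>(N i \<Otimes>\<^sub>M PiM UNIV N))"
    by (subst eq, subst nn_integral_distr) (auto simp: case_prod_beta')
  also have "\<dots> = (\<integral>\<^sup>+w. (\<integral>\<^sup>+x. G (w(i := x)) \<partial>N i) \<partial>PiM UNIV N)"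
    using m by (subst nn_integral_snd[symmetric]) (auto simp: case_prod_beta')
  finally show ?thesis .
qed

section \<open>Iterated kernels and the decay of their expectation\<close>

definition bump :: "real \<Rightarrow> real \<Rightarrow> real" where
  "bump \<epsilon> z = indicator {-\<epsilon><..<\<epsilon>} z / (2 * \<epsilon>)"

lemma bump_nonneg: "0 < \<epsilon> \<Longrightarrow> 0 \<le> bump \<epsilon> z" by (simp add: bump_def)

lemma bump_measurable [measurable]: "bump \<epsilon> \<in> borel_measurable borel"
  unfolding bump_def by measurable

lemma nn_integral_bump: "0 < \<epsilon> \<Longrightarrow> (\<integral>\<^sup>+z. ennreal (bump \<epsilon> z) \<partial>lborel) = 1"
proof -
  assume e: "0 < \<epsilon>"
  have "(\<integral>\<^sup>+z. ennreal (bump \<epsilon> z) \<partial>lborel) = (\<integral>\<^sup>+z. ennreal (1 / (2 * \<epsilon>)) * indicator {-\<epsilon><..<\<epsilon>} z \<partial>lborel)"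
    by (intro nn_integral_cong) (auto simp: bump_def split: split_indicator)
  also have "\<dots> = 1" using e by (simp add: nn_integral_cmult_indicator ennreal_mult[symmetric])
  finally show ?thesis .
qed

text \<open>The point is independence of \<epsilon>: the average is at most \<beta> and has integral
  1, so its square has integral at most \<beta>. The contraction property \<open>avg_L2\<close>
  alone would give 1 / (2 \<epsilon>).\<close>

lemma (in bounded_law) avg_bump:
  assumes e: "0 < \<epsilon>"
  shows "nonneg_L2 (avg N t (bump \<epsilon>))" "sqnorm (avg N t (bump \<epsilon>)) \<le> \<beta>"
    "ennreal (avg N t (bump \<epsilon>) y) = (\<integral>\<^sup>+x. ennreal (bump \<epsilon> (t - x - y)) \<partial>N)"
proof -
  have bound: "bump \<epsilon> z \<le> 1 / (2 * \<epsilon>)" for z using e by (auto simp: bump_def split: split_indicator)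
  have int: "integrable N (\<lambda>x. bump \<epsilon> (t - x - y))" for y
    using bound bump_nonneg[OF e]
    by (intro integrable_const_bound[where B = "1 / (2 * \<epsilon>)"]) auto
  have eq: "ennreal (avg N t (bump \<epsilon>) y) = (\<integral>\<^sup>+x. ennreal (bump \<epsilon> (t - x - y)) \<partial>N)" for y
    unfolding avg_def using bump_nonneg[OF e] by (intro nn_integral_eq_integral[symmetric] int) auto
  then show "ennreal (avg N t (bump \<epsilon>) y) = (\<integral>\<^sup>+x. ennreal (bump \<epsilon> (t - x - y)) \<partial>N)" .
  have pos: "0 \<le> avg N t (bump \<epsilon>) y" for y
    unfolding avg_def using bump_nonneg[OF e] by simp
  have le: "avg N t (bump \<epsilon>) y \<le> \<beta>" for y
  proof -
    have "ennreal (avg N t (bump \<epsilon>) y) \<le> ennreal \<beta> * (\<integral>\<^sup>+x. ennreal (bump \<epsilon> ((t - y) - x)) \<partial>lborel)"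
      unfolding eq using dominated[of "\<lambda>x. ennreal (bump \<epsilon> (t - x - y))"] by (simp add: algebra_simps)
    also have "\<dots> = ennreal \<beta>"
      using nn_integral_bump[OF e] nn_integral_reflect[of "\<lambda>x. ennreal (bump \<epsilon> x)" "t - y"] by simp
    finally show ?thesis using beta by simp
  qed
  have "(\<integral>\<^sup>+y. ennreal ((avg N t (bump \<epsilon>) y)\<^sup>2) \<partial>lborel) \<le> (\<integral>\<^sup>+y. ennreal \<beta> * ennreal (avg N t (bump \<epsilon>) y) \<partial>lborel)"
    using pos le beta by (intro nn_integral_mono) (auto simp: ennreal_mult[symmetric] power2_eq_square intro!: ennreal_leI mult_right_mono)
  also have "\<dots> = ennreal \<beta> * (\<integral>\<^sup>+y. ennreal (bump \<epsilon> y) \<partial>lborel)"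
    using nn_integral_swap_reflect[of "\<lambda>x. ennreal (bump \<epsilon> x)" t] by (simp add: nn_integral_cmult eq)
  finally have "(\<integral>\<^sup>+y. ennreal ((avg N t (bump \<epsilon>) y)\<^sup>2) \<partial>lborel) \<le> ennreal \<beta>"
    using nn_integral_bump[OF e] by simp
  from nonneg_L2I[OF _ pos this] beta
  show "nonneg_L2 (avg N t (bump \<epsilon>))" "sqnorm (avg N t (bump \<epsilon>)) \<le> \<beta>" by simp_all
qed

fun kernel_iter :: "(nat \<Rightarrow> real measure) \<Rightarrow> (nat \<Rightarrow> real) \<Rightarrow> real \<Rightarrow> (real \<Rightarrow> real) \<Rightarrow> nat \<Rightarrow> real \<Rightarrow> real" where
  "kernel_iter N \<alpha> t f 0 = f"
| "kernel_iter N \<alpha> t f (Suc m) = avg (N (Suc m)) t (inversion (\<alpha> (Suc m)) (kernel_iter N \<alpha> t f m))"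

text \<open>Steps are grouped in pairs; a leftover single step is only used as a contraction, hence
  \<open>m div 2\<close>.\<close>

lemma kernel_iter_bounds:
  assumes N: "\<And>i. 1 \<le> i \<Longrightarrow> i \<le> n \<Longrightarrow> bounded_law (N i) \<beta> V" and f: "nonneg_L2 f"
    and \<alpha>: "\<And>i. 0 < \<alpha> i" "\<And>i. \<alpha> i \<le> A" and t: "\<bar>t\<bar> \<le> R" and V: "0 \<le> V"
    and \<epsilon>: "\<epsilon> = 1 / (131072 * (8 * (R + V + A) + 2)\<^sup>2)"
  shows "m \<le> n \<Longrightarrow> nonneg_L2 (kernel_iter N \<alpha> t f m)"
    and "m \<le> n \<Longrightarrow> sqnorm (kernel_iter N \<alpha> t f m) \<le> (1 - \<epsilon> / \<beta>\<^sup>2) ^ (m div 2) * sqnorm f"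
proof -
  have L: "nonneg_L2 (kernel_iter N \<alpha> t f m)" if "m \<le> n" for m
    using that
  proof (induction m)
    case (Suc m)
    interpret bounded_law "N (Suc m)" \<beta> V by (rule N) (use Suc in auto)
    show ?case using Suc avg_L2(1) inversion_L2(1) \<alpha> by auto
  qed (use f in simp)
  show "nonneg_L2 (kernel_iter N \<alpha> t f m)" if "m \<le> n" using L that .
  have even: "2 * j \<le> n \<Longrightarrow> sqnorm (kernel_iter N \<alpha> t f (2 * j)) \<le> (1 - \<epsilon> / \<beta>\<^sup>2) ^ j * sqnorm f" for j
  proof (induction j)
    case (Suc j)
    have b: "bounded_law (N (Suc (2 * j))) \<beta> V" "bounded_law (N (Suc (Suc (2 * j)))) \<beta> V"
      using Suc.prems by (auto intro!: N)
    interpret bounded_law "N (Suc (2 * j))" \<beta> V by (rule b)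
    have "\<epsilon> / \<beta>\<^sup>2 \<le> 1"
    proof -
      have A: "0 < A" using \<alpha>[of 0] by simp
      have "1 \<le> 131072 * (8 * (R + V + A) + 2)\<^sup>2 * \<beta>\<^sup>2"
        using one_le_power[of "8 * (R + V + A) + 2" 2] one_le_power[OF beta, of 2] A t V
        by (intro mult_ge1_I) auto
      then show ?thesis unfolding \<epsilon> by (simp add: field_simps)
    qed
    then have p: "0 \<le> 1 - \<epsilon> / \<beta>\<^sup>2" by simp
    have "sqnorm (kernel_iter N \<alpha> t f (2 * Suc j)) \<le> (1 - \<epsilon> / \<beta>\<^sup>2) * sqnorm (kernel_iter N \<alpha> t f (2 * j))"
      using two_step_contraction[OF b(1,2) L[of "2 * j"] \<alpha>(1) \<alpha>(1) \<alpha>(2) t V \<epsilon>] Suc.prems by simp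
    also have "\<dots> \<le> (1 - \<epsilon> / \<beta>\<^sup>2) * ((1 - \<epsilon> / \<beta>\<^sup>2) ^ j * sqnorm f)"
      using Suc p by (intro mult_left_mono) auto
    finally show ?case by simp
  qed simp
  show "sqnorm (kernel_iter N \<alpha> t f m) \<le> (1 - \<epsilon> / \<beta>\<^sup>2) ^ (m div 2) * sqnorm f" if m: "m \<le> n"
  proof (cases "even m")
    case True then show ?thesis using even[of "m div 2"] m by simp
  next
    case False
    then obtain j where j: "m = Suc (2 * j)" by (metis oddE Suc_eq_plus1)
    interpret bounded_law "N (Suc (2 * j))" \<beta> V by (rule N) (use m j in auto)
    have "sqnorm (kernel_iter N \<alpha> t f m) \<le> sqnorm (kernel_iter N \<alpha> t f (2 * j))"
      using avg_L2(2)[OF inversion_L2(1)[OF L[of "2 * j"] \<alpha>(1)]] inversion_L2(2)[OF L[of "2 * j"] \<alpha>(1)] j m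
      by simp
    then show ?thesis using even[of j] j m by simp
  qed
qed

lemma avg_param_measurable:
  assumes "prob_space N" and [measurable_cong]: "sets N = sets borel" and [measurable]: "(\<lambda>(s, y). g s y) \<in> borel_measurable (borel \<Otimes>\<^sub>M borel)"
  shows "(\<lambda>(s, y). avg N t (inversion \<alpha> (g s)) y) \<in> borel_measurable (borel \<Otimes>\<^sub>M borel)"
proof -
  interpret prob_space N by fact
  show ?thesis unfolding avg_def inversion_def by measurable
qed

lemma kernel_iter_measurable:
  assumes N: "\<And>i. prob_space (N i)" "\<And>i. sets (N i) = sets borel"
    and g: "(\<lambda>(s, y). g s y) \<in> borel_measurable (borel \<Otimes>\<^sub>M borel)"
  shows "(\<lambda>(s, y). kernel_iter N \<alpha> t (g s) m y) \<in> borel_measurable (borel \<Otimes>\<^sub>M borel)"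
proof (induction m)
  case (Suc m)
  then show ?case using avg_param_measurable[OF N Suc] by simp
qed (use g in simp)

text \<open>\<open>s\<close> will be the Riccati variable of the other half-line and shifts the
  energy at site 0. The sites 0, ..., n are integrated out from the center outwards, which is
  possible because the Riccati variable at a site reads only sites further out. Sites 0 and n supply
  the initial L2 bound and the final supremum bound, at the price \<open>sqrt \<beta>\<close> each;
  the n - 1 sites between them supply the contraction.\<close>

lemma expectation_decay:
  fixes N :: "int \<Rightarrow> real measure" and site :: "nat \<Rightarrow> int" and s :: "(int \<Rightarrow> real) \<Rightarrow> real"
  assumes N: "\<And>i. prob_space (N i)" "\<And>i. sets (N i) = sets borel"
    and law: "\<And>i. i \<le> n \<Longrightarrow> bounded_law (N (site i)) \<beta> V"
    and inj: "inj site" and s_meas [measurable]: "s \<in> borel_measurable (PiM UNIV N)"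
    and s_indep: "\<And>w i x. s (w(site i := x)) = s w"
    and \<alpha>: "\<And>i. 0 < \<alpha> i" "\<And>i. \<alpha> i \<le> A" and t: "\<bar>t\<bar> \<le> R" and V: "0 \<le> V"
    and \<epsilon>: "\<epsilon> = 1 / (131072 * (8 * (R + V + A) + 2)\<^sup>2)"
    and e: "0 < e" and n: "1 \<le> n" "n \<le> L"
  shows "(\<integral>\<^sup>+w. ennreal (bump e (t - w (site 0) - riccati \<alpha> (\<lambda>i. t - w (site i)) L 0 - s w)
            * decay_factor \<alpha> (\<lambda>i. t - w (site i)) L 0 n) \<partial>PiM UNIV N)
    \<le> ennreal (\<beta> * sqrt ((1 - \<epsilon> / \<beta>\<^sup>2) ^ ((n - 1) div 2)))"
proof -
  let ?M = "PiM UNIV N"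
  let ?v = "\<lambda>w i. t - w (site i)"
  note [measurable_cong] = N(2)
  interpret P: prob_space ?M by (rule prob_space_PiM) (rule N)
  define F0 where "F0 u = avg (N (site 0)) (t - u) (bump e)" for u
  define F where "F u m = kernel_iter (\<lambda>i. N (site i)) \<alpha> t (F0 u) m" for u m
  interpret N0: bounded_law "N (site 0)" \<beta> V by (rule law) simp
  have refl_m: "(\<lambda>x::real. a - x - b) \<in> borel_measurable (N i)" for a b i
    by measurable
  note bump_m = measurable_compose[OF measurable_compose[OF refl_m bump_measurable] measurable_ennreal]
  have F0_meas: "(\<lambda>(u, y). F0 u y) \<in> borel_measurable (borel \<Otimes>\<^sub>M borel)"
    unfolding F0_def avg_def by measurable
  have F_meas: "(\<lambda>p. F (fst p) m (snd p)) \<in> borel_measurable (borel \<Otimes>\<^sub>M borel)" for m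
    using kernel_iter_measurable[OF N F0_meas] by (simp add: F_def case_prod_beta')
  have c [measurable]: "(\<lambda>w. w i) \<in> borel_measurable ?M" for i
    using measurable_component_singleton[of i UNIV N] N(2)[of i] by (simp cong: measurable_cong_sets)
  have F_meas' [measurable]: "(\<lambda>w. F (s w) m (y w)) \<in> borel_measurable ?M"
    if [measurable]: "y \<in> borel_measurable ?M" for m y
    using measurable_compose[OF _ F_meas, of "\<lambda>w. (s w, y w)" ?M] by simp
  have F0_L2: "nonneg_L2 (F0 u)" "sqnorm (F0 u) \<le> \<beta>" for u
    unfolding F0_def by (rule N0.avg_bump[OF e])+
  have F_L2: "nonneg_L2 (F u m)" if "m \<le> n" for u m
    unfolding F_def by (rule kernel_iter_bounds(1)[OF _ F0_L2(1) \<alpha> t V \<epsilon> that]) (use law in auto)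
  \<comment> \<open>In \<open>S m\<close> the integrand no longer involves the sites 0, ..., m: they
    survive only in the function \<open>F (s w) m\<close>, evaluated at a Riccati variable that
    reads the sites beyond \<open>m\<close>.\<close>
  define S where "S m = (\<integral>\<^sup>+w. ennreal (F (s w) m (riccati \<alpha> (?v w) (L - m) m) * decay_factor \<alpha> (?v w) L m n) \<partial>?M)" for m
  have start: "(\<integral>\<^sup>+w. ennreal (bump e (t - w (site 0) - riccati \<alpha> (?v w) L 0 - s w)
            * decay_factor \<alpha> (?v w) L 0 n) \<partial>?M) = S 0"
  proof -
    have rc: "riccati \<alpha> (?v (w(site 0 := x))) L 0 = riccati \<alpha> (?v w) L 0" for w x
      by (rule riccati_cong) (simp add: inj_eq[OF inj])
    have dc: "decay_factor \<alpha> (?v (w(site 0 := x))) L 0 n = decay_factor \<alpha> (?v w) L 0 n" for w x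
      by (rule decay_factor_cong) (simp add: inj_eq[OF inj])
    have "(\<integral>\<^sup>+w. ennreal (bump e (t - w (site 0) - riccati \<alpha> (?v w) L 0 - s w)
            * decay_factor \<alpha> (?v w) L 0 n) \<partial>?M)
      = (\<integral>\<^sup>+w. (\<integral>\<^sup>+x. ennreal (bump e (t - x - riccati \<alpha> (?v w) L 0 - s w)
            * decay_factor \<alpha> (?v w) L 0 n) \<partial>N (site 0)) \<partial>?M)"
      by (subst nn_integral_resample[OF N(1), where i = "site 0"]) (simp_all only: rc dc s_indep fun_upd_same, measurable)
    also have "\<dots> = S 0"
      unfolding S_def
    proof (intro nn_integral_cong)
      fix w
      let ?y = "riccati \<alpha> (?v w) L 0" and ?d = "decay_factor \<alpha> (?v w) L 0 n"
      have d: "0 \<le> ?d" using \<alpha> by (intro decay_factor_nonneg less_imp_le) auto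
      have "(\<integral>\<^sup>+x. ennreal (bump e (t - x - ?y - s w) * ?d) \<partial>N (site 0))
          = (\<integral>\<^sup>+x. ennreal (bump e ((t - s w) - x - ?y)) * ennreal ?d \<partial>N (site 0))"
        using d bump_nonneg[OF e] by (intro nn_integral_cong) (simp add: ennreal_mult algebra_simps)
      also have "\<dots> = (\<integral>\<^sup>+x. ennreal (bump e ((t - s w) - x - ?y)) \<partial>N (site 0)) * ennreal ?d"
        by (rule nn_integral_multc[OF bump_m])
      also have "\<dots> = ennreal (F0 (s w) ?y) * ennreal ?d"
        by (simp add: N0.avg_bump(3)[OF e] F0_def)
      also have "\<dots> = ennreal (F0 (s w) ?y * ?d)" using d nonneg_L2D(2)[OF F0_L2(1)] by (simp add: ennreal_mult)
      finally show "(\<integral>\<^sup>+x. ennreal (bump e (t - x - ?y - s w) * ?d) \<partial>N (site 0))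
        = ennreal (F (s w) 0 (riccati \<alpha> (?v w) (L - 0) 0) * ?d)" by (simp add: F_def)
    qed
    finally show ?thesis .
  qed
  have step: "S m = S (Suc m)" if m: "m < n" for m
  proof -
    interpret Nm: bounded_law "N (site (Suc m))" \<beta> V by (rule law) (use m in simp)
    let ?i = "Suc m"
    let ?y = "\<lambda>w. riccati \<alpha> (?v w) (L - ?i) ?i" and ?d = "\<lambda>w. decay_factor \<alpha> (?v w) L ?i n"
    have rc: "?y (w(site ?i := x)) = ?y w" for w x by (rule riccati_cong) (simp add: inj_eq[OF inj])
    have dc: "?d (w(site ?i := x)) = ?d w" for w x by (rule decay_factor_cong) (simp add: inj_eq[OF inj])
    have Lm: "L - m = Suc (L - ?i)" using m n by simp
    \<comment> \<open>With z the denominator at the next site, the Riccati variable is \<alpha>^2 /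
      z and the first decay factor is \<alpha> / \<bar>z\<bar>; together they are the inversion at
      z.\<close>
    have pw: "F (s w) m (riccati \<alpha> (?v w) (L - m) m) * decay_factor \<alpha> (?v w) L m n
        = inversion (\<alpha> ?i) (F (s w) m) (t - w (site ?i) - ?y w) * ?d w" for w
      unfolding decay_factor_Suc[OF m] Lm riccati.simps inversion_def by simp
    have "S m = (\<integral>\<^sup>+w. ennreal (inversion (\<alpha> ?i) (F (s w) m) (t - w (site ?i) - ?y w) * ?d w) \<partial>?M)"
      unfolding S_def pw ..
    also have "\<dots> = (\<integral>\<^sup>+w. (\<integral>\<^sup>+x. ennreal (inversion (\<alpha> ?i) (F (s w) m) (t - x - ?y w) * ?d w) \<partial>N (site ?i)) \<partial>?M)"
      unfolding inversion_def
      by (subst nn_integral_resample[OF N(1), where i = "site ?i"]) (simp_all only: rc dc s_indep fun_upd_same, measurable)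
    also have "\<dots> = S (Suc m)"
      unfolding S_def
    proof (intro nn_integral_cong)
      fix w
      have d: "0 \<le> ?d w" using \<alpha> by (intro decay_factor_nonneg less_imp_le) auto
      have L2: "nonneg_L2 (inversion (\<alpha> ?i) (F (s w) m))"
        by (rule inversion_L2[OF F_L2 \<alpha>(1)]) (use m in simp)
      note inv_m = measurable_compose[OF measurable_compose[OF refl_m nonneg_L2D(1)[OF L2]] measurable_ennreal]
      have "(\<integral>\<^sup>+x. ennreal (inversion (\<alpha> ?i) (F (s w) m) (t - x - ?y w) * ?d w) \<partial>N (site ?i))
          = (\<integral>\<^sup>+x. ennreal (inversion (\<alpha> ?i) (F (s w) m) (t - x - ?y w)) * ennreal (?d w) \<partial>N (site ?i))"
        using d nonneg_L2D(2)[OF L2] by (intro nn_integral_cong) (simp add: ennreal_mult)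
      also have "\<dots> = (\<integral>\<^sup>+x. ennreal (inversion (\<alpha> ?i) (F (s w) m) (t - x - ?y w)) \<partial>N (site ?i)) * ennreal (?d w)"
        by (rule nn_integral_multc[OF inv_m])
      also have "\<dots> = ennreal (F (s w) (Suc m) (?y w)) * ennreal (?d w)"
        using Nm.avg_facts(7)[OF L2] by (simp add: F_def)
      also have "\<dots> = ennreal (F (s w) (Suc m) (?y w) * ?d w)"
        using d nonneg_L2D(2)[OF F_L2[of "Suc m"]] m by (simp add: ennreal_mult)
      finally show "(\<integral>\<^sup>+x. ennreal (inversion (\<alpha> ?i) (F (s w) m) (t - x - ?y w) * ?d w) \<partial>N (site ?i))
          = ennreal (F (s w) (Suc m) (?y w) * ?d w)" .
    qed
    finally show ?thesis .
  qed
  have "S 0 = S m" if "m \<le> n" for m using that by (induction m) (auto simp: step)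
  then have "S 0 = S n" by simp
  also have "\<dots> \<le> (\<integral>\<^sup>+w. ennreal (\<beta> * sqrt ((1 - \<epsilon> / \<beta>\<^sup>2) ^ ((n - 1) div 2))) \<partial>?M)"
    unfolding S_def
  proof (intro nn_integral_mono ennreal_leI)
    fix w
    obtain m where m: "n = Suc m" using n by (cases n) auto
    interpret Nn: bounded_law "N (site (Suc m))" \<beta> V by (rule law) (use m in simp)
    have L2: "nonneg_L2 (inversion (\<alpha> (Suc m)) (F u m))" for u
      by (rule inversion_L2[OF F_L2 \<alpha>(1)]) (use m in simp)
    have q: "sqnorm (inversion (\<alpha> (Suc m)) (F u m)) = sqnorm (F u m)" for u
      by (rule inversion_L2[OF F_L2 \<alpha>(1)]) (use m in simp)
    have F_le: "F u n y \<le> sqrt (\<beta> * sqnorm (F u m))" for u y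
      using Nn.avg_facts(6)[OF L2[of u], of t y] unfolding q by (simp add: F_def m)
    have s0: "sqnorm (F u m) \<le> (1 - \<epsilon> / \<beta>\<^sup>2) ^ (m div 2) * sqnorm (F0 u)" for u
      unfolding F_def by (rule kernel_iter_bounds(2)[OF _ F0_L2(1) \<alpha> t V \<epsilon>, where n = n]) (use law m in auto)
    have p: "0 \<le> (1 - \<epsilon> / \<beta>\<^sup>2)"
    proof -
      have A: "0 < A" using \<alpha>[of 0] by simp
      have "1 \<le> 131072 * (8 * (R + V + A) + 2)\<^sup>2 * \<beta>\<^sup>2"
        using one_le_power[of "8 * (R + V + A) + 2" 2] one_le_power[OF N0.beta, of 2] A t V
        by (intro mult_ge1_I) auto
      then show ?thesis unfolding \<epsilon> by (simp add: field_simps)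
    qed
    have "sqnorm (F u m) \<le> (1 - \<epsilon> / \<beta>\<^sup>2) ^ (m div 2) * \<beta>" for u
      using s0[of u] mult_left_mono[OF F0_L2(2)[of u], of "(1 - \<epsilon> / \<beta>\<^sup>2) ^ (m div 2)"] p by simp
    then have "F u n y \<le> sqrt (\<beta> * ((1 - \<epsilon> / \<beta>\<^sup>2) ^ (m div 2) * \<beta>))" for u y
      using N0.beta by (intro order_trans[OF F_le] real_sqrt_le_mono mult_left_mono) auto
    also have "sqrt (\<beta> * ((1 - \<epsilon> / \<beta>\<^sup>2) ^ (m div 2) * \<beta>)) = \<beta> * sqrt ((1 - \<epsilon> / \<beta>\<^sup>2) ^ (m div 2))"
      using N0.beta by (simp add: real_sqrt_mult)
    finally show "F (s w) n (riccati \<alpha> (?v w) (L - n) n) * decay_factor \<alpha> (?v w) L n n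
        \<le> \<beta> * sqrt ((1 - \<epsilon> / \<beta>\<^sup>2) ^ ((n - 1) div 2))"
      by (simp add: decay_factor_def m)
  qed
  also have "\<dots> = ennreal (\<beta> * sqrt ((1 - \<epsilon> / \<beta>\<^sup>2) ^ ((n - 1) div 2)))"
    using P.emeasure_space_1 by simp
  finally show ?thesis unfolding start .
qed

section \<open>Orthonormal eigenbases of symmetric matrices\<close>

text \<open>Tychonoff's theorem. It serves twice: to maximize a quadratic form over the unit sphere
  of a finite set of sites, and to extract limits of box eigenvectors.\<close>

lemma compact_cube: "compact {f :: 'i \<Rightarrow> real. \<forall>i. \<bar>f i\<bar> \<le> B}"
proof -
  have "compactin (product_topology (\<lambda>i::'i. euclidean) UNIV) (PiE UNIV (\<lambda>i. {-B..B}))"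
    by (subst compactin_PiE) auto
  moreover have "PiE UNIV (\<lambda>i::'i. {-B..B}) = {f :: 'i \<Rightarrow> real. \<forall>i. \<bar>f i\<bar> \<le> B}"
    by (auto simp: PiE_def Pi_def abs_le_iff minus_le_iff)
  ultimately show ?thesis by (simp add: euclidean_product_topology)
qed

definition ip :: "'i set \<Rightarrow> ('i \<Rightarrow> real) \<Rightarrow> ('i \<Rightarrow> real) \<Rightarrow> real" where
  "ip S f g = (\<Sum>i\<in>S. f i * g i)"

lemma ip_commute: "ip S f g = ip S g f"
  by (simp add: ip_def mult.commute)

lemma ip_add: "ip S (\<lambda>i. f i + g i) h = ip S f h + ip S g h"
  and ip_diff: "ip S (\<lambda>i. f i - g i) h = ip S f h - ip S g h"
  and ip_scale: "ip S (\<lambda>i. c * f i) h = c * ip S f h"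
  and ip_sum: "ip S (\<lambda>i. \<Sum>k\<in>K. F k i) h = (\<Sum>k\<in>K. ip S (F k) h)"
  by (simp_all add: ip_def algebra_simps sum.distrib sum_subtractf sum_distrib_left sum_distrib_right)
    (rule sum.swap)

lemma ip_add2: "ip S h (\<lambda>i. f i + g i) = ip S h f + ip S h g"
  and ip_diff2: "ip S h (\<lambda>i. f i - g i) = ip S h f - ip S h g"
  and ip_scale2: "ip S h (\<lambda>i. c * f i) = c * ip S h f"
  and ip_sum2: "ip S h (\<lambda>i. \<Sum>k\<in>K. F k i) = (\<Sum>k\<in>K. ip S h (F k))"
  using ip_add[of S f g h] ip_diff[of S f g h] ip_scale[of S c f h] ip_sum[of S F K h]
  by (simp_all add: ip_commute)

lemmas ip_linear = ip_add ip_diff ip_scale ip_sum ip_add2 ip_diff2 ip_scale2 ip_sum2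

lemma ip_self_nonneg: "0 \<le> ip S f f"
  by (simp add: ip_def sum_nonneg)

lemma ip_self_eq_0: "finite S \<Longrightarrow> ip S f f = 0 \<longleftrightarrow> (\<forall>i\<in>S. f i = 0)"
  by (simp add: ip_def sum_nonneg_eq_0_iff)

definition orthonormal :: "'i set \<Rightarrow> ('i \<Rightarrow> real) set \<Rightarrow> bool" where
  "orthonormal S F \<longleftrightarrow> finite F \<and> (\<forall>\<phi>\<in>F. \<forall>i. i \<notin> S \<longrightarrow> \<phi> i = 0)
     \<and> (\<forall>\<phi>\<in>F. \<forall>\<psi>\<in>F. ip S \<phi> \<psi> = (if \<phi> = \<psi> then 1 else 0))"

lemma orthonormal_expansion_defect:
  assumes F: "orthonormal S F"
  defines "g \<equiv> \<lambda>f i. f i - (\<Sum>\<phi>\<in>F. ip S f \<phi> * \<phi> i)"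
  shows "ip S (g f) (g f) = ip S f f - (\<Sum>\<phi>\<in>F. (ip S f \<phi>)\<^sup>2)"
    and "\<phi> \<in> F \<Longrightarrow> ip S (g f) \<phi> = 0"
proof -
  have fin: "finite F" and on: "\<And>\<phi> \<psi>. \<phi> \<in> F \<Longrightarrow> \<psi> \<in> F \<Longrightarrow> ip S \<phi> \<psi> = (if \<phi> = \<psi> then 1 else 0)"
    using F by (auto simp: orthonormal_def)
  have orth: "ip S (g f) \<phi> = 0" if "\<phi> \<in> F" for \<phi>
  proof -
    have "ip S (g f) \<phi> = ip S f \<phi> - (\<Sum>\<psi>\<in>F. ip S f \<psi> * ip S \<psi> \<phi>)"
      unfolding g_def by (simp add: ip_linear)
    also have "(\<Sum>\<psi>\<in>F. ip S f \<psi> * ip S \<psi> \<phi>) = (\<Sum>\<psi>\<in>F. if \<psi> = \<phi> then ip S f \<psi> else 0)"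
      using on that by (intro sum.cong) auto
    finally show ?thesis using fin that by simp
  qed
  then show "\<phi> \<in> F \<Longrightarrow> ip S (g f) \<phi> = 0" .
  have "ip S (g f) (g f) = ip S (g f) f - (\<Sum>\<phi>\<in>F. ip S f \<phi> * ip S (g f) \<phi>)"
    by (subst (2) g_def) (simp add: ip_linear)
  also have "\<dots> = ip S (g f) f" using orth by simp
  also have "\<dots> = ip S f f - (\<Sum>\<phi>\<in>F. (ip S f \<phi>)\<^sup>2)"
    unfolding g_def by (simp add: ip_linear power2_eq_square) (simp add: ip_commute)
  finally show "ip S (g f) (g f) = ip S f f - (\<Sum>\<phi>\<in>F. (ip S f \<phi>)\<^sup>2)" .
qed

lemma ip_delta: "finite S \<Longrightarrow> i \<in> S \<Longrightarrow> ip S (\<lambda>j. if j = i then 1 else 0) f = f i"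
  unfolding ip_def by (subst sum.mono_neutral_cong_right[where S = "{i}" and h = f]) auto

lemma orthonormal_pointwise:
  assumes "orthonormal S F" "finite S" "i \<in> S"
  shows "(\<Sum>\<phi>\<in>F. (\<phi> i)\<^sup>2) \<le> 1"
  using orthonormal_expansion_defect(1)[OF assms(1), of "\<lambda>j. if j = i then 1 else 0"]
    ip_self_nonneg[of S "\<lambda>j. (if j = i then 1 else 0) - (\<Sum>\<phi>\<in>F. ip S (\<lambda>j. if j = i then 1 else 0) \<phi> * \<phi> j)"] assms
  by (simp add: ip_delta)

lemma orthonormal_card:
  assumes "orthonormal S F" "finite S"
  shows "card F \<le> card S"
proof -
  have "real (card F) = (\<Sum>\<phi>\<in>F. ip S \<phi> \<phi>)" using assms by (simp add: orthonormal_def)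
  also have "\<dots> = (\<Sum>i\<in>S. \<Sum>\<phi>\<in>F. (\<phi> i)\<^sup>2)"
    unfolding ip_def power2_eq_square by (rule sum.swap)
  also have "\<dots> \<le> (\<Sum>i\<in>S. 1)" by (rule sum_mono) (rule orthonormal_pointwise[OF assms])
  finally show ?thesis by simp
qed

text \<open>First order condition at a maximum. The test value
  \<open>p / (\<bar>q\<bar> + 1)\<close> works for either sign of \<open>q\<close>.\<close>

lemma quadratic_nonpos_imp_linear_zero:
  fixes p q :: real
  assumes "\<And>t. 2 * t * p + t\<^sup>2 * q \<le> 0"
  shows "p = 0"
proof (rule ccontr)
  assume p: "p \<noteq> 0"
  have pos: "0 < \<bar>q\<bar> + 1" by simp
  define t where "t = p / (\<bar>q\<bar> + 1)"
  have "t\<^sup>2 * q \<ge> - (t\<^sup>2 * \<bar>q\<bar>)" by (metis abs_ge_minus_self abs_mult abs_power2 minus_le_iff)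
  moreover have "t * p = t\<^sup>2 * \<bar>q\<bar> + t\<^sup>2"
  proof -
    have "p = t * (\<bar>q\<bar> + 1)" using pos by (simp add: t_def)
    then have "t * p = t * (t * (\<bar>q\<bar> + 1))" by simp
    then show ?thesis by (simp add: power2_eq_square algebra_simps)
  qed
  moreover have "0 \<le> t\<^sup>2 * \<bar>q\<bar>" by simp
  moreover have "0 < t\<^sup>2" using p pos by (simp add: t_def)
  ultimately show False using assms[of t] unfolding mult.assoc by linarith
qed

text \<open>The quadratic form of \<open>M\<close> is maximized over the unit vectors orthogonal to
  \<open>F\<close>, of which \<open>v\<close> provides one. As \<open>M\<close> is symmetric and
  \<open>F\<close> consists of eigenvectors, the complement is invariant, so the Lagrange condition
  within the complement is the full eigenvalue equation.\<close>

lemma ex_eigenvector_orthogonal: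
  fixes M :: "'i \<Rightarrow> 'i \<Rightarrow> real"
  assumes S: "finite S" and sym: "\<And>i j. M i j = M j i"
    and F: "orthonormal S F" and eig: "\<And>\<phi>. \<phi> \<in> F \<Longrightarrow> \<exists>e. \<forall>i\<in>S. (\<Sum>j\<in>S. M i j * \<phi> j) = e * \<phi> i"
    and v: "\<And>\<phi>. \<phi> \<in> F \<Longrightarrow> ip S v \<phi> = 0" "i0 \<in> S" "v i0 \<noteq> 0"
  shows "\<exists>u e. (\<forall>i. i \<notin> S \<longrightarrow> u i = 0) \<and> ip S u u = 1 \<and> (\<forall>\<phi>\<in>F. ip S u \<phi> = 0) \<and> (\<forall>i\<in>S. (\<Sum>j\<in>S. M i j * u j) = e * u i)"
proof -
  define T where "T f i = (\<Sum>j\<in>S. M i j * f j)" for f i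
  have T_sym: "ip S (T f) g = ip S f (T g)" for f g
  proof -
    have "ip S (T f) g = (\<Sum>i\<in>S. \<Sum>j\<in>S. M i j * f j * g i)"
      by (simp add: ip_def T_def sum_distrib_right)
    also have "\<dots> = (\<Sum>j\<in>S. \<Sum>i\<in>S. M i j * f j * g i)" by (rule sum.swap)
    also have "\<dots> = ip S f (T g)"
      unfolding ip_def T_def sum_distrib_left
      by (intro sum.cong refl) (simp add: sym[of i j for i j] mult_ac)
    finally show ?thesis .
  qed
  have T_add: "T (\<lambda>i. f i + t * g i) = (\<lambda>i. T f i + t * T g i)" for f g t
    by (simp add: T_def fun_eq_iff algebra_simps sum.distrib sum_distrib_left)
  define W where "W = {f. (\<forall>i. i \<notin> S \<longrightarrow> f i = 0) \<and> (\<forall>\<phi>\<in>F. ip S f \<phi> = 0)}"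
  define K where "K = {f. \<forall>i. \<bar>f i\<bar> \<le> 1} \<inter> (\<Inter>i\<in>-S. {f. f i = 0}) \<inter> (\<Inter>\<phi>\<in>F. {f. ip S f \<phi> = 0}) \<inter> {f. ip S f f = 1}"
  have cont_ip: "continuous_on UNIV (\<lambda>f. ip S (h f) (k f))"
    if "\<And>i. continuous_on UNIV (\<lambda>f. h f i)" "\<And>i. continuous_on UNIV (\<lambda>f. k f i)" for h k :: "('i \<Rightarrow> real) \<Rightarrow> 'i \<Rightarrow> real"
    unfolding ip_def by (intro continuous_intros that)
  have co: "continuous_on UNIV (\<lambda>f::'i \<Rightarrow> real. f i)" for i by simp
  have "compact K"
    unfolding K_def
    by (intro compact_Int_closed compact_cube closed_INT ballI closed_Collect_eq cont_ip co continuous_on_const)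
  moreover have K_eq: "f \<in> K \<longleftrightarrow> f \<in> W \<and> ip S f f = 1" for f
  proof -
    have "\<bar>f i\<bar> \<le> 1" if "f \<in> W" "ip S f f = 1" for i
    proof (cases "i \<in> S")
      case True
      have "f i * f i \<le> ip S f f" unfolding ip_def using S True by (intro member_le_sum) auto
      then show ?thesis using that by (simp add: abs_square_le_1 power2_eq_square[symmetric])
    qed (use that in \<open>auto simp: W_def\<close>)
    then show ?thesis by (auto simp: K_def W_def)
  qed
  moreover have "K \<noteq> {}"
  proof -
    define v' where "v' i = (if i \<in> S then v i else 0)" for i
    have e: "ip S v' g = ip S v g" for g by (simp add: ip_def v'_def)
    have "v' \<in> W" using v(1) unfolding W_def by (simp add: e) (simp add: v'_def)
    moreover have "ip S v' v' \<noteq> 0" using v S by (subst ip_self_eq_0) (auto simp: v'_def)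
    then have p: "0 < ip S v' v'" using ip_self_nonneg[of S v'] by linarith
    let ?u = "\<lambda>i. inverse (sqrt (ip S v' v')) * v' i"
    have "ip S ?u ?u = 1" unfolding ip_scale ip_scale2 using p by (simp add: field_simps)
    moreover have "?u \<in> W" using \<open>v' \<in> W\<close> by (auto simp: W_def ip_linear)
    ultimately show ?thesis using K_eq by blast
  qed
  moreover have "continuous_on K (\<lambda>f. ip S f (T f))"
    by (rule continuous_on_subset[OF cont_ip]) (auto simp: T_def intro!: continuous_intros co)
  ultimately obtain u where u: "u \<in> K" and max: "\<And>f. f \<in> K \<Longrightarrow> ip S f (T f) \<le> ip S u (T u)"
    using continuous_attains_sup[of K "\<lambda>f. ip S f (T f)"] by blast
  define e where "e = ip S u (T u)"
  have uW: "u \<in> W" and u1: "ip S u u = 1" using u K_eq by auto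
  have max': "ip S f (T f) \<le> e * ip S f f" if "f \<in> W" for f
  proof (cases "ip S f f = 0")
    case True
    then have "ip S f (T f) = 0" using S by (simp add: ip_self_eq_0) (simp add: ip_def)
    then show ?thesis using True by simp
  next
    case False
    then have p: "0 < ip S f f" using ip_self_nonneg[of S f] by linarith
    define c where "c = inverse (sqrt (ip S f f))"
    have c2: "c * c = inverse (ip S f f)" using p by (simp add: c_def inverse_mult_distrib[symmetric])
    let ?g = "\<lambda>i. c * f i"
    have "?g \<in> K" unfolding K_eq using that p c2 by (auto simp: W_def ip_linear mult.assoc[symmetric])
    then have "ip S ?g (T ?g) \<le> e" using max by (simp add: e_def)
    moreover have "T ?g = (\<lambda>i. c * T f i)" by (simp add: T_def fun_eq_iff sum_distrib_left mult_ac)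
    ultimately have "c * c * ip S f (T f) \<le> e" by (simp add: ip_linear mult.assoc)
    then show ?thesis using p by (simp add: c2 field_simps)
  qed
  have orth: "ip S w (T u) = e * ip S w u" if w: "w \<in> W" for w
  proof -
    have "ip S w (T u) - e * ip S w u = 0"
    proof (rule quadratic_nonpos_imp_linear_zero)
      fix t
      have "(\<lambda>i. u i + t * w i) \<in> W" using w uW by (auto simp: W_def ip_linear)
      from max'[OF this] have "ip S u (T u) + t * ip S u (T w) + t * (ip S w (T u) + t * ip S w (T w))
          \<le> e * (ip S u u + t * ip S u w + t * (ip S w u + t * ip S w w))"
        by (simp add: T_add ip_linear)
      moreover have "ip S u (T w) = ip S w (T u)" using T_sym[of u w] by (simp add: ip_commute)
      moreover have "ip S u w = ip S w u" by (rule ip_commute)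
      ultimately show "2 * t * (ip S w (T u) - e * ip S w u) + t\<^sup>2 * (ip S w (T w) - e * ip S w w) \<le> 0"
        using u1 by (simp add: e_def[symmetric] algebra_simps power2_eq_square)
    qed
    then show ?thesis by simp
  qed
  \<comment> \<open>The residual of \<open>u\<close> itself lies in the complement, so
    \<open>orth\<close> applied to it shows that its norm is 0.\<close>
  define w where "w i = (if i \<in> S then T u i - e * u i else 0)" for i
  have we: "ip S w g = ip S (\<lambda>i. T u i - e * u i) g" for g by (simp add: ip_def w_def)
  have "ip S w \<phi> = 0" if "\<phi> \<in> F" for \<phi>
  proof -
    obtain e' where e': "\<forall>i\<in>S. T \<phi> i = e' * \<phi> i" using eig[OF \<open>\<phi> \<in> F\<close>] by (auto simp: T_def)
    have "ip S (T u) \<phi> = ip S u (T \<phi>)" by (rule T_sym)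
    also have "\<dots> = e' * ip S u \<phi>" using e' by (simp add: ip_def sum_distrib_left mult_ac)
    finally show ?thesis using uW that unfolding we by (simp add: ip_linear W_def)
  qed
  then have "w \<in> W" by (simp add: W_def w_def)
  from orth[OF this] have "ip S w w = 0"
    by (subst ip_commute, subst we) (simp add: ip_linear ip_commute)
  then have "\<forall>i\<in>S. T u i = e * u i" using S by (simp add: ip_self_eq_0 w_def)
  then show ?thesis using uW u1 by (intro exI[of _ u] exI[of _ e]) (auto simp: W_def T_def)
qed

text \<open>An orthonormal set of eigenvectors of maximal cardinality leaves no nonzero vector
  orthogonal to it. Completeness is read off from the expansion defects of the unit vectors.\<close>

lemma symmetric_eigenbasis:
  fixes M :: "'i \<Rightarrow> 'i \<Rightarrow> real"
  assumes S: "finite S" and sym: "\<And>i j. M i j = M j i"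
  shows "\<exists>F. orthonormal S F \<and> (\<forall>\<phi>\<in>F. \<exists>e. \<forall>i\<in>S. (\<Sum>j\<in>S. M i j * \<phi> j) = e * \<phi> i)
     \<and> (\<forall>i\<in>S. \<forall>j\<in>S. (\<Sum>\<phi>\<in>F. \<phi> i * \<phi> j) = (if i = j then 1 else 0))"
proof -
  define P where "P F \<longleftrightarrow> orthonormal S F \<and> (\<forall>\<phi>\<in>F. \<exists>e. \<forall>i\<in>S. (\<Sum>j\<in>S. M i j * \<phi> j) = e * \<phi> i)" for F
  have "P {}" by (simp add: P_def orthonormal_def)
  moreover have "\<forall>F. P F \<longrightarrow> card F \<le> card S"
    using orthonormal_card S by (auto simp: P_def)
  ultimately obtain F where F: "P F" and max: "\<And>G. P G \<Longrightarrow> card G \<le> card F"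
    using ex_has_greatest_nat[of P "{}" card "Suc (card S)"] by (auto simp: less_Suc_eq_le)
  have on: "orthonormal S F" using F by (simp add: P_def)
  have no: "v i = 0" if v: "\<And>\<phi>. \<phi> \<in> F \<Longrightarrow> ip S v \<phi> = 0" "i \<in> S" for v i
  proof (rule ccontr)
    assume "v i \<noteq> 0"
    then obtain u e where u: "\<forall>i. i \<notin> S \<longrightarrow> u i = 0" "ip S u u = 1" "\<forall>\<phi>\<in>F. ip S u \<phi> = 0"
      "\<forall>i\<in>S. (\<Sum>j\<in>S. M i j * u j) = e * u i"
      using ex_eigenvector_orthogonal[where S = S and M = M and F = F and v = v and ?i0.0 = i, OF S sym on] F v by (auto simp: P_def)
    then have "u \<notin> F" by auto
    moreover have "\<forall>\<phi>\<in>F. ip S \<phi> u = 0" using u(3) by (simp add: ip_commute)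
    then have "P (insert u F)"
      using u F by (auto simp: P_def orthonormal_def)
    ultimately show False using max[of "insert u F"] on by (simp add: orthonormal_def)
  qed
  have "(\<Sum>\<phi>\<in>F. \<phi> i * \<phi> j) = (if i = j then 1 else 0)" if "i \<in> S" "j \<in> S" for i j
    using no[OF orthonormal_expansion_defect(2)[OF on], of j "\<lambda>j. if j = i then 1 else 0"] that S
    by (simp add: ip_delta split: if_splits)
  then show ?thesis using F by (auto simp: P_def)
qed

section \<open>Spectral averaging on a box\<close>

text \<open>\<open>sol \<alpha> v j m\<close> is the value at \<open>m\<close> of the solution of the same recurrence that is \<open>0\<close> at \<open>m + j\<close>
  and \<open>1\<close> at \<open>m + j - 1\<close>.\<close>
fun sol :: "(nat \<Rightarrow> real) \<Rightarrow> (nat \<Rightarrow> real) \<Rightarrow> nat \<Rightarrow> nat \<Rightarrow> real" where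
  "sol \<alpha> v 0 m = 0"
| "sol \<alpha> v (Suc 0) m = 1"
| "sol \<alpha> v (Suc (Suc j)) m =
     (v (Suc m) * sol \<alpha> v (Suc j) (Suc m) - \<alpha> (Suc (Suc m)) * sol \<alpha> v j (Suc (Suc m))) / \<alpha> (Suc m)"

lemma riccati_eq_sol:
  assumes \<alpha>: "\<And>i. 0 < \<alpha> i"
    and nz: "\<And>i. i \<le> j \<Longrightarrow> sol \<alpha> v (Suc i) (m + j - i) \<noteq> 0"
  shows "riccati \<alpha> v j m = \<alpha> (Suc m) * sol \<alpha> v j (Suc m) / sol \<alpha> v (Suc j) m"
  using nz
proof (induction j arbitrary: m)
  case (Suc j)
  have IH: "riccati \<alpha> v j (Suc m) = \<alpha> (Suc (Suc m)) * sol \<alpha> v j (Suc (Suc m)) / sol \<alpha> v (Suc j) (Suc m)"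
    using Suc.prems by (intro Suc.IH) (metis add_Suc_shift le_SucI)
  have nz: "sol \<alpha> v (Suc j) (Suc m) \<noteq> 0" using Suc.prems[of j] by simp
  have a: "\<alpha> (Suc m) \<noteq> 0" using \<alpha>[of "Suc m"] by simp
  have "v (Suc m) - riccati \<alpha> v j (Suc m) = \<alpha> (Suc m) * sol \<alpha> v (Suc (Suc j)) m / sol \<alpha> v (Suc j) (Suc m)"
    using nz a by (simp add: IH field_simps)
  then show ?case using nz a by (simp add: power2_eq_square)
qed simp

lemma decay_factor_eq_sol:
  assumes \<alpha>: "\<And>i. 0 < \<alpha> i"
    and nz: "\<And>i. i \<le> L \<Longrightarrow> sol \<alpha> v (Suc i) (L - i) \<noteq> 0" and n: "n \<le> L"
  shows "decay_factor \<alpha> v L 0 n = \<bar>sol \<alpha> v (Suc L - n) n / sol \<alpha> v (Suc L) 0\<bar>"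
  using n
proof (induction n)
  case 0
  then show ?case using nz[of L] by (simp add: decay_factor_def)
next
  case (Suc n)
  let ?j = "L - Suc n"
  have r: "riccati \<alpha> v (Suc ?j) n = \<alpha> (Suc n) * sol \<alpha> v (Suc ?j) (Suc n) / sol \<alpha> v (Suc (Suc ?j)) n"
    using Suc.prems nz by (intro riccati_eq_sol \<alpha>) auto
  have Ln: "Suc ?j = L - n" "Suc (Suc ?j) = Suc L - n" "Suc ?j = Suc L - Suc n" using Suc.prems by auto
  have n1: "sol \<alpha> v (Suc (Suc ?j)) n \<noteq> 0" using nz[of "Suc ?j"] Suc.prems by simp
  have n2: "sol \<alpha> v (Suc ?j) (Suc n) \<noteq> 0" using nz[of ?j] Suc.prems by simp
  have a: "\<alpha> (Suc n) > 0" by (rule \<alpha>)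
  have f: "\<alpha> (Suc n) / \<bar>v (Suc n) - riccati \<alpha> v ?j (Suc n)\<bar> = \<bar>sol \<alpha> v (Suc ?j) (Suc n) / sol \<alpha> v (Suc (Suc ?j)) n\<bar>"
  proof -
    have "(\<alpha> (Suc n))\<^sup>2 / (v (Suc n) - riccati \<alpha> v ?j (Suc n)) = \<alpha> (Suc n) * (sol \<alpha> v (Suc ?j) (Suc n) / sol \<alpha> v (Suc (Suc ?j)) n)"
      using r by (simp del: sol.simps)
    then have "\<alpha> (Suc n) / (v (Suc n) - riccati \<alpha> v ?j (Suc n)) = sol \<alpha> v (Suc ?j) (Suc n) / sol \<alpha> v (Suc (Suc ?j)) n"
      using a by (simp add: power2_eq_square del: sol.simps times_divide_eq_right add: times_divide_eq_right[symmetric])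
    then show ?thesis using a by (metis abs_divide abs_of_pos)
  qed
  have "decay_factor \<alpha> v L 0 (Suc n) = decay_factor \<alpha> v L 0 n * (\<alpha> (Suc n) / \<bar>v (Suc n) - riccati \<alpha> v ?j (Suc n)\<bar>)"
    by (simp add: decay_factor_def)
  also have "\<dots> = \<bar>sol \<alpha> v (Suc L - n) n / sol \<alpha> v (Suc L) 0\<bar> * \<bar>sol \<alpha> v (Suc ?j) (Suc n) / sol \<alpha> v (Suc L - n) n\<bar>"
    using Suc f Ln by simp
  also have "\<dots> = \<bar>sol \<alpha> v (Suc L - Suc n) (Suc n) / sol \<alpha> v (Suc L) 0\<bar>"
    using n1[unfolded Ln(2)] unfolding Ln(3) abs_mult[symmetric] by (simp add: field_simps del: sol.simps)
  finally show ?case .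
qed

text \<open>Discrete Green identity for two energies with the same boundary condition at
  \<open>m + j\<close>. Divided by the product of both solutions at \<open>m\<close>, it gives the
  difference quotient of the Riccati variable in the energy, whose limit is, up to sign, a sum of
  squares.\<close>

lemma sol_wronskian:
  fixes x :: "nat \<Rightarrow> real" and e E :: real
  assumes \<alpha>: "\<And>i. 0 < \<alpha> i"
  defines "u \<equiv> \<lambda>E j m. sol \<alpha> (\<lambda>i. E - x i) j m"
  shows "\<alpha> (Suc m) * (u e j (Suc m) * u E (Suc j) m - u e (Suc j) m * u E j (Suc m))
     = (E - e) * (\<Sum>i<j. u e (Suc i) (m + j - i) * u E (Suc i) (m + j - i))"
proof (induction j arbitrary: m)
  case (Suc j)
  have rec: "\<alpha> (Suc m) * u E (Suc (Suc j)) m = (E - x (Suc m)) * u E (Suc j) (Suc m) - \<alpha> (Suc (Suc m)) * u E j (Suc (Suc m))" for E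
    using \<alpha>[of "Suc m"] by (simp add: u_def)
  have "\<alpha> (Suc m) * (u e (Suc j) (Suc m) * u E (Suc (Suc j)) m - u e (Suc (Suc j)) m * u E (Suc j) (Suc m))
      = u e (Suc j) (Suc m) * (\<alpha> (Suc m) * u E (Suc (Suc j)) m) - (\<alpha> (Suc m) * u e (Suc (Suc j)) m) * u E (Suc j) (Suc m)"
    by (simp add: algebra_simps)
  also have "\<dots> = (E - e) * (u e (Suc j) (Suc m) * u E (Suc j) (Suc m))
      + \<alpha> (Suc (Suc m)) * (u e j (Suc (Suc m)) * u E (Suc j) (Suc m) - u e (Suc j) (Suc m) * u E j (Suc (Suc m)))"
    unfolding rec by (simp add: algebra_simps)
  also have "\<dots> = (E - e) * (\<Sum>i<Suc j. u e (Suc i) (m + Suc j - i) * u E (Suc i) (m + Suc j - i))"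
    unfolding Suc.IH by (simp add: algebra_simps)
  finally show ?case .
qed (simp add: u_def)

text \<open>As a function of the energy, the solution over \<open>Suc j\<close> steps is a
  polynomial of degree \<open>j\<close>. It has finitely many zeros, so in a punctured neighborhood
  of any energy the Riccati variables are genuine quotients.\<close>

fun sol_poly :: "(nat \<Rightarrow> real) \<Rightarrow> (nat \<Rightarrow> real) \<Rightarrow> nat \<Rightarrow> nat \<Rightarrow> real poly" where
  "sol_poly \<alpha> x 0 m = 0"
| "sol_poly \<alpha> x (Suc 0) m = 1"
| "sol_poly \<alpha> x (Suc (Suc j)) m =
     smult (inverse (\<alpha> (Suc m))) ([:- x (Suc m), 1:] * sol_poly \<alpha> x (Suc j) (Suc m) - smult (\<alpha> (Suc (Suc m))) (sol_poly \<alpha> x j (Suc (Suc m))))"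

lemma poly_sol_poly: "poly (sol_poly \<alpha> x j m) E = sol \<alpha> (\<lambda>i. E - x i) j m"
  by (induction \<alpha> x j m rule: sol_poly.induct) (simp_all add: field_simps)

lemma sol_poly_degree:
  assumes \<alpha>: "\<And>i. 0 < \<alpha> i"
  shows "sol_poly \<alpha> x (Suc j) m \<noteq> 0 \<and> degree (sol_poly \<alpha> x (Suc j) m) = j"
proof (induction j arbitrary: m rule: less_induct)
  case (less j)
  show ?case
  proof (cases j)
    case (Suc i)
    let ?p = "sol_poly \<alpha> x (Suc i) (Suc m)" and ?q = "smult (\<alpha> (Suc (Suc m))) (sol_poly \<alpha> x i (Suc (Suc m)))"
    have p: "?p \<noteq> 0" "degree ?p = i" using less[of i "Suc m"] Suc by auto
    have d: "degree ([:- x (Suc m), 1:] * ?p) = Suc i" using p by (subst degree_mult_eq) auto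
    have q: "degree ?q < Suc i"
    proof (cases i)
      case (Suc l)
      then show ?thesis using less[of l "Suc (Suc m)"] \<open>j = Suc i\<close> by simp
    qed simp
    have "degree ([:- x (Suc m), 1:] * ?p - ?q) = Suc i"
      using degree_add_eq_left[of "- ?q" "[:- x (Suc m), 1:] * ?p"] d q by simp
    then have D: "degree (sol_poly \<alpha> x (Suc j) m) = j" using \<alpha>[of "Suc m"] Suc by simp
    then have "sol_poly \<alpha> x (Suc j) m \<noteq> 0" using Suc by (metis degree_0 nat.distinct(1))
    with D show ?thesis by blast
  qed simp
qed

lemma sol_isCont: "isCont (\<lambda>E. sol \<alpha> (\<lambda>i. E - x i) j m) e"
  unfolding poly_sol_poly[symmetric] by simp

lemma sol_eventually_nonzero:
  assumes "\<And>i. 0 < \<alpha> i"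
  shows "eventually (\<lambda>E. sol \<alpha> (\<lambda>i. E - x i) (Suc j) m \<noteq> 0) (at e)"
proof -
  have "finite {E. poly (sol_poly \<alpha> x (Suc j) m) E = 0}"
    using sol_poly_degree[OF assms] by (intro poly_roots_finite) auto
  then have "finite ({E. poly (sol_poly \<alpha> x (Suc j) m) E = 0} - {e})" by simp
  then have "open (- ({E. poly (sol_poly \<alpha> x (Suc j) m) E = 0} - {e}))"
    by (intro open_Compl finite_imp_closed)
  then have "eventually (\<lambda>E. E \<in> - ({E. poly (sol_poly \<alpha> x (Suc j) m) E = 0} - {e})) (at e)"
    by (intro eventually_at_in_open') auto
  moreover have "eventually (\<lambda>E. E \<noteq> e) (at e)" by (simp add: eventually_at_filter)
  ultimately show ?thesis by eventually_elim (simp add: poly_sol_poly)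
qed

section \<open>Half-line solutions and the slope of the Riccati variable\<close>

lemma chain_solution:
  assumes \<alpha>: "\<And>i. 0 < \<alpha> i" and end0: "\<psi> (Suc L) = 0"
    and eq: "\<And>m. 1 \<le> m \<Longrightarrow> m \<le> L \<Longrightarrow> \<alpha> (Suc m) * \<psi> (Suc m) + \<alpha> m * \<psi> (m - 1) + x m * \<psi> m = e * \<psi> m"
    and m: "m \<le> Suc L"
  shows "\<psi> m = \<psi> L * sol \<alpha> (\<lambda>i. e - x i) (Suc L - m) m"
proof -
  have "j \<le> Suc L \<Longrightarrow> \<psi> (Suc L - j) = \<psi> L * sol \<alpha> (\<lambda>i. e - x i) j (Suc L - j)" for j
  proof (induction j rule: less_induct)
    case (less j)
    consider "j = 0" | "j = 1" | i where "j = Suc (Suc i)" by (metis One_nat_def not0_implies_Suc)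
    then show ?case
    proof cases
      case 3
      define m where "m = Suc L - j"
      have m: "Suc L - i = Suc (Suc m)" "Suc L - Suc i = Suc m" "Suc m \<le> L" using less.prems 3 by (auto simp: m_def)
      have "\<psi> (Suc m) = \<psi> L * sol \<alpha> (\<lambda>i. e - x i) (Suc i) (Suc m)"
        "\<psi> (Suc (Suc m)) = \<psi> L * sol \<alpha> (\<lambda>i. e - x i) i (Suc (Suc m))"
        using less.IH[of "Suc i"] less.IH[of i] less.prems 3 m by auto
      moreover have "\<psi> m = ((e - x (Suc m)) * \<psi> (Suc m) - \<alpha> (Suc (Suc m)) * \<psi> (Suc (Suc m))) / \<alpha> (Suc m)"
        using eq[of "Suc m"] m(3) \<alpha>[of "Suc m"] by (simp add: field_simps)
      ultimately have "\<psi> m = \<psi> L * sol \<alpha> (\<lambda>i. e - x i) (Suc (Suc i)) m"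
        by (simp add: algebra_simps)
      then show ?thesis by (simp add: m_def 3)
    qed (use end0 in auto)
  qed
  from this[of "Suc L - m"] m show ?thesis by simp
qed

text \<open>\<psi> is a multiple of the one-sided solution at energy \<open>e\<close>, so the
  Wronskian identity compares its Riccati ratio with that at a nearby \<open>E\<close>. All claims
  concern punctured neighborhoods: only \<psi> 0 is known to be nonzero, and at \<open>e\<close>
  itself a zero of \<psi> further out may give the recursive definitions junk values.\<close>

lemma chain_limit:
  assumes \<alpha>: "\<And>i. 0 < \<alpha> i" and end0: "\<psi> (Suc L) = 0"
    and eq: "\<And>m. 1 \<le> m \<Longrightarrow> m \<le> L \<Longrightarrow> \<alpha> (Suc m) * \<psi> (Suc m) + \<alpha> m * \<psi> (m - 1) + x m * \<psi> m = e * \<psi> m"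
    and nz: "\<psi> 0 \<noteq> 0"
  obtains G where "(G \<longlongrightarrow> (\<Sum>m=1..L. (\<psi> m / \<psi> 0)\<^sup>2)) (at e)"
    "eventually (\<lambda>E. \<alpha> 1 * \<psi> 1 / \<psi> 0 - riccati \<alpha> (\<lambda>i. E - x i) L 0 = (E - e) * G E) (at e)"
    "\<And>n. n \<le> L \<Longrightarrow> ((\<lambda>E. decay_factor \<alpha> (\<lambda>i. E - x i) L 0 n) \<longlongrightarrow> \<bar>\<psi> n / \<psi> 0\<bar>) (at e)"
proof -
  define u where "u E j m = sol \<alpha> (\<lambda>i. E - x i) j m" for E j m
  have \<psi>: "\<psi> m = \<psi> L * u e (Suc L - m) m" if "m \<le> Suc L" for m
    using chain_solution[OF \<alpha> end0 eq that] by (simp add: u_def)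
  have nz': "\<psi> L \<noteq> 0" "u e (Suc L) 0 \<noteq> 0" using \<psi>[of 0] nz by auto
  have rat: "\<psi> m / \<psi> 0 = u e (Suc L - m) m / u e (Suc L) 0" if "m \<le> Suc L" for m
    unfolding \<psi>[OF that] using \<psi>[of 0] nz' by simp
  define G where "G E = (\<Sum>i<L. u e (Suc i) (L - i) * u E (Suc i) (L - i)) / (u e (Suc L) 0 * u E (Suc L) 0)" for E
  have lim: "((\<lambda>E. u E j m) \<longlongrightarrow> u e j m) (at e)" for j m
    using sol_isCont unfolding u_def isCont_def .
  have "(G \<longlongrightarrow> (\<Sum>i<L. u e (Suc i) (L - i) * u e (Suc i) (L - i)) / (u e (Suc L) 0 * u e (Suc L) 0)) (at e)"
    unfolding G_def using nz' by (intro tendsto_intros lim) auto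
  moreover have "(\<Sum>i<L. u e (Suc i) (L - i) * u e (Suc i) (L - i)) / (u e (Suc L) 0 * u e (Suc L) 0) = (\<Sum>m=1..L. (\<psi> m / \<psi> 0)\<^sup>2)"
    unfolding sum_divide_distrib
    by (rule sum.reindex_bij_witness[of _ "\<lambda>m. L - m" "\<lambda>i. L - i"])
      (auto simp: rat power2_eq_square Suc_diff_le)
  ultimately have 1: "(G \<longlongrightarrow> (\<Sum>m=1..L. (\<psi> m / \<psi> 0)\<^sup>2)) (at e)" by simp
  have ev: "eventually (\<lambda>E. \<forall>i\<in>{..L}. u E (Suc i) (L - i) \<noteq> 0) (at e)"
    unfolding u_def by (intro eventually_ball_finite ballI sol_eventually_nonzero \<alpha>) auto
  have 2: "eventually (\<lambda>E. \<alpha> 1 * \<psi> 1 / \<psi> 0 - riccati \<alpha> (\<lambda>i. E - x i) L 0 = (E - e) * G E) (at e)"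
    using ev
  proof eventually_elim
    case (elim E)
    have n0: "u E (Suc L) 0 \<noteq> 0" using elim by (metis atMost_iff diff_self_eq_0 order_refl)
    have "riccati \<alpha> (\<lambda>i. E - x i) L 0 = \<alpha> 1 * u E L 1 / u E (Suc L) 0"
      using riccati_eq_sol[where j = L and v = "\<lambda>i. E - x i" and m = 0, OF \<alpha>] elim by (simp add: u_def del: sol.simps)
    moreover have "\<alpha> 1 * \<psi> 1 / \<psi> 0 = \<alpha> 1 * u e L 1 / u e (Suc L) 0"
      using rat[of 1] by (simp add: times_divide_eq_right[symmetric] del: times_divide_eq_right)
    moreover have "\<alpha> 1 * (u e L 1 * u E (Suc L) 0 - u e (Suc L) 0 * u E L 1) = (E - e) * (\<Sum>i<L. u e (Suc i) (L - i) * u E (Suc i) (L - i))"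
      using sol_wronskian[where m = 0 and e = e and x = x and j = L and E = E, OF \<alpha>] by (simp add: u_def del: sol.simps)
    ultimately show ?case using n0 nz'
      unfolding G_def times_divide_eq_right by (simp add: field_simps)
  qed
  have 3: "((\<lambda>E. decay_factor \<alpha> (\<lambda>i. E - x i) L 0 n) \<longlongrightarrow> \<bar>\<psi> n / \<psi> 0\<bar>) (at e)" if n: "n \<le> L" for n
  proof (rule Lim_transform_eventually)
    show "((\<lambda>E. \<bar>u E (Suc L - n) n / u E (Suc L) 0\<bar>) \<longlongrightarrow> \<bar>\<psi> n / \<psi> 0\<bar>) (at e)"
      unfolding rat[OF le_SucI[OF n]] using nz' by (intro tendsto_intros lim)
    show "eventually (\<lambda>E. \<bar>u E (Suc L - n) n / u E (Suc L) 0\<bar> = decay_factor \<alpha> (\<lambda>i. E - x i) L 0 n) (at e)"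
      using ev by eventually_elim (subst decay_factor_eq_sol[OF \<alpha> _ n], auto simp: u_def)
  qed
  from 1 2 3 show ?thesis by (rule that)
qed

text \<open>The mass that \<open>bump \<epsilon> \<circ> W\<close> puts near a simple zero of \<open>W\<close> tends to the inverse slope.\<close>
lemma bump_mass_at_zero:
  assumes W: "eventually (\<lambda>E. W E = (E - e) * H E) (at e)" and H: "(H \<longlongrightarrow> h) (at e)" "0 < h"
    and D: "(D \<longlongrightarrow> d) (at e)" "0 < d" and B: "open B" "e \<in> B" and q: "0 < q" "q < 1"
  shows "eventually (\<lambda>i. ennreal (d / h * q\<^sup>2) \<le> (\<integral>\<^sup>+E\<in>B. ennreal (bump (1 / real (Suc i)) (W E) * D E) \<partial>lborel)) sequentially"
proof -
  have "eventually (\<lambda>E. H E < h / q) (at e)" using H q by (intro order_tendstoD(2)[OF H(1)]) (simp add: field_simps)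
  moreover have "eventually (\<lambda>E. 0 < H E) (at e)" by (rule order_tendstoD(1)[OF H])
  moreover have "eventually (\<lambda>E. d * q < D E) (at e)" using D q by (intro order_tendstoD(1)[OF D(1)]) simp
  moreover have "eventually (\<lambda>E. E \<in> B) (at e)" by (rule eventually_at_in_open'[OF B])
  ultimately have "eventually (\<lambda>E. \<bar>W E\<bar> \<le> \<bar>E - e\<bar> * (h / q) \<and> d * q \<le> D E \<and> E \<in> B) (at e)"
    using W by eventually_elim (simp add: abs_mult mult_left_mono del: times_divide_eq_right)
  then obtain r where r: "0 < r" and rr: "\<And>E. E \<noteq> e \<Longrightarrow> \<bar>E - e\<bar> < r \<Longrightarrow> \<bar>W E\<bar> \<le> \<bar>E - e\<bar> * (h / q) \<and> d * q \<le> D E \<and> E \<in> B"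
    unfolding eventually_at by (auto simp: dist_real_def)
  have "eventually (\<lambda>i. 1 / real (Suc i) < r * h / q) sequentially"
    using H q r by (intro order_tendstoD(2)[OF LIMSEQ_Suc[OF lim_1_over_n]]) auto
  then show ?thesis
  proof eventually_elim
    case (elim i)
    define \<epsilon> where "\<epsilon> = 1 / real (Suc i)"
    \<comment> \<open>On the punctured interval of radius \<rho> around \<open>e\<close>,
      \<bar>W\<bar> \<le> \<bar>E - e\<bar> h / q stays below \<epsilon>. The height d q / (2
      \<epsilon>) times the length 2 \<rho> is d q^2 / h; one factor q absorbs the error of the
      slope, the other that of \<open>D\<close>.\<close>
    define \<rho> where "\<rho> = \<epsilon> * q / h"
    have \<epsilon>: "0 < \<epsilon>" by (simp add: \<epsilon>_def)
    have el: "\<epsilon> < r * h / q" using elim by (simp only: \<epsilon>_def)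
    have \<rho>: "0 < \<rho>" "\<rho> < r" using el \<epsilon> q H by (auto simp: \<rho>_def field_simps)
    have "ennreal (d / h * q\<^sup>2) = ennreal (d * q / (2 * \<epsilon>)) * ennreal (2 * \<rho>)"
      using \<epsilon> D q H \<rho> by (subst ennreal_mult[symmetric]) (auto simp: \<rho>_def power2_eq_square field_simps)
    also have "\<dots> = (\<integral>\<^sup>+E. ennreal (d * q / (2 * \<epsilon>)) * indicator ({e - \<rho><..<e + \<rho>} - {e}) E \<partial>lborel)"
      using \<rho> by (subst nn_integral_cmult_indicator) (auto simp: emeasure_Diff)
    also have "\<dots> \<le> (\<integral>\<^sup>+E\<in>B. ennreal (bump \<epsilon> (W E) * D E) \<partial>lborel)"
    proof (intro nn_integral_mono)
      fix E
      show "ennreal (d * q / (2 * \<epsilon>)) * indicator ({e - \<rho><..<e + \<rho>} - {e}) E \<le> ennreal (bump \<epsilon> (W E) * D E) * indicator B E"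
      proof (cases "E \<in> {e - \<rho><..<e + \<rho>} - {e}")
        case True
        then have E: "E \<noteq> e" "\<bar>E - e\<bar> < \<rho>" by auto
        from rr[of E] E \<rho> have R: "\<bar>W E\<bar> \<le> \<bar>E - e\<bar> * (h / q)" "d * q \<le> D E" "E \<in> B" by auto
        have "\<bar>E - e\<bar> * (h / q) < \<rho> * (h / q)" using E H q by (intro mult_strict_right_mono) auto
        also have "\<dots> = \<epsilon>" using H q by (simp add: \<rho>_def)
        finally have "\<bar>W E\<bar> < \<epsilon>" using R by simp
        then have "W E \<in> {-\<epsilon><..<\<epsilon>}" by auto
        then have "bump \<epsilon> (W E) = 1 / (2 * \<epsilon>)" by (simp add: bump_def)
        then show ?thesis using True R \<epsilon> by (simp add: divide_right_mono ennreal_leI)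
      qed simp
    qed
    finally show ?case by (simp add: \<epsilon>_def)
  qed
qed


section \<open>The operator on a box, its eigenvalues and correlators\<close>

definition jac :: "(int \<Rightarrow> real) \<Rightarrow> (int \<Rightarrow> real) \<Rightarrow> (int \<Rightarrow> real) \<Rightarrow> int \<Rightarrow> real" where
  "jac a w \<phi> n = a n * \<phi> (n + 1) + a (n - 1) * \<phi> (n - 1) + w n * \<phi> n"

definition ibox :: "int \<Rightarrow> nat \<Rightarrow> int set" where
  "ibox k L = {k - int L..k + int L}"

lemma finite_ibox [simp]: "finite (ibox k L)"
  by (simp add: ibox_def)

text \<open>Orthonormal families vanish outside the box, so the equation for \<open>jac\<close> at
  the sites of the box is the Dirichlet restriction. The last clause is completeness.\<close>

definition eigenbasis :: "(int \<Rightarrow> real) \<Rightarrow> (int \<Rightarrow> real) \<Rightarrow> int \<Rightarrow> nat \<Rightarrow> (int \<Rightarrow> real) set \<Rightarrow> bool" where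
  "eigenbasis a w k L F \<longleftrightarrow> orthonormal (ibox k L) F
     \<and> (\<forall>\<phi>\<in>F. \<exists>e. \<forall>n\<in>ibox k L. jac a w \<phi> n = e * \<phi> n)
     \<and> (\<forall>i\<in>ibox k L. \<forall>j\<in>ibox k L. (\<Sum>\<phi>\<in>F. \<phi> i * \<phi> j) = (if i = j then 1 else 0))"

lemma ex_eigenbasis: "\<exists>F. eigenbasis a w k L F"
proof -
  define M where "M i j = (if j = i then w i else if j = i + 1 then a i else if i = j + 1 then a j else 0)" for i j :: int
  let ?S = "ibox k L"
  have sym: "M i j = M j i" for i j by (auto simp: M_def)
  obtain F where F: "orthonormal ?S F" "\<forall>\<phi>\<in>F. \<exists>e. \<forall>i\<in>?S. (\<Sum>j\<in>?S. M i j * \<phi> j) = e * \<phi> i"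
     "\<forall>i\<in>?S. \<forall>j\<in>?S. (\<Sum>\<phi>\<in>F. \<phi> i * \<phi> j) = (if i = j then 1 else 0)"
    using symmetric_eigenbasis[OF finite_ibox, of M k L] sym by blast
  have "(\<Sum>j\<in>?S. M i j * \<phi> j) = jac a w \<phi> i" if \<phi>: "\<phi> \<in> F" and i: "i \<in> ?S" for \<phi> i
  proof -
    have z: "\<phi> j = 0" if "j \<notin> ?S" for j using F(1) \<phi> that by (auto simp: orthonormal_def)
    have "(\<Sum>j\<in>?S. M i j * \<phi> j) = (\<Sum>j\<in>?S \<union> {i - 1, i, i + 1}. M i j * \<phi> j)"
      by (rule sum.mono_neutral_left) (auto simp: z)
    also have "\<dots> = (\<Sum>j\<in>{i - 1, i, i + 1}. M i j * \<phi> j)"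
      by (rule sum.mono_neutral_right) (auto simp: M_def)
    also have "\<dots> = jac a w \<phi> i" by (simp add: M_def jac_def)
    finally show ?thesis .
  qed
  then show ?thesis using F unfolding eigenbasis_def by (intro exI[of _ F]) auto
qed

text \<open>Compare both sides at a site where \<bar>\<phi>\<bar> is largest. The bound is
  independent of \<open>L\<close>, so one energy window serves all boxes.\<close>

lemma eigenvalue_bound:
  assumes on: "orthonormal (ibox k L) F" and f: "\<phi> \<in> F"
    and ev: "\<And>n. n \<in> ibox k L \<Longrightarrow> jac a w \<phi> n = e * \<phi> n"
    and a: "\<And>i. 0 < a i" "\<And>i. a i \<le> A" and w: "\<And>i. \<bar>w i\<bar> \<le> V"
  shows "\<bar>e\<bar> \<le> 2 * A + V"
proof -
  have z: "\<phi> j = 0" if "j \<notin> ibox k L" for j using on f that by (auto simp: orthonormal_def)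
  have ip1: "ip (ibox k L) \<phi> \<phi> = 1" using on f by (auto simp: orthonormal_def)
  have ne: "ibox k L \<noteq> {}" by (simp add: ibox_def)
  obtain p where p: "p \<in> ibox k L" "\<And>m. m \<in> ibox k L \<Longrightarrow> \<bar>\<phi> m\<bar> \<le> \<bar>\<phi> p\<bar>"
  proof -
    let ?M = "(\<lambda>m. \<bar>\<phi> m\<bar>) ` ibox k L"
    have "Max ?M \<in> ?M" using ne by (intro Max_in) auto
    then obtain p where "p \<in> ibox k L" "Max ?M = \<bar>\<phi> p\<bar>" by auto
    moreover have "\<bar>\<phi> m\<bar> \<le> Max ?M" if "m \<in> ibox k L" for m using that by (intro Max_ge) auto
    ultimately show ?thesis using that[of p] by simp
  qed
  have all: "\<bar>\<phi> m\<bar> \<le> \<bar>\<phi> p\<bar>" for m using p z by (cases "m \<in> ibox k L") auto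
  have pos: "0 < \<bar>\<phi> p\<bar>"
  proof (rule ccontr)
    assume "\<not> ?thesis"
    then have "\<phi> m = 0" for m using all[of m] by simp
    then show False using ip1 by (simp add: ip_def)
  qed
  have "\<bar>e\<bar> * \<bar>\<phi> p\<bar> = \<bar>jac a w \<phi> p\<bar>" using ev[OF p(1)] by (simp add: abs_mult)
  also have "\<dots> \<le> \<bar>a p * \<phi> (p + 1)\<bar> + \<bar>a (p - 1) * \<phi> (p - 1)\<bar> + \<bar>w p * \<phi> p\<bar>"
    unfolding jac_def by linarith
  also have "\<dots> \<le> A * \<bar>\<phi> p\<bar> + A * \<bar>\<phi> p\<bar> + V * \<bar>\<phi> p\<bar>"
    unfolding abs_mult using a w all less_imp_le[OF a(1)] order_trans[OF less_imp_le[OF a(1)] a(2)]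
    by (intro add_mono mult_mono) (auto intro: order_trans[OF abs_ge_zero w])
  also have "\<dots> = (2 * A + V) * \<bar>\<phi> p\<bar>" by (simp add: algebra_simps)
  finally show "\<bar>e\<bar> \<le> 2 * A + V" using pos by simp
qed

definition site :: "int \<Rightarrow> int \<Rightarrow> nat \<Rightarrow> int" where
  "site k \<sigma> i = k + \<sigma> * int i"

text \<open>The coupling between the sites \<open>i - 1\<close> and \<open>i\<close> of the half-line that starts at \<open>k\<close> in direction \<open>\<sigma>\<close>.\<close>
definition hop :: "(int \<Rightarrow> real) \<Rightarrow> int \<Rightarrow> int \<Rightarrow> nat \<Rightarrow> real" where
  "hop a k \<sigma> i = (if \<sigma> = 1 then a (k + int i - 1) else a (k - int i))"

lemma site_0 [simp]: "site k \<sigma> 0 = k" by (simp add: site_def)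

lemma jac_site:
  assumes "\<sigma> = 1 \<or> \<sigma> = -1" "1 \<le> i"
  shows "jac a w \<phi> (site k \<sigma> i) = hop a k \<sigma> (Suc i) * \<phi> (site k \<sigma> (Suc i)) + hop a k \<sigma> i * \<phi> (site k \<sigma> (i - 1)) + w (site k \<sigma> i) * \<phi> (site k \<sigma> i)"
  using assms by (auto simp: jac_def hop_def site_def algebra_simps of_nat_diff)

lemma jac_center:
  assumes "\<sigma> = 1 \<or> \<sigma> = -1"
  shows "jac a w \<phi> k = hop a k \<sigma> 1 * \<phi> (site k \<sigma> 1) + hop a k (-\<sigma>) 1 * \<phi> (site k (-\<sigma>) 1) + w k * \<phi> k"
  using assms by (auto simp: jac_def hop_def site_def)

lemma sum_ibox:
  assumes "\<sigma> = 1 \<or> \<sigma> = -1"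
  shows "(\<Sum>n\<in>ibox k L. f n) = f k + (\<Sum>m=1..L. f (site k \<sigma> m)) + (\<Sum>m=1..L. f (site k (-\<sigma>) m))"
proof -
  have r: "(\<Sum>n\<in>{k + 1..k + int L}. f n) = (\<Sum>m=1..L. f (site k 1 m))"
    by (rule sum.reindex_bij_witness[of _ "\<lambda>m. k + int m" "\<lambda>n. nat (n - k)"]) (auto simp: site_def)
  have l: "(\<Sum>n\<in>{k - int L..k - 1}. f n) = (\<Sum>m=1..L. f (site k (-1) m))"
    by (rule sum.reindex_bij_witness[of _ "\<lambda>m. k - int m" "\<lambda>n. nat (k - n)"]) (auto simp: site_def)
  have "ibox k L = insert k ({k + 1..k + int L} \<union> {k - int L..k - 1})" by (auto simp: ibox_def)
  then have "(\<Sum>n\<in>ibox k L. f n) = f k + ((\<Sum>n\<in>{k + 1..k + int L}. f n) + (\<Sum>n\<in>{k - int L..k - 1}. f n))"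
    by simp (subst sum.union_disjoint, auto)
  with r l assms show ?thesis by (auto simp: add_ac)
qed

text \<open>An energy \<open>E\<close> is an eigenvalue, with an eigenvector that does not vanish at \<open>k\<close>, precisely where this function
  vanishes (poles and junk values of the Riccati variables aside).\<close>
definition resonance :: "(int \<Rightarrow> real) \<Rightarrow> (int \<Rightarrow> real) \<Rightarrow> int \<Rightarrow> nat \<Rightarrow> int \<Rightarrow> real \<Rightarrow> real" where
  "resonance a w k L \<sigma> E = E - w k - riccati (hop a k \<sigma>) (\<lambda>i. E - w (site k \<sigma> i)) L 0
      - riccati (hop a k (-\<sigma>)) (\<lambda>i. E - w (site k (-\<sigma>) i)) L 0"

text \<open>Smeared eigenfunction correlator: integrating a Dirac mass at the resonance function
  gives, at each eigenvalue, the decay factor divided by the slope, which is to be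
  \<open>\<bar>\<phi> k * \<phi> (site k \<sigma> n)\<bar>\<close>.\<close>

definition correlator :: "(int \<Rightarrow> real) \<Rightarrow> (int \<Rightarrow> real) \<Rightarrow> int \<Rightarrow> nat \<Rightarrow> int \<Rightarrow> nat \<Rightarrow> real \<Rightarrow> nat \<Rightarrow> ennreal" where
  "correlator a w k L \<sigma> n R i = (\<integral>\<^sup>+E\<in>{-R..R}. ennreal (bump (1 / real (Suc i)) (resonance a w k L \<sigma> E)
     * decay_factor (hop a k \<sigma>) (\<lambda>i. E - w (site k \<sigma> i)) L 0 n) \<partial>lborel)"

text \<open>At the eigenvalue of some \<phi> with \<open>\<phi> k \<noteq> 0\<close> the two
  half-lines and the center contribute to the slope of the resonance function, which by
  normalization of \<phi> is 1 / (\<phi> k)^2. The decay factor tends to \<bar>\<phi> (site k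
  \<sigma> n) / \<phi> k\<bar>, and the quotient is the desired product. Eigenvectors vanishing at
  \<open>k\<close> or at \<open>site k \<sigma> n\<close> contribute 0 to the sum.\<close>

lemma correlator_lower_bound:
  assumes F: "eigenbasis a w k L F" and \<sigma>: "\<sigma> = 1 \<or> \<sigma> = -1" and n: "n \<le> L"
    and a: "\<And>i. 0 < a i" "\<And>i. a i \<le> A" and w: "\<And>i. \<bar>w i\<bar> \<le> V" and R: "2 * A + V < R"
  shows "ennreal (\<Sum>\<phi>\<in>F. \<bar>\<phi> k * \<phi> (site k \<sigma> n)\<bar>) \<le> liminf (correlator a w k L \<sigma> n R)"
proof -
  have \<sigma>': "-\<sigma> = 1 \<or> -\<sigma> = -1" using \<sigma> by auto
  have on: "orthonormal (ibox k L) F" using F by (simp add: eigenbasis_def)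
  then have fin: "finite F" by (simp add: orthonormal_def)
  have z: "\<phi> j = 0" if "\<phi> \<in> F" "j \<notin> ibox k L" for \<phi> j using on that by (auto simp: orthonormal_def)
  have ipF: "ip (ibox k L) \<phi> \<psi> = (if \<phi> = \<psi> then 1 else 0)" if "\<phi> \<in> F" "\<psi> \<in> F" for \<phi> \<psi>
    using on that by (auto simp: orthonormal_def)
  have "\<forall>\<phi>\<in>F. \<exists>e. \<forall>n\<in>ibox k L. jac a w \<phi> n = e * \<phi> n" using F by (simp add: eigenbasis_def)
  then obtain ev where ev: "jac a w \<phi> n = ev \<phi> * \<phi> n" if "\<phi> \<in> F" "n \<in> ibox k L" for \<phi> n
    unfolding bchoice_iff by blast
  have hop: "0 < hop a k \<tau> i" for \<tau> i using a by (simp add: hop_def)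
  have inbox: "site k \<tau> m \<in> ibox k L" if "\<tau> = 1 \<or> \<tau> = -1" "m \<le> L" for \<tau> m
    using that by (auto simp: site_def ibox_def)
  have kbox: "k \<in> ibox k L" by (simp add: ibox_def)
  have end0: "\<phi> (site k \<tau> (Suc L)) = 0" if "\<phi> \<in> F" "\<tau> = 1 \<or> \<tau> = -1" for \<phi> \<tau>
    using that by (intro z) (auto simp: site_def ibox_def)
  have chain: "hop a k \<tau> (Suc m) * \<phi> (site k \<tau> (Suc m)) + hop a k \<tau> m * \<phi> (site k \<tau> (m - 1)) + w (site k \<tau> m) * \<phi> (site k \<tau> m)
      = ev \<phi> * \<phi> (site k \<tau> m)" if "\<phi> \<in> F" "\<tau> = 1 \<or> \<tau> = -1" "1 \<le> m" "m \<le> L" for \<phi> \<tau> m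
    using jac_site[OF that(2,3), of a w \<phi> k] ev[OF that(1) inbox[OF that(2,4)]] by simp
  define F' where "F' = {\<phi>\<in>F. \<phi> k \<noteq> 0 \<and> \<phi> (site k \<sigma> n) \<noteq> 0}"
  have F'F: "F' \<subseteq> F" and finF': "finite F'" using fin by (auto simp: F'_def)
  have sol_eq: "\<phi> (site k \<tau> m) = \<phi> (site k \<tau> L) * sol (hop a k \<tau>) (\<lambda>i. ev \<phi> - w (site k \<tau> i)) (Suc L - m) m"
    if "\<phi> \<in> F" "\<tau> = 1 \<or> \<tau> = -1" "m \<le> Suc L" for \<phi> \<tau> m
    by (rule chain_solution[where \<psi> = "\<lambda>m. \<phi> (site k \<tau> m)", OF hop end0[OF that(1,2)] chain[OF that(1,2)] that(3)])
  \<comment> \<open>Eigenvectors nonzero at \<open>k\<close> with the same energy are proportional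
    on each half-line with the same factor, contradicting orthogonality.\<close>
  have inj: "inj_on ev F'"
  proof (rule inj_onI, rule ccontr)
    fix \<phi> \<psi> assume h: "\<phi> \<in> F'" "\<psi> \<in> F'" "ev \<phi> = ev \<psi>" "\<phi> \<noteq> \<psi>"
    then have f: "\<phi> \<in> F" "\<psi> \<in> F" "\<phi> k \<noteq> 0" "\<psi> k \<noteq> 0" by (auto simp: F'_def)
    have proportional: "\<psi> (site k \<tau> m) * \<phi> k = \<psi> k * \<phi> (site k \<tau> m)" if "\<tau> = 1 \<or> \<tau> = -1" "m \<le> L" for \<tau> m
    proof -
      let ?s = "\<lambda>m. sol (hop a k \<tau>) (\<lambda>i. ev \<phi> - w (site k \<tau> i)) (Suc L - m) m"
      have "\<phi> (site k \<tau> m) = \<phi> (site k \<tau> L) * ?s m" "\<phi> k = \<phi> (site k \<tau> L) * ?s 0"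
        "\<psi> (site k \<tau> m) = \<psi> (site k \<tau> L) * ?s m" "\<psi> k = \<psi> (site k \<tau> L) * ?s 0"
        using sol_eq[OF f(1) that(1), of m] sol_eq[OF f(1) that(1), of 0]
          sol_eq[OF f(2) that(1), of m] sol_eq[OF f(2) that(1), of 0] that h(3) by auto
      then show ?thesis by (simp del: sol.simps)
    qed
    have "ip (ibox k L) \<phi> \<phi> * \<psi> k = ip (ibox k L) \<phi> \<psi> * \<phi> k"
      unfolding ip_def sum_distrib_right
    proof (intro sum.cong refl)
      fix n assume "n \<in> ibox k L"
      then have "n = site k 1 (nat (n - k)) \<and> nat (n - k) \<le> L \<or> n = site k (-1) (nat (k - n)) \<and> nat (k - n) \<le> L"
        by (auto simp: ibox_def site_def)
      then have "\<psi> n * \<phi> k = \<psi> k * \<phi> n"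
        using proportional[of 1 "nat (n - k)"] proportional[of "-1" "nat (k - n)"] by auto
      then show "\<phi> n * \<phi> n * \<psi> k = \<phi> n * \<psi> n * \<phi> k" by simp
    qed
    then show False using ipF[OF f(1,1)] ipF[OF f(1,2)] h f by simp
  qed
  have ev_bound: "\<bar>ev \<phi>\<bar> < R" if f: "\<phi> \<in> F" for \<phi>
    using eigenvalue_bound[OF on f ev[OF f] a w] R by simp
  \<comment> \<open>Disjoint neighborhoods inside the energy window allow the masses at different
    eigenvalues to be added under one integral.\<close>
  obtain B where B: "\<And>\<phi>. \<phi> \<in> F' \<Longrightarrow> open (B \<phi>) \<and> ev \<phi> \<in> B \<phi> \<and> B \<phi> \<subseteq> {-R..R}" "disjoint_family_on B F'"
  proof -
    obtain r where r: "0 < r" "\<And>\<phi> \<psi>. \<phi> \<in> F' \<Longrightarrow> \<psi> \<in> F' \<Longrightarrow> \<phi> \<noteq> \<psi> \<Longrightarrow> 2 * r \<le> dist (ev \<phi>) (ev \<psi>)"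
    proof -
      have "\<exists>r>0. \<forall>x\<in>ev ` F'. \<forall>y\<in>ev ` F'. x \<noteq> y \<longrightarrow> 2 * r \<le> dist x y"
      proof -
        let ?D = "insert 1 ((\<lambda>(x, y). dist x y) ` {(x, y). x \<in> ev ` F' \<and> y \<in> ev ` F' \<and> x \<noteq> y})"
        have finD: "finite ?D"
          by (rule finite.insertI, rule finite_imageI, rule finite_subset[of _ "ev ` F' \<times> ev ` F'"]) (use finF' in auto)
        moreover have "\<forall>x\<in>?D. 0 < x" by auto
        ultimately have "0 < Min ?D" by (subst Min_gr_iff) auto
        moreover have "Min ?D \<le> dist x y" if "x \<in> ev ` F'" "y \<in> ev ` F'" "x \<noteq> y" for x y
          using finD that by (intro Min_le) auto
        ultimately show ?thesis by (intro exI[of _ "Min ?D / 2"]) auto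
      qed
      then show ?thesis using that inj by (metis image_eqI inj_on_def)
    qed
    define B where "B \<phi> = ball (ev \<phi>) r \<inter> {-R<..<R}" for \<phi>
    have "disjoint_family_on B F'"
      unfolding disjoint_family_on_def
    proof (intro ballI impI, rule ccontr)
      fix \<phi> \<psi> assume h: "\<phi> \<in> F'" "\<psi> \<in> F'" "\<phi> \<noteq> \<psi>" "B \<phi> \<inter> B \<psi> \<noteq> {}"
      then obtain x where "dist (ev \<phi>) x < r" "dist (ev \<psi>) x < r" by (auto simp: B_def)
      then have "dist (ev \<phi>) (ev \<psi>) < 2 * r" using dist_triangle2[of "ev \<phi>" "ev \<psi>" x] by simp
      then show False using r(2) h by force
    qed
    moreover have "open (B \<phi>) \<and> ev \<phi> \<in> B \<phi> \<and> B \<phi> \<subseteq> {-R..R}" if "\<phi> \<in> F'" for \<phi>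
      using ev_bound[of \<phi>] that F'F r(1) by (auto simp: B_def)
    ultimately show ?thesis using that by blast
  qed
  let ?f = "\<lambda>i E. ennreal (bump (1 / real (Suc i)) (resonance a w k L \<sigma> E)
     * decay_factor (hop a k \<sigma>) (\<lambda>i. E - w (site k \<sigma> i)) L 0 n)"
  have single: "eventually (\<lambda>i. ennreal (\<bar>\<phi> k * \<phi> (site k \<sigma> n)\<bar> * q\<^sup>2) \<le> (\<integral>\<^sup>+E\<in>B \<phi>. ?f i E \<partial>lborel)) sequentially"
    if f: "\<phi> \<in> F'" and q: "0 < q" "q < 1" for \<phi> q
  proof -
    have fF: "\<phi> \<in> F" and nz: "\<phi> k \<noteq> 0" "\<phi> (site k \<sigma> n) \<noteq> 0" using f by (auto simp: F'_def)
    obtain G1 where G1: "(G1 \<longlongrightarrow> (\<Sum>m=1..L. (\<phi> (site k \<sigma> m) / \<phi> (site k \<sigma> 0))\<^sup>2)) (at (ev \<phi>))"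
      "eventually (\<lambda>E. hop a k \<sigma> 1 * \<phi> (site k \<sigma> 1) / \<phi> (site k \<sigma> 0) - riccati (hop a k \<sigma>) (\<lambda>i. E - w (site k \<sigma> i)) L 0 = (E - ev \<phi>) * G1 E) (at (ev \<phi>))"
      "\<And>n. n \<le> L \<Longrightarrow> ((\<lambda>E. decay_factor (hop a k \<sigma>) (\<lambda>i. E - w (site k \<sigma> i)) L 0 n) \<longlongrightarrow> \<bar>\<phi> (site k \<sigma> n) / \<phi> (site k \<sigma> 0)\<bar>) (at (ev \<phi>))"
      by (rule chain_limit[where \<psi> = "\<lambda>m. \<phi> (site k \<sigma> m)", OF hop end0[OF fF \<sigma>] chain[OF fF \<sigma>]]) (use nz in auto)
    obtain G2 where G2: "(G2 \<longlongrightarrow> (\<Sum>m=1..L. (\<phi> (site k (-\<sigma>) m) / \<phi> (site k (-\<sigma>) 0))\<^sup>2)) (at (ev \<phi>))"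
      "eventually (\<lambda>E. hop a k (-\<sigma>) 1 * \<phi> (site k (-\<sigma>) 1) / \<phi> (site k (-\<sigma>) 0) - riccati (hop a k (-\<sigma>)) (\<lambda>i. E - w (site k (-\<sigma>) i)) L 0 = (E - ev \<phi>) * G2 E) (at (ev \<phi>))"
      by (rule chain_limit[where \<psi> = "\<lambda>m. \<phi> (site k (-\<sigma>) m)", OF hop end0[OF fF \<sigma>'] chain[OF fF \<sigma>']]) (use nz in auto)
    have center: "ev \<phi> - w k = hop a k \<sigma> 1 * \<phi> (site k \<sigma> 1) / \<phi> k + hop a k (-\<sigma>) 1 * \<phi> (site k (-\<sigma>) 1) / \<phi> k"
      using jac_center[OF \<sigma>, of a w \<phi> k] ev[OF fF kbox] nz by (simp add: field_simps)
    have W: "eventually (\<lambda>E. resonance a w k L \<sigma> E = (E - ev \<phi>) * (1 + G1 E + G2 E)) (at (ev \<phi>))"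
      using G1(2) G2(2)
    proof eventually_elim
      case (elim E)
      have "resonance a w k L \<sigma> E = (E - ev \<phi>) + (ev \<phi> - w k) - riccati (hop a k \<sigma>) (\<lambda>i. E - w (site k \<sigma> i)) L 0
        - riccati (hop a k (-\<sigma>)) (\<lambda>i. E - w (site k (-\<sigma>) i)) L 0" by (simp add: resonance_def)
      also have "\<dots> = (E - ev \<phi>) + (E - ev \<phi>) * G1 E + (E - ev \<phi>) * G2 E"
        unfolding center elim[symmetric] by simp
      finally show ?case by (simp add: algebra_simps)
    qed
    have h: "1 + (\<Sum>m=1..L. (\<phi> (site k \<sigma> m) / \<phi> (site k \<sigma> 0))\<^sup>2) + (\<Sum>m=1..L. (\<phi> (site k (-\<sigma>) m) / \<phi> (site k (-\<sigma>) 0))\<^sup>2) = 1 / (\<phi> k)\<^sup>2"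
    proof -
      have "1 = (\<phi> k)\<^sup>2 + (\<Sum>m=1..L. (\<phi> (site k \<sigma> m))\<^sup>2) + (\<Sum>m=1..L. (\<phi> (site k (-\<sigma>) m))\<^sup>2)"
        using ipF[OF fF fF] unfolding ip_def sum_ibox[OF \<sigma>] by (simp add: power2_eq_square)
      then have "1 / (\<phi> k)\<^sup>2 = ((\<phi> k)\<^sup>2 + (\<Sum>m=1..L. (\<phi> (site k \<sigma> m))\<^sup>2) + (\<Sum>m=1..L. (\<phi> (site k (-\<sigma>) m))\<^sup>2)) / (\<phi> k)\<^sup>2"
        by simp
      then show ?thesis using nz by (simp add: add_divide_distrib sum_divide_distrib power_divide)
    qed
    have H: "((\<lambda>E. 1 + G1 E + G2 E) \<longlongrightarrow> 1 / (\<phi> k)\<^sup>2) (at (ev \<phi>))"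
      unfolding h[symmetric] by (intro tendsto_intros G1 G2)
    have "eventually (\<lambda>i. ennreal (\<bar>\<phi> (site k \<sigma> n) / \<phi> (site k \<sigma> 0)\<bar> / (1 / (\<phi> k)\<^sup>2) * q\<^sup>2) \<le> (\<integral>\<^sup>+E\<in>B \<phi>. ?f i E \<partial>lborel)) sequentially"
      by (rule bump_mass_at_zero[OF W H _ G1(3)[OF n]]) (use nz q B(1)[OF f] in auto)
    moreover have "\<bar>\<phi> (site k \<sigma> n) / \<phi> (site k \<sigma> 0)\<bar> / (1 / (\<phi> k)\<^sup>2) = \<bar>\<phi> k * \<phi> (site k \<sigma> n)\<bar>"
      using nz by (simp add: abs_mult abs_divide field_simps power2_eq_square)
    ultimately show ?thesis by (simp only:)
  qed
  let ?C = "\<Sum>\<phi>\<in>F'. \<bar>\<phi> k * \<phi> (site k \<sigma> n)\<bar>"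
  have q_bound: "ennreal (?C * q\<^sup>2) \<le> liminf (correlator a w k L \<sigma> n R)" if q: "0 < q" "q < 1" for q
  proof (rule Liminf_bounded)
    have "eventually (\<lambda>i. \<forall>\<phi>\<in>F'. ennreal (\<bar>\<phi> k * \<phi> (site k \<sigma> n)\<bar> * q\<^sup>2) \<le> (\<integral>\<^sup>+E\<in>B \<phi>. ?f i E \<partial>lborel)) sequentially"
      using single q finF' by (intro eventually_ball_finite) auto
    then show "eventually (\<lambda>i. ennreal (?C * q\<^sup>2) \<le> correlator a w k L \<sigma> n R i) sequentially"
    proof eventually_elim
      case (elim i)
      have Bm: "B \<phi> \<in> sets lborel" if "\<phi> \<in> F'" for \<phi> using B(1)[OF that] by auto
      have fm: "?f i \<in> borel_measurable lborel" unfolding resonance_def by measurable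
      have "ennreal (?C * q\<^sup>2) = (\<Sum>\<phi>\<in>F'. ennreal (\<bar>\<phi> k * \<phi> (site k \<sigma> n)\<bar> * q\<^sup>2))"
        by (simp add: sum_distrib_right)
      also have "\<dots> \<le> (\<Sum>\<phi>\<in>F'. (\<integral>\<^sup>+E\<in>B \<phi>. ?f i E \<partial>lborel))" using elim by (intro sum_mono) auto
      also have "\<dots> = (\<integral>\<^sup>+E. (\<Sum>\<phi>\<in>F'. ?f i E * indicator (B \<phi>) E) \<partial>lborel)"
        by (rule nn_integral_sum[symmetric]) (rule borel_measurable_times_ennreal[OF fm borel_measurable_indicator[OF Bm]])
      also have "\<dots> \<le> correlator a w k L \<sigma> n R i"
        unfolding correlator_def
      proof (intro nn_integral_mono)
        fix E
        have "(\<Sum>\<phi>\<in>F'. ?f i E * indicator (B \<phi>) E) = ?f i E * (indicator (\<Union>\<phi>\<in>F'. B \<phi>) E)"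
          unfolding sum_distrib_left[symmetric] indicator_UN_disjoint[OF finF' B(2)] ..
        also have "\<dots> \<le> ?f i E * indicator {-R..R} E"
        proof (intro mult_left_mono)
          have "(\<Union>\<phi>\<in>F'. B \<phi>) \<subseteq> {-R..R}" using B(1) by blast
          then show "indicator (\<Union>\<phi>\<in>F'. B \<phi>) E \<le> (indicator {-R..R} E :: ennreal)"
            by (auto split: split_indicator)
        qed simp
        finally show "(\<Sum>\<phi>\<in>F'. ?f i E * indicator (B \<phi>) E) \<le> ?f i E * indicator {-R..R} E" .
      qed
      finally show ?case .
    qed
  qed
  \<comment> \<open>The double \<open>Suc\<close> keeps q = 1 - 1 / (i + 2) strictly between 0 and 1
    already for i = 0.\<close>
  have lim: "(\<lambda>i. ennreal (?C * (1 - 1 / real (Suc (Suc i)))\<^sup>2)) \<longlonglongrightarrow> ennreal (?C * (1 - 0)\<^sup>2)"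
    by (intro tendsto_intros LIMSEQ_Suc[OF LIMSEQ_Suc[OF lim_1_over_n]])
  have le: "ennreal (?C * (1 - 1 / real (Suc (Suc i)))\<^sup>2) \<le> liminf (correlator a w k L \<sigma> n R)" for i
    by (rule q_bound) auto
  have "ennreal (?C * (1 - 0)\<^sup>2) \<le> liminf (correlator a w k L \<sigma> n R)"
    by (rule LIMSEQ_le_const2[OF lim]) (use le in blast)
  moreover have "?C = (\<Sum>\<phi>\<in>F. \<bar>\<phi> k * \<phi> (site k \<sigma> n)\<bar>)"
    using fin by (intro sum.mono_neutral_left) (auto simp: F'_def)
  ultimately show ?thesis by simp
qed

section \<open>From boxes to the line\<close>

definition eigenspan :: "((int \<Rightarrow> complex) \<Rightarrow> (int \<Rightarrow> complex)) \<Rightarrow> (int \<Rightarrow> complex) \<Rightarrow> bool" where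
  "eigenspan T g \<longleftrightarrow> (\<exists>F coef. finite F \<and> F \<subseteq> {\<phi>. is_eigenvector T \<phi>} \<and> g = (\<lambda>n. \<Sum>\<phi>\<in>F. coef \<phi> * \<phi> n))"

lemma eigenspan_0: "eigenspan T (\<lambda>n. 0)"
  unfolding eigenspan_def by (intro exI[of _ "{}"]) auto

lemma eigenspan_eigenvector: "is_eigenvector T \<phi> \<Longrightarrow> eigenspan T \<phi>"
  unfolding eigenspan_def by (intro exI[of _ "{\<phi>}"] exI[of _ "\<lambda>_. 1"]) auto

lemma eigenspan_scale: "eigenspan T g \<Longrightarrow> eigenspan T (\<lambda>n. c * g n)"
  unfolding eigenspan_def by (force simp: sum_distrib_left mult.assoc[symmetric])

lemma eigenspan_add:
  assumes "eigenspan T g" "eigenspan T h"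
  shows "eigenspan T (\<lambda>n. g n + h n)"
proof -
  from assms obtain F c G d where F: "finite F" "F \<subseteq> {\<phi>. is_eigenvector T \<phi>}" "g = (\<lambda>n. \<Sum>\<phi>\<in>F. c \<phi> * \<phi> n)"
    and G: "finite G" "G \<subseteq> {\<phi>. is_eigenvector T \<phi>}" "h = (\<lambda>n. \<Sum>\<phi>\<in>G. d \<phi> * \<phi> n)"
    unfolding eigenspan_def by blast
  define b where "b \<phi> = (if \<phi> \<in> F then c \<phi> else 0) + (if \<phi> \<in> G then d \<phi> else 0)" for \<phi>
  have "(\<Sum>\<phi>\<in>F \<union> G. b \<phi> * \<phi> n) = g n + h n" for n
  proof -
    have "(\<Sum>\<phi>\<in>F \<union> G. b \<phi> * \<phi> n) = (\<Sum>\<phi>\<in>F \<union> G. if \<phi> \<in> F then c \<phi> * \<phi> n else 0) + (\<Sum>\<phi>\<in>F \<union> G. if \<phi> \<in> G then d \<phi> * \<phi> n else 0)"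
      unfolding sum.distrib[symmetric] by (intro sum.cong) (auto simp: b_def algebra_simps)
    then show ?thesis using F G by (simp add: sum.If_cases Int_absorb1)
  qed
  then show ?thesis unfolding eigenspan_def using F G by (intro exI[of _ "F \<union> G"] exI[of _ b]) auto
qed

lemma eigenspan_sum:
  assumes "finite I" "\<And>i. i \<in> I \<Longrightarrow> eigenspan T (g i)"
  shows "eigenspan T (\<lambda>n. \<Sum>i\<in>I. c i * g i n)"
  using assms by (induction I rule: finite_induct) (auto simp: eigenspan_0 intro!: eigenspan_add eigenspan_scale)

text \<open>Testing on finite sets makes the bound stable under pointwise limits and avoids
  summability conditions; for \<open>0 \<le> B\<close> it implies membership in
  \<open>ell2\<close>.\<close>

definition l2_le :: "(int \<Rightarrow> complex) \<Rightarrow> real \<Rightarrow> bool" where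
  "l2_le f B \<longleftrightarrow> (\<forall>A. finite A \<longrightarrow> L2_set (\<lambda>n. cmod (f n)) A \<le> B)"

lemma l2_le_add: "l2_le f B \<Longrightarrow> l2_le g C \<Longrightarrow> l2_le (\<lambda>n. f n + g n) (B + C)"
  unfolding l2_le_def
proof (intro allI impI)
  fix A :: "int set" assume h: "\<forall>A. finite A \<longrightarrow> L2_set (\<lambda>n. cmod (f n)) A \<le> B" "\<forall>A. finite A \<longrightarrow> L2_set (\<lambda>n. cmod (g n)) A \<le> C" "finite A"
  have "L2_set (\<lambda>n. cmod (f n + g n)) A \<le> L2_set (\<lambda>n. cmod (f n) + cmod (g n)) A"
    by (rule L2_set_mono) (auto intro: norm_triangle_ineq)
  also have "\<dots> \<le> L2_set (\<lambda>n. cmod (f n)) A + L2_set (\<lambda>n. cmod (g n)) A" by (rule L2_set_triangle_ineq)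
  finally show "L2_set (\<lambda>n. cmod (f n + g n)) A \<le> B + C" using h by (smt (verit))
qed

lemma l2_le_scale: "l2_le f B \<Longrightarrow> l2_le (\<lambda>n. c * f n) (cmod c * B)"
  unfolding l2_le_def by (auto simp: norm_mult L2_set_left_distrib[symmetric] L2_set_right_distrib[symmetric] mult_left_mono)

lemma l2_le_0: "l2_le (\<lambda>n. 0) 0"
  by (simp add: l2_le_def L2_set_def)

lemma l2_le_sum:
  assumes "finite I" "\<And>i. i \<in> I \<Longrightarrow> l2_le (f i) (B i)"
  shows "l2_le (\<lambda>n. \<Sum>i\<in>I. f i n) (\<Sum>i\<in>I. B i)"
  using assms by (induction I rule: finite_induct) (auto intro!: l2_le_add simp: l2_le_0)

lemma l2_le_iff:
  assumes "0 \<le> B"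
  shows "l2_le f B \<longleftrightarrow> (\<forall>A. finite A \<longrightarrow> (\<Sum>n\<in>A. (cmod (f n))\<^sup>2) \<le> B\<^sup>2)"
proof -
  have "sqrt x \<le> B \<longleftrightarrow> x \<le> B\<^sup>2" for x
    using real_sqrt_le_iff[of x "B\<^sup>2"] assms by simp
  then show ?thesis unfolding l2_le_def L2_set_def by simp
qed

lemma l2_le_imp:
  assumes "l2_le f B" "0 \<le> B"
  shows "f \<in> ell2" "l2norm f \<le> B"
proof -
  have b: "(\<Sum>n\<in>A. (cmod (f n))\<^sup>2) \<le> B\<^sup>2" if "finite A" for A using assms that by (simp add: l2_le_iff)
  have s: "(\<lambda>n. (cmod (f n))\<^sup>2) summable_on UNIV"
    by (rule nonneg_bdd_above_summable_on) (auto intro!: bdd_aboveI2[where M = "B\<^sup>2"] b)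
  then show "f \<in> ell2" by (simp add: ell2_def)
  have "(\<Sum>\<^sub>\<infinity>n. (cmod (f n))\<^sup>2) \<le> B\<^sup>2" by (rule infsum_le_finite_sums[OF s]) (use b in auto)
  then show "l2norm f \<le> B" unfolding l2norm_def using assms(2) by (simp add: real_le_lsqrt infsum_nonneg)
qed

lemma ell2_tail:
  assumes "\<psi> \<in> ell2" "0 < \<epsilon>"
  obtains A where "finite A" "l2_le (\<lambda>n. if n \<in> A then 0 else \<psi> n) \<epsilon>"
proof -
  let ?f = "\<lambda>n. (cmod (\<psi> n))\<^sup>2"
  obtain S where "(?f has_sum S) UNIV" using assms(1) by (auto simp: ell2_def summable_on_def)
  then have "(sum ?f \<longlongrightarrow> S) (finite_subsets_at_top UNIV)" by (simp add: has_sum_def)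
  then have "eventually (\<lambda>A. dist (sum ?f A) S < \<epsilon>\<^sup>2 / 2) (finite_subsets_at_top UNIV)"
    using assms(2) by (intro tendstoD) auto
  then obtain A where A: "finite A" "\<And>B. finite B \<Longrightarrow> A \<subseteq> B \<Longrightarrow> dist (sum ?f B) S < \<epsilon>\<^sup>2 / 2"
    by (auto simp: eventually_finite_subsets_at_top)
  have "l2_le (\<lambda>n. if n \<in> A then 0 else \<psi> n) \<epsilon>"
    unfolding l2_le_iff[OF less_imp_le[OF assms(2)]]
  proof (intro allI impI)
    fix B :: "int set" assume B: "finite B"
    have "(\<Sum>n\<in>B. (cmod (if n \<in> A then 0 else \<psi> n))\<^sup>2) = sum ?f (B - A)"
      using B by (intro sum.mono_neutral_cong_right) auto
    also have "\<dots> = sum ?f (A \<union> B) - sum ?f A"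
      using A(1) B sum.union_disjoint[of A "B - A" ?f] by simp
    also have "\<dots> \<le> \<epsilon>\<^sup>2"
    proof -
      have "\<bar>sum ?f A - S\<bar> < \<epsilon>\<^sup>2 / 2" "\<bar>sum ?f (A \<union> B) - S\<bar> < \<epsilon>\<^sup>2 / 2"
        using A(2)[of A] A(2)[of "A \<union> B"] A(1) B by (auto simp: dist_real_def)
      then show ?thesis by linarith
    qed
    finally show "(\<Sum>n\<in>B. (cmod (if n \<in> A then 0 else \<psi> n))\<^sup>2) \<le> \<epsilon>\<^sup>2" .
  qed
  with A(1) show ?thesis by (rule that)
qed

text \<open>It suffices to approximate unit vectors, since every vector is close to a finite
  combination of them.\<close>

lemma pure_point_spectrumI:
  assumes "\<And>k \<eta>. 0 < \<eta> \<Longrightarrow> \<exists>g. eigenspan T g \<and> l2_le (\<lambda>n. (if n = k then 1 else 0) - g n) \<eta>"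
  shows "pure_point_spectrum T"
  unfolding pure_point_spectrum_def
proof (intro ballI allI impI)
  fix \<psi> and \<epsilon> :: real assume \<psi>: "\<psi> \<in> ell2" and \<epsilon>: "0 < \<epsilon>"
  obtain A where A: "finite A" "l2_le (\<lambda>n. if n \<in> A then 0 else \<psi> n) (\<epsilon> / 4)"
    using ell2_tail[OF \<psi>, of "\<epsilon> / 4"] \<epsilon> by auto
  \<comment> \<open>The approximation errors are weighted by \<bar>\<psi> k\<bar>, so precision
    \<epsilon> / (4 M) at each unit vector costs at most \<epsilon> / 4 in total; the summand 1
    keeps \<open>M\<close> positive.\<close>
  define M where "M = (\<Sum>k\<in>A. cmod (\<psi> k)) + 1"
  have M: "0 < M" unfolding M_def by (simp add: add_nonneg_pos sum_nonneg)
  have "\<exists>g. eigenspan T g \<and> l2_le (\<lambda>n. (if n = k then 1 else 0) - g n) (\<epsilon> / (4 * M))" for k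
    using \<epsilon> M by (intro assms) auto
  then obtain g where g: "\<And>k. eigenspan T (g k)" "\<And>k. l2_le (\<lambda>n. (if n = k then 1 else 0) - g k n) (\<epsilon> / (4 * M))"
    by metis
  let ?h = "\<lambda>n. \<Sum>k\<in>A. \<psi> k * g k n"
  have "l2_le (\<lambda>n. (if n \<in> A then 0 else \<psi> n) + (\<Sum>k\<in>A. \<psi> k * ((if n = k then 1 else 0) - g k n)))
     (\<epsilon> / 4 + (\<Sum>k\<in>A. cmod (\<psi> k) * (\<epsilon> / (4 * M))))"
    by (intro l2_le_add A l2_le_sum l2_le_scale g)
  moreover have "(if n \<in> A then 0 else \<psi> n) + (\<Sum>k\<in>A. \<psi> k * ((if n = k then 1 else 0) - g k n)) = \<psi> n - ?h n" for n
  proof -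
    have "(\<Sum>k\<in>A. \<psi> k * ((if n = k then 1 else 0) - g k n)) = (\<Sum>k\<in>A. if n = k then \<psi> k else 0) - ?h n"
      unfolding sum_subtractf[symmetric] by (intro sum.cong) (auto simp: algebra_simps)
    then show ?thesis using A(1) by simp
  qed
  moreover have "\<epsilon> / 4 + (\<Sum>k\<in>A. cmod (\<psi> k) * (\<epsilon> / (4 * M))) \<le> \<epsilon> / 2"
  proof -
    have "(\<Sum>k\<in>A. cmod (\<psi> k) * (\<epsilon> / (4 * M))) = (\<Sum>k\<in>A. cmod (\<psi> k)) * (\<epsilon> / (4 * M))"
      by (rule sum_distrib_right[symmetric])
    also have "(\<Sum>k\<in>A. cmod (\<psi> k)) = M - 1" by (simp add: M_def)
    also have "(M - 1) * (\<epsilon> / (4 * M)) \<le> M * (\<epsilon> / (4 * M))" using \<epsilon> M by (intro mult_right_mono) auto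
    also have "\<dots> = \<epsilon> / 4" using M by simp
    finally show ?thesis by simp
  qed
  ultimately have "l2_le (\<lambda>n. \<psi> n - ?h n) (\<epsilon> / 2)" unfolding l2_le_def by (auto intro: order_trans)
  then have nm: "l2norm (\<lambda>n. \<psi> n - ?h n) < \<epsilon>" using l2_le_imp(2)[of _ "\<epsilon> / 2"] \<epsilon> by fastforce
  have "eigenspan T ?h" by (intro eigenspan_sum A g)
  then obtain F coef where F: "finite F" "F \<subseteq> {\<phi>. is_eigenvector T \<phi>}" and h: "?h = (\<lambda>n. \<Sum>\<phi>\<in>F. coef \<phi> * \<phi> n)"
    unfolding eigenspan_def by blast
  show "\<exists>F coef. finite F \<and> F \<subseteq> {\<phi>. is_eigenvector T \<phi>} \<and> l2norm (\<lambda>n. \<psi> n - (\<Sum>\<phi>\<in>F. coef \<phi> * \<phi> n)) < \<epsilon>"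
    using nm F unfolding fun_cong[OF h] by blast
qed

text \<open>At most \<open>4 N + 2\<close> eigenvectors of the box carry half of their mass within distance \<open>N\<close> of \<open>k\<close>,
  a number that does not depend on the size of the box; the other ones hardly contribute to the expansion of
  the unit vector at \<open>k\<close>.\<close>
lemma localized_eigenvectors:
  assumes F: "eigenbasis a w k L F" and N: "N \<le> L"
    and a: "\<And>i. 0 < a i" "\<And>i. a i \<le> A" and w: "\<And>i. \<bar>w i\<bar> \<le> V"
    and tail: "(\<Sum>\<phi>\<in>F. \<Sum>m=Suc N..L. \<bar>\<phi> k * \<phi> (site k 1 m)\<bar> + \<bar>\<phi> k * \<phi> (site k (-1) m)\<bar>) \<le> \<eta>"
  obtains \<Phi> :: "nat \<Rightarrow> int \<Rightarrow> real" and e :: "nat \<Rightarrow> real" where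
    "\<And>j B. finite B \<Longrightarrow> (\<Sum>n\<in>B. (\<Phi> j n)\<^sup>2) \<le> 1"
    "\<And>j n. n \<in> ibox k L \<Longrightarrow> jac a w (\<Phi> j) n = e j * \<Phi> j n" "\<And>j. \<bar>e j\<bar> \<le> 2 * A + V"
    "\<And>B. finite B \<Longrightarrow> (\<Sum>n\<in>B. ((if n = k then 1 else 0) - (\<Sum>j<4 * N + 2. \<Phi> j k * \<Phi> j n))\<^sup>2) \<le> 2 * \<eta>"
proof -
  let ?S = "ibox k L"
  have on: "orthonormal ?S F" and ev: "\<And>\<phi>. \<phi> \<in> F \<Longrightarrow> \<exists>e. \<forall>n\<in>?S. jac a w \<phi> n = e * \<phi> n"
    and comp: "\<And>i. i \<in> ?S \<Longrightarrow> (\<Sum>\<phi>\<in>F. \<phi> i * \<phi> i) = 1"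
    using F by (auto simp: eigenbasis_def)
  have fin: "finite F" and z: "\<And>\<phi> i. \<phi> \<in> F \<Longrightarrow> i \<notin> ?S \<Longrightarrow> \<phi> i = 0" and nrm: "\<And>\<phi>. \<phi> \<in> F \<Longrightarrow> ip ?S \<phi> \<phi> = 1"
    using on by (auto simp: orthonormal_def)
  have kS: "k \<in> ?S" by (simp add: ibox_def)
  define G where "G = {\<phi>\<in>F. 1 / 2 \<le> (\<Sum>n\<in>ibox k N. (\<phi> n)\<^sup>2)}"
  have GF: "G \<subseteq> F" and finG: "finite G" using fin by (auto simp: G_def)
  \<comment> \<open>Trace count: each member of \<open>G\<close> has mass at least 1/2 on the
    \<open>2 * N + 1\<close> central sites, while the total mass of \<open>F\<close> at each site is
    at most 1.\<close>
  have card: "card G \<le> 4 * N + 2"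
  proof -
    have "real (card G) * (1 / 2) \<le> (\<Sum>\<phi>\<in>G. \<Sum>n\<in>ibox k N. (\<phi> n)\<^sup>2)"
      using sum_mono[of G "\<lambda>_. 1 / 2" "\<lambda>\<phi>. \<Sum>n\<in>ibox k N. (\<phi> n)\<^sup>2"] by (simp add: G_def)
    also have "\<dots> \<le> (\<Sum>\<phi>\<in>F. \<Sum>n\<in>ibox k N. (\<phi> n)\<^sup>2)" by (intro sum_mono2 fin GF sum_nonneg) auto
    also have "\<dots> = (\<Sum>n\<in>ibox k N. \<Sum>\<phi>\<in>F. (\<phi> n)\<^sup>2)" by (rule sum.swap)
    also have "\<dots> \<le> (\<Sum>n\<in>ibox k N. 1)"
      using N by (intro sum_mono orthonormal_pointwise[OF on]) (auto simp: ibox_def)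
    also have "\<dots> = 2 * real N + 1" by (simp add: ibox_def)
    finally show ?thesis by linarith
  qed
  have le1: "\<bar>\<phi> n\<bar> \<le> 1" if f: "\<phi> \<in> F" for \<phi> n
  proof (cases "n \<in> ?S")
    case True
    have "\<phi> n * \<phi> n \<le> ip ?S \<phi> \<phi>" unfolding ip_def using True by (intro member_le_sum) auto
    then show ?thesis using nrm[OF f] by (simp add: abs_square_le_1 power2_eq_square[symmetric])
  qed (use z[OF f] in simp)
  \<comment> \<open>Half of the mass lies beyond distance \<open>N\<close>. As \<bar>\<phi>\<bar>
    \<le> 1, squares are bounded by first powers, and (\<phi> k)^2 \<le> \<bar>\<phi> k\<bar> is
    then controlled by the correlations in the tail.\<close>
  have nonloc: "(\<phi> k)\<^sup>2 \<le> 2 * (\<Sum>m=Suc N..L. \<bar>\<phi> k * \<phi> (site k 1 m)\<bar> + \<bar>\<phi> k * \<phi> (site k (-1) m)\<bar>)"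
    if "\<phi> \<in> F - G" for \<phi>
  proof -
    have f: "\<phi> \<in> F" using that by simp
    have split: "(\<Sum>m=1..L. g m) = (\<Sum>m=1..N. g m) + (\<Sum>m=Suc N..L. g m)" for g :: "nat \<Rightarrow> real"
      using N sum.ub_add_nat[of 1 N g "L - N"] by simp
    have "(\<Sum>n\<in>?S. (\<phi> n)\<^sup>2) = 1" using nrm[OF f] by (simp add: ip_def power2_eq_square)
    then have s1: "(\<phi> k)\<^sup>2 + ((\<Sum>m=1..N. (\<phi> (site k 1 m))\<^sup>2) + (\<Sum>m=Suc N..L. (\<phi> (site k 1 m))\<^sup>2))
       + ((\<Sum>m=1..N. (\<phi> (site k (-1) m))\<^sup>2) + (\<Sum>m=Suc N..L. (\<phi> (site k (-1) m))\<^sup>2)) = 1"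
      using sum_ibox[of 1 "\<lambda>n. (\<phi> n)\<^sup>2" k L] split[of "\<lambda>m. (\<phi> (site k 1 m))\<^sup>2"] split[of "\<lambda>m. (\<phi> (site k (-1) m))\<^sup>2"]
      by simp
    have "(\<Sum>n\<in>ibox k N. (\<phi> n)\<^sup>2) < 1 / 2" using that by (auto simp: G_def)
    then have s2: "(\<phi> k)\<^sup>2 + (\<Sum>m=1..N. (\<phi> (site k 1 m))\<^sup>2) + (\<Sum>m=1..N. (\<phi> (site k (-1) m))\<^sup>2) < 1 / 2"
      using sum_ibox[of 1 "\<lambda>n. (\<phi> n)\<^sup>2" k N] by simp
    have "1 / 2 \<le> (\<Sum>m=Suc N..L. (\<phi> (site k 1 m))\<^sup>2) + (\<Sum>m=Suc N..L. (\<phi> (site k (-1) m))\<^sup>2)"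
      using s1 s2 by linarith
    also have "\<dots> \<le> (\<Sum>m=Suc N..L. \<bar>\<phi> (site k 1 m)\<bar> + \<bar>\<phi> (site k (-1) m)\<bar>)"
    proof -
      have "(\<phi> n)\<^sup>2 \<le> \<bar>\<phi> n\<bar>" for n
        using mult_left_mono[OF le1[OF f, of n], of "\<bar>\<phi> n\<bar>"] by (simp add: power2_eq_square)
      then show ?thesis unfolding sum.distrib by (intro add_mono sum_mono)
    qed
    finally have half: "1 / 2 \<le> (\<Sum>m=Suc N..L. \<bar>\<phi> (site k 1 m)\<bar> + \<bar>\<phi> (site k (-1) m)\<bar>)" .
    have "(\<phi> k)\<^sup>2 \<le> \<bar>\<phi> k\<bar> * 1"
      using mult_left_mono[OF le1[OF f, of k], of "\<bar>\<phi> k\<bar>"] by (simp add: power2_eq_square)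
    also have "\<dots> \<le> \<bar>\<phi> k\<bar> * (2 * (\<Sum>m=Suc N..L. \<bar>\<phi> (site k 1 m)\<bar> + \<bar>\<phi> (site k (-1) m)\<bar>))"
      using half by (intro mult_left_mono) auto
    also have "\<dots> = 2 * (\<Sum>m=Suc N..L. \<bar>\<phi> k * \<phi> (site k 1 m)\<bar> + \<bar>\<phi> k * \<phi> (site k (-1) m)\<bar>)"
      by (simp add: sum_distrib_left abs_mult algebra_simps)
    finally show ?thesis .
  qed
  have rest: "(\<Sum>\<phi>\<in>F - G. (\<phi> k)\<^sup>2) \<le> 2 * \<eta>"
  proof -
    have "(\<Sum>\<phi>\<in>F - G. (\<phi> k)\<^sup>2) \<le> (\<Sum>\<phi>\<in>F - G. 2 * (\<Sum>m=Suc N..L. \<bar>\<phi> k * \<phi> (site k 1 m)\<bar> + \<bar>\<phi> k * \<phi> (site k (-1) m)\<bar>))"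
      by (intro sum_mono nonloc)
    also have "\<dots> \<le> (\<Sum>\<phi>\<in>F. 2 * (\<Sum>m=Suc N..L. \<bar>\<phi> k * \<phi> (site k 1 m)\<bar> + \<bar>\<phi> k * \<phi> (site k (-1) m)\<bar>))"
      using fin by (intro sum_mono2) (auto intro!: sum_nonneg)
    also have "\<dots> \<le> 2 * \<eta>" using tail by (simp add: sum_distrib_left[symmetric])
    finally show ?thesis .
  qed
  have onG: "orthonormal ?S G" using on GF finG by (auto simp: orthonormal_def subset_eq)
  let ?\<delta> = "\<lambda>n. if n = k then 1 else (0::real)"
  have ipd: "ip ?S ?\<delta> f = f k" for f using kS by (intro ip_delta) auto
  have defect: "(\<Sum>n\<in>?S. (?\<delta> n - (\<Sum>\<phi>\<in>G. \<phi> k * \<phi> n))\<^sup>2) \<le> 2 * \<eta>"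
  proof -
    have "(\<Sum>n\<in>?S. (?\<delta> n - (\<Sum>\<phi>\<in>G. \<phi> k * \<phi> n))\<^sup>2) = 1 - (\<Sum>\<phi>\<in>G. (\<phi> k)\<^sup>2)"
      using orthonormal_expansion_defect(1)[OF onG, of ?\<delta>] unfolding ipd by (simp add: ip_def power2_eq_square)
    also have "\<dots> = (\<Sum>\<phi>\<in>F. (\<phi> k)\<^sup>2) - (\<Sum>\<phi>\<in>G. (\<phi> k)\<^sup>2)" using comp[OF kS] by (simp add: power2_eq_square)
    also have "\<dots> = (\<Sum>\<phi>\<in>F - G. (\<phi> k)\<^sup>2)" using sum_diff[OF fin GF, of "\<lambda>\<phi>. (\<phi> k)\<^sup>2"] by simp
    finally show ?thesis using rest by simp
  qed
  obtain h where h: "bij_betw h {..<card G} G" using ex_bij_betw_nat_finite[OF finG] by (auto simp: atLeast0LessThan)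
  \<comment> \<open>Padding with zero vectors makes the number of vectors the same for every box, as
    the limit in \<open>L\<close> requires; they satisfy the equation with energy 0.\<close>
  define \<Phi> where "\<Phi> j = (if j < card G then h j else (\<lambda>_. 0))" for j
  have hG: "h j \<in> F" if "j < card G" for j using h that GF by (auto simp: bij_betw_def)
  have "\<exists>e. (\<forall>n\<in>?S. jac a w (\<Phi> j) n = e * \<Phi> j n) \<and> \<bar>e\<bar> \<le> 2 * A + V" for j
  proof (cases "j < card G")
    case True
    with ev[OF hG] obtain e where e: "\<forall>n\<in>?S. jac a w (\<Phi> j) n = e * \<Phi> j n" by (auto simp: \<Phi>_def)
    moreover have "\<bar>e\<bar> \<le> 2 * A + V"
      using eigenvalue_bound[OF on hG[OF True], of a w e] e a w True by (auto simp: \<Phi>_def)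
    ultimately show ?thesis by blast
  next
    case False
    have "0 \<le> 2 * A + V" using order_trans[OF less_imp_le[OF a(1)] a(2)] order_trans[OF abs_ge_zero w] by (simp add: add_nonneg_nonneg)
    then show ?thesis using False by (intro exI[of _ 0]) (auto simp: \<Phi>_def jac_def)
  qed
  then obtain e where e: "\<And>j. (\<forall>n\<in>?S. jac a w (\<Phi> j) n = e j * \<Phi> j n) \<and> \<bar>e j\<bar> \<le> 2 * A + V" by metis
  have sumG: "(\<Sum>j<4 * N + 2. \<Phi> j k * \<Phi> j n) = (\<Sum>\<phi>\<in>G. \<phi> k * \<phi> n)" for n
  proof -
    have "(\<Sum>j<4 * N + 2. \<Phi> j k * \<Phi> j n) = (\<Sum>j<card G. h j k * h j n)"
      using card by (intro sum.mono_neutral_cong_right) (auto simp: \<Phi>_def)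
    also have "\<dots> = (\<Sum>\<phi>\<in>G. \<phi> k * \<phi> n)" by (rule sum.reindex_bij_betw[OF h])
    finally show ?thesis .
  qed
  have restrict: "(\<Sum>n\<in>B. (f n)\<^sup>2) \<le> (\<Sum>n\<in>?S. (f n)\<^sup>2)" if "finite B" "\<And>n. n \<notin> ?S \<Longrightarrow> f n = 0" for B and f :: "int \<Rightarrow> real"
  proof -
    have "(\<Sum>n\<in>B. (f n)\<^sup>2) = (\<Sum>n\<in>B \<inter> ?S. (f n)\<^sup>2)" using that by (intro sum.mono_neutral_right) auto
    also have "\<dots> \<le> (\<Sum>n\<in>?S. (f n)\<^sup>2)" by (intro sum_mono2) auto
    finally show ?thesis .
  qed
  show ?thesis
  proof (rule that[of \<Phi> e])
    fix B :: "int set" assume B: "finite B"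
    show "(\<Sum>n\<in>B. (\<Phi> j n)\<^sup>2) \<le> 1" for j
    proof (cases "j < card G")
      case True
      then have "(\<Sum>n\<in>B. (\<Phi> j n)\<^sup>2) \<le> (\<Sum>n\<in>?S. (\<Phi> j n)\<^sup>2)" using z[OF hG] B by (intro restrict) (auto simp: \<Phi>_def)
      also have "\<dots> = 1" using nrm[OF hG[OF True]] True by (simp add: \<Phi>_def ip_def power2_eq_square)
      finally show ?thesis .
    qed (simp add: \<Phi>_def)
    have "(\<Sum>n\<in>B. (?\<delta> n - (\<Sum>\<phi>\<in>G. \<phi> k * \<phi> n))\<^sup>2) \<le> (\<Sum>n\<in>?S. (?\<delta> n - (\<Sum>\<phi>\<in>G. \<phi> k * \<phi> n))\<^sup>2)"
    proof (rule restrict[OF B])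
      fix n assume n: "n \<notin> ?S"
      then have "n \<noteq> k" using kS by auto
      moreover have "(\<Sum>\<phi>\<in>G. \<phi> k * \<phi> n) = 0" using z n GF by (intro sum.neutral) auto
      ultimately show "?\<delta> n - (\<Sum>\<phi>\<in>G. \<phi> k * \<phi> n) = 0" by simp
    qed
    also note defect
    finally show "(\<Sum>n\<in>B. (?\<delta> n - (\<Sum>j<4 * N + 2. \<Phi> j k * \<Phi> j n))\<^sup>2) \<le> 2 * \<eta>"
      unfolding sumG .
  qed (use e in auto)
qed

text \<open>\<open>N\<close> is fixed while \<open>L\<close> runs through infinitely many values.
  The entries and energies of the \<open>4 * N + 2\<close> vectors are bounded, so a subsequence
  converges pointwise; the eigenvalue equation is local and the norm bounds concern finite sets, so
  both survive.\<close>

lemma delta_approximation: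
  assumes a: "\<And>i. 0 < a i" "\<And>i. a i \<le> A" and w: "\<And>i. \<bar>w i\<bar> \<le> V" and \<eta>: "0 \<le> \<eta>"
    and inf: "\<exists>\<^sub>\<infinity>L. \<exists>F. eigenbasis a w k L F
      \<and> (\<Sum>\<phi>\<in>F. \<Sum>m=Suc N..L. \<bar>\<phi> k * \<phi> (site k 1 m)\<bar> + \<bar>\<phi> k * \<phi> (site k (-1) m)\<bar>) \<le> \<eta>"
  shows "\<exists>g. eigenspan (jacobi a w) g \<and> l2_le (\<lambda>n. (if n = k then 1 else 0) - g n) (sqrt (2 * \<eta>))"
proof -
  let ?K = "4 * N + 2"
  define P where "P L \<Phi> e \<longleftrightarrow> (\<forall>j B. finite B \<longrightarrow> (\<Sum>n\<in>B. (\<Phi> j n)\<^sup>2) \<le> 1)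
     \<and> (\<forall>j. \<forall>n\<in>ibox k L. jac a w (\<Phi> j) n = e j * \<Phi> j n) \<and> (\<forall>j. \<bar>e j\<bar> \<le> 2 * A + V)
     \<and> (\<forall>B. finite B \<longrightarrow> (\<Sum>n\<in>B. ((if n = k then 1 else 0) - (\<Sum>j<?K. \<Phi> j k * \<Phi> j n))\<^sup>2) \<le> 2 * \<eta>)"
    for L and \<Phi> :: "nat \<Rightarrow> int \<Rightarrow> real" and e :: "nat \<Rightarrow> real"
  have "\<exists>L\<ge>i. \<exists>\<Phi> e. P L \<Phi> e" for i
  proof -
    obtain L F where L: "max i N < L" and F: "eigenbasis a w k L F"
      "(\<Sum>\<phi>\<in>F. \<Sum>m=Suc N..L. \<bar>\<phi> k * \<phi> (site k 1 m)\<bar> + \<bar>\<phi> k * \<phi> (site k (-1) m)\<bar>) \<le> \<eta>"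
      using inf unfolding INFM_nat by blast
    have "\<exists>\<Phi> e. P L \<Phi> e"
      by (rule localized_eigenvectors[OF F(1) _ a w F(2)]) (use L in simp, unfold P_def, blast)
    then show ?thesis using L by (intro exI[of _ L]) auto
  qed
  then obtain Lf \<Phi>f ef where Lf: "\<And>i. i \<le> Lf i" and P: "\<And>i. P (Lf i) (\<Phi>f i) (ef i)" by metis
  note P' = P[unfolded P_def]
  note P1 = P'[THEN conjunct1, rule_format]
    and P2 = P'[THEN conjunct2, THEN conjunct1, rule_format]
    and P3 = P'[THEN conjunct2, THEN conjunct2, THEN conjunct1, rule_format]
    and P4 = P'[THEN conjunct2, THEN conjunct2, THEN conjunct2, rule_format]
  define R where "R = max 1 (2 * A + V)"
  \<comment> \<open>All entries and energies are packed into one point of a cube, so one extraction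
    suffices. Its index type is countable, which makes the function space metrizable and compactness
    sequential.\<close>
  define Z where "Z i c = (case c of Inl (j, n) \<Rightarrow> \<Phi>f i j n | Inr j \<Rightarrow> ef i j)" for i and c :: "nat \<times> int + nat"
  have "\<bar>Z i c\<bar> \<le> R" for i c
  proof (cases c)
    case (Inl p)
    obtain j n where p: "p = (j, n)" by (cases p)
    have "(\<Sum>n\<in>{n}. (\<Phi>f i j n)\<^sup>2) \<le> 1" by (rule P1) simp
    then have "\<bar>\<Phi>f i j n\<bar> \<le> 1" by (simp add: abs_square_le_1)
    then show ?thesis using Inl p by (simp add: Z_def R_def)
  next
    case (Inr j)
    then show ?thesis using P3[of i j] by (simp add: Z_def R_def)
  qed
  then have "\<forall>i. Z i \<in> {f. \<forall>c. \<bar>f c\<bar> \<le> R}" by simp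
  moreover have "seq_compact {f :: nat \<times> int + nat \<Rightarrow> real. \<forall>c. \<bar>f c\<bar> \<le> R}"
    using compact_cube by (subst compact_eq_seq_compact_metric[symmetric])
  ultimately obtain l r where r: "strict_mono r" and lim: "(Z \<circ> r) \<longlonglongrightarrow> l"
    unfolding seq_compact_def by meson
  have coord: "(\<lambda>i. Z (r i) c) \<longlonglongrightarrow> l c" for c
    using continuous_on_tendsto_compose[OF continuous_on_product_coordinates[of c] lim] by (simp add: o_def)
  define \<Phi> where "\<Phi> j n = l (Inl (j, n))" for j n
  define e where "e j = l (Inr j)" for j
  have \<Phi>: "(\<lambda>i. \<Phi>f (r i) j n) \<longlonglongrightarrow> \<Phi> j n" for j n using coord[of "Inl (j, n)"] by (simp add: Z_def \<Phi>_def)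
  have e: "(\<lambda>i. ef (r i) j) \<longlonglongrightarrow> e j" for j using coord[of "Inr j"] by (simp add: Z_def e_def)
  have b1: "(\<Sum>n\<in>B. (\<Phi> j n)\<^sup>2) \<le> 1" if "finite B" for j B
  proof (rule LIMSEQ_le_const2)
    show "(\<lambda>i. \<Sum>n\<in>B. (\<Phi>f (r i) j n)\<^sup>2) \<longlonglongrightarrow> (\<Sum>n\<in>B. (\<Phi> j n)\<^sup>2)" by (intro tendsto_intros \<Phi>)
  qed (use P1[OF that] in blast)
  have b2: "(\<Sum>n\<in>B. ((if n = k then 1 else 0) - (\<Sum>j<?K. \<Phi> j k * \<Phi> j n))\<^sup>2) \<le> 2 * \<eta>" if "finite B" for B
  proof (rule LIMSEQ_le_const2)
    show "(\<lambda>i. \<Sum>n\<in>B. ((if n = k then 1 else 0) - (\<Sum>j<?K. \<Phi>f (r i) j k * \<Phi>f (r i) j n))\<^sup>2)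
      \<longlonglongrightarrow> (\<Sum>n\<in>B. ((if n = k then 1 else 0) - (\<Sum>j<?K. \<Phi> j k * \<Phi> j n))\<^sup>2)" by (intro tendsto_intros \<Phi>)
  qed (use P4[OF that] in blast)
  have eq: "jac a w (\<Phi> j) n = e j * \<Phi> j n" for j n
  proof (rule LIMSEQ_unique)
    show "(\<lambda>i. jac a w (\<Phi>f (r i) j) n) \<longlonglongrightarrow> jac a w (\<Phi> j) n" unfolding jac_def by (intro tendsto_intros \<Phi>)
    have "(\<lambda>i. ef (r i) j * \<Phi>f (r i) j n) \<longlonglongrightarrow> e j * \<Phi> j n" by (intro tendsto_intros \<Phi> e)
    moreover have "eventually (\<lambda>i. ef (r i) j * \<Phi>f (r i) j n = jac a w (\<Phi>f (r i) j) n) sequentially"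
      using eventually_ge_at_top[of "nat \<bar>n - k\<bar>"]
    proof eventually_elim
      case (elim i)
      then have "nat \<bar>n - k\<bar> \<le> Lf (r i)" using seq_suble[OF r, of i] Lf[of "r i"] by linarith
      then have "n \<in> ibox k (Lf (r i))" by (auto simp: ibox_def)
      then show ?case using P2 by simp
    qed
    ultimately show "(\<lambda>i. jac a w (\<Phi>f (r i) j) n) \<longlonglongrightarrow> e j * \<Phi> j n" by (rule Lim_transform_eventually)
  qed
  define \<Psi> where "\<Psi> j n = complex_of_real (\<Phi> j n)" for j n
  \<comment> \<open>A limit can lose all its mass to infinity. It is then no eigenvector, but the
    zero vector still belongs to the span.\<close>
  have span: "eigenspan (jacobi a w) (\<Psi> j)" for j
  proof (cases "\<Psi> j = (\<lambda>_. 0)")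
    case True
    then show ?thesis using eigenspan_0 by simp
  next
    case False
    have "l2_le (\<Psi> j) 1" using b1 by (simp add: l2_le_iff \<Psi>_def)
    then have "\<Psi> j \<in> ell2" by (rule l2_le_imp) simp
    moreover have "jacobi a w (\<Psi> j) = (\<lambda>n. complex_of_real (e j) * \<Psi> j n)"
    proof
      fix n
      have "jacobi a w (\<Psi> j) n = complex_of_real (jac a w (\<Phi> j) n)" by (simp add: jacobi_def jac_def \<Psi>_def)
      then show "jacobi a w (\<Psi> j) n = complex_of_real (e j) * \<Psi> j n" by (simp add: eq \<Psi>_def)
    qed
    ultimately show ?thesis using False by (intro eigenspan_eigenvector) (auto simp: is_eigenvector_def)
  qed
  let ?g = "\<lambda>n. \<Sum>j<?K. complex_of_real (\<Phi> j k) * \<Psi> j n"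
  have "eigenspan (jacobi a w) ?g" by (intro eigenspan_sum span) auto
  moreover have "(if n = k then 1 else 0) - ?g n = complex_of_real ((if n = k then 1 else 0) - (\<Sum>j<?K. \<Phi> j k * \<Phi> j n))" for n
    by (simp add: \<Psi>_def)
  then have "l2_le (\<lambda>n. (if n = k then 1 else 0) - ?g n) (sqrt (2 * \<eta>))"
    using b2 \<eta> by (subst l2_le_iff) (auto simp del: of_real_diff of_real_sum)
  ultimately show ?thesis by blast
qed

section \<open>Almost sure localization\<close>

lemma inj_site: "\<sigma> = 1 \<or> \<sigma> = -1 \<Longrightarrow> inj (site k \<sigma>)"
  by (auto simp: inj_def site_def)

lemma correlator_measurable:
  assumes N: "\<And>i::int. prob_space (N i)" "\<And>i. sets (N i) = sets borel"
  shows "(\<lambda>p. ennreal (bump e (resonance a (snd p) k L \<sigma> (fst p))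
     * decay_factor (hop a k \<sigma>) (\<lambda>i. fst p - snd p (site k \<sigma> i)) L 0 n)) \<in> borel_measurable (lborel \<Otimes>\<^sub>M PiM UNIV N)"
    "(\<lambda>w. correlator a w k L \<sigma> n R i) \<in> borel_measurable (PiM UNIV N)"
proof -
  interpret P: prob_space "PiM UNIV N" by (rule prob_space_PiM) (rule N)
  interpret pair_sigma_finite lborel "PiM UNIV N" ..
  have c0: "(\<lambda>w. w i) \<in> borel_measurable (PiM UNIV N)" for i
    using measurable_component_singleton[of i UNIV N] N(2)[of i] by (simp cong: measurable_cong_sets)
  have c: "(\<lambda>p. fst p - snd p i) \<in> borel_measurable (lborel \<Otimes>\<^sub>M PiM UNIV N)" for i
  proof (rule borel_measurable_diff)
    show "(\<lambda>p. snd p i) \<in> borel_measurable (lborel \<Otimes>\<^sub>M PiM UNIV N)"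
      by (rule measurable_compose[OF measurable_snd c0])
  qed (simp add: measurable_fst'')
  have r: "(\<lambda>p. resonance a (snd p) k L \<sigma> (fst p)) \<in> borel_measurable (lborel \<Otimes>\<^sub>M PiM UNIV N)"
    unfolding resonance_def by (intro borel_measurable_diff riccati_measurable c)
  show m: "(\<lambda>p. ennreal (bump e (resonance a (snd p) k L \<sigma> (fst p))
     * decay_factor (hop a k \<sigma>) (\<lambda>i. fst p - snd p (site k \<sigma> i)) L 0 n)) \<in> borel_measurable (lborel \<Otimes>\<^sub>M PiM UNIV N)" for e
    by (intro measurable_compose[OF _ measurable_ennreal] borel_measurable_times decay_factor_measurable c
        measurable_compose[OF r bump_measurable])
  show "(\<lambda>w. correlator a w k L \<sigma> n R i) \<in> borel_measurable (PiM UNIV N)"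
  proof -
    have "(\<lambda>p. ennreal (bump (1 / real (Suc i)) (resonance a (snd p) k L \<sigma> (fst p))
     * decay_factor (hop a k \<sigma>) (\<lambda>i. fst p - snd p (site k \<sigma> i)) L 0 n) * indicator {-R..R} (fst p)) \<in> borel_measurable (lborel \<Otimes>\<^sub>M PiM UNIV N)"
      by (intro borel_measurable_times_ennreal m measurable_compose[OF measurable_fst borel_measurable_indicator]) simp
    from measurable_pair_swap[OF this] show ?thesis
      unfolding correlator_def by (intro lborel.borel_measurable_nn_integral) (simp add: case_prod_beta')
  qed
qed

text \<open>After exchanging the integrals the energy is fixed and \<open>expectation_decay\<close>
  applies with \<open>s\<close> the Riccati variable of the opposite half-line; \<open>2 * R\<close>
  is the length of the energy window.\<close>

lemma correlator_expectation:
  fixes N :: "int \<Rightarrow> real measure"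
  assumes N: "\<And>i. prob_space (N i)" "\<And>i. sets (N i) = sets borel"
    and law: "\<And>i. i \<le> n \<Longrightarrow> bounded_law (N (site k \<sigma> i)) \<beta> V"
    and \<sigma>: "\<sigma> = 1 \<or> \<sigma> = -1" and a: "\<And>i. 0 < a i" "\<And>i. a i \<le> A" and V: "0 \<le> V" and R: "0 \<le> R"
    and \<epsilon>: "\<epsilon> = 1 / (131072 * (8 * (R + V + A) + 2)\<^sup>2)"
    and n: "1 \<le> n" "n \<le> L"
  shows "(\<integral>\<^sup>+w. correlator a w k L \<sigma> n R i \<partial>PiM UNIV N) \<le> ennreal (2 * R * (\<beta> * sqrt ((1 - \<epsilon> / \<beta>\<^sup>2) ^ ((n - 1) div 2))))"
proof -
  interpret P: prob_space "PiM UNIV N" by (rule prob_space_PiM) (rule N)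
  interpret pair_sigma_finite lborel "PiM UNIV N" ..
  interpret N0: bounded_law "N (site k \<sigma> 0)" \<beta> V by (rule law) simp
  let ?e = "1 / real (Suc i)" and ?b = "\<beta> * sqrt ((1 - \<epsilon> / \<beta>\<^sup>2) ^ ((n - 1) div 2))"
  let ?f = "\<lambda>E w. ennreal (bump ?e (resonance a w k L \<sigma> E) * decay_factor (hop a k \<sigma>) (\<lambda>i. E - w (site k \<sigma> i)) L 0 n)"
  note m = correlator_measurable(1)[OF N, of ?e a k L \<sigma> n]
  have hop: "0 < hop a k \<tau> i" "hop a k \<tau> i \<le> A" for \<tau> i using a by (auto simp: hop_def)
  have "(\<integral>\<^sup>+w. correlator a w k L \<sigma> n R i \<partial>PiM UNIV N) = (\<integral>\<^sup>+w. (\<integral>\<^sup>+E. ?f E w * indicator {-R..R} E \<partial>lborel) \<partial>PiM UNIV N)"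
    unfolding correlator_def ..
  also have "\<dots> = (\<integral>\<^sup>+E. (\<integral>\<^sup>+w. ?f E w * indicator {-R..R} E \<partial>PiM UNIV N) \<partial>lborel)"
  proof (rule Fubini')
    show "(\<lambda>(E, w). ?f E w * indicator {-R..R} E) \<in> borel_measurable (lborel \<Otimes>\<^sub>M PiM UNIV N)"
      unfolding case_prod_beta'
      by (intro borel_measurable_times_ennreal m measurable_compose[OF measurable_fst borel_measurable_indicator]) simp
  qed
  also have "\<dots> \<le> (\<integral>\<^sup>+E. ennreal ?b * indicator {-R..R} E \<partial>lborel)"
  proof (intro nn_integral_mono)
    fix E
    show "(\<integral>\<^sup>+w. ?f E w * indicator {-R..R} E \<partial>PiM UNIV N) \<le> ennreal ?b * indicator {-R..R} E"
    proof (cases "E \<in> {-R..R}")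
      case True
      define s where "s w = riccati (hop a k (-\<sigma>)) (\<lambda>i. E - w (site k (-\<sigma>) i)) L 0" for w :: "int \<Rightarrow> real"
      have c0: "(\<lambda>w. w i) \<in> borel_measurable (PiM UNIV N)" for i
        using measurable_component_singleton[of i UNIV N] N(2)[of i] by (simp cong: measurable_cong_sets)
      have sm: "s \<in> borel_measurable (PiM UNIV N)"
        unfolding s_def by (intro riccati_measurable borel_measurable_diff borel_measurable_const c0)
      \<comment> \<open>The opposite Riccati variable at \<open>k\<close> reads only sites strictly
        beyond \<open>k\<close>, so it is unaffected even by resampling the center.\<close>
      have si: "s (w(site k \<sigma> i := x)) = s w" for w i x
        unfolding s_def
      proof (rule riccati_cong)
        fix j :: nat assume "0 < j"
        then have "site k (-\<sigma>) j \<noteq> site k \<sigma> i" using \<sigma> by (auto simp: site_def)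
        then show "E - (w(site k \<sigma> i := x)) (site k (-\<sigma>) j) = E - w (site k (-\<sigma>) j)" by simp
      qed
      have t: "\<bar>E\<bar> \<le> R" using True by auto
      have "(\<integral>\<^sup>+w. ennreal (bump ?e (E - w (site k \<sigma> 0) - riccati (hop a k \<sigma>) (\<lambda>i. E - w (site k \<sigma> i)) L 0 - s w)
            * decay_factor (hop a k \<sigma>) (\<lambda>i. E - w (site k \<sigma> i)) L 0 n) \<partial>PiM UNIV N) \<le> ennreal ?b"
        by (rule expectation_decay[OF N law inj_site[OF \<sigma>] sm si hop t V \<epsilon> _ n]) auto
      then show ?thesis using True by (simp add: resonance_def s_def)
    qed simp
  qed
  also have "\<dots> = ennreal ?b * ennreal (2 * R)"
    using R by (simp add: nn_integral_cmult_indicator)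
  also have "\<dots> = ennreal (2 * R * ?b)"
  proof -
    have "0 \<le> 1 - \<epsilon> / \<beta>\<^sup>2"
    proof -
      have "0 < A" using a[of 0] by simp
      then have "1 \<le> 131072 * (8 * (R + V + A) + 2)\<^sup>2 * \<beta>\<^sup>2"
        using one_le_power[of "8 * (R + V + A) + 2" 2] one_le_power[OF N0.beta, of 2] R V
        by (intro mult_ge1_I) auto
      then show ?thesis unfolding \<epsilon> by (simp add: field_simps)
    qed
    then show ?thesis using R N0.beta by (subst ennreal_mult[symmetric]) (auto simp: mult_ac)
  qed
  finally show ?thesis .
qed

text \<open>Fatou's lemma is used twice, for the smearing index and for the box size. The expected
  tail beyond distance \<open>M\<close> is at most \<open>tl M\<close>, which tends to 0, so almost
  surely the infimum over \<open>M\<close> of the lower limits over \<open>L\<close> is 0. A small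
  lower limit speaks only of infinitely many \<open>L\<close>, which is all that compactness needs.
  \<beta> may depend on \<open>n\<close> because the bound at distance \<open>n\<close> uses only
  the laws up to that distance.\<close>

lemma AE_delta_approximation:
  fixes N :: "int \<Rightarrow> real measure" and \<beta> :: "nat \<Rightarrow> real"
  assumes N: "\<And>i. prob_space (N i)" "\<And>i. sets (N i) = sets borel" "\<And>i. AE x in N i. \<bar>x\<bar> \<le> V"
    and law: "\<And>n i \<sigma>. \<sigma> = 1 \<or> \<sigma> = -1 \<Longrightarrow> i \<le> n \<Longrightarrow> 1 \<le> n \<Longrightarrow> bounded_law (N (site k \<sigma> i)) (\<beta> n) V"
    and a: "\<And>i. 0 < a i" "\<And>i. a i \<le> A" and V: "0 \<le> V" and R: "2 * A + V < R"
    and \<epsilon>: "\<epsilon> = 1 / (131072 * (8 * (R + V + A) + 2)\<^sup>2)"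
    and sm: "summable (\<lambda>n. \<beta> n * sqrt ((1 - \<epsilon> / (\<beta> n)\<^sup>2) ^ ((n - 1) div 2)))"
  shows "AE w in PiM UNIV N. \<forall>\<eta>>0. \<exists>g. eigenspan (jacobi a w) g \<and> l2_le (\<lambda>n. (if n = k then 1 else 0) - g n) \<eta>"
proof -
  let ?M = "PiM UNIV N"
  interpret P: prob_space ?M by (rule prob_space_PiM) (rule N)
  have A: "0 < A" using a[of 0] by simp
  have R0: "0 \<le> R" using A V R by simp
  \<comment> \<open>The factor \<open>4 * R\<close> adds the bounds for both directions,
    \<open>2 * R\<close> each.\<close>
  define b where "b n = 4 * R * (\<beta> n * sqrt ((1 - \<epsilon> / (\<beta> n)\<^sup>2) ^ ((n - 1) div 2)))" for n
  have sb: "summable b" unfolding b_def by (intro summable_mult sm)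
  have b0: "0 \<le> b n" if "1 \<le> n" for n
  proof -
    interpret bounded_law "N (site k 1 0)" "\<beta> n" V by (rule law) (use that in auto)
    have "1 \<le> 131072 * (8 * (R + V + A) + 2)\<^sup>2 * (\<beta> n)\<^sup>2"
      using one_le_power[of "8 * (R + V + A) + 2" 2] one_le_power[OF beta, of 2] R0 V A
      by (intro mult_ge1_I) auto
    then have "0 \<le> 1 - \<epsilon> / (\<beta> n)\<^sup>2" unfolding \<epsilon> by (simp add: field_simps)
    then show ?thesis unfolding b_def using R0 beta by simp
  qed
  define c where "c w L \<sigma> n = liminf (correlator a w k L \<sigma> n R)" for w L \<sigma> n
  define W where "W M L w = (\<Sum>n=Suc M..L. c w L 1 n + c w L (-1) n)" for M L w
  define Y where "Y M w = liminf (\<lambda>L. W M L w)" for M w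
  have c_meas [measurable]: "(\<lambda>w. c w L \<sigma> n) \<in> borel_measurable ?M" for L \<sigma> n
    unfolding c_def by (intro borel_measurable_liminf correlator_measurable N)
  have W_meas [measurable]: "W M L \<in> borel_measurable ?M" for M L unfolding W_def by measurable
  have Y_meas [measurable]: "Y M \<in> borel_measurable ?M" for M unfolding Y_def by measurable
  have c_int: "(\<integral>\<^sup>+w. c w L \<sigma> n \<partial>?M) \<le> ennreal (b n / 2)" if \<sigma>: "\<sigma> = 1 \<or> \<sigma> = -1" and n: "1 \<le> n" "n \<le> L" for L \<sigma> n
  proof -
    have "(\<integral>\<^sup>+w. c w L \<sigma> n \<partial>?M) \<le> liminf (\<lambda>i. \<integral>\<^sup>+w. correlator a w k L \<sigma> n R i \<partial>?M)"
      unfolding c_def by (intro nn_integral_liminf correlator_measurable N)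
    also have "\<dots> \<le> liminf (\<lambda>i::nat. ennreal (b n / 2))"
    proof (intro Liminf_mono always_eventually allI)
      fix i
      have "(\<integral>\<^sup>+w. correlator a w k L \<sigma> n R i \<partial>?M) \<le> ennreal (2 * R * (\<beta> n * sqrt ((1 - \<epsilon> / (\<beta> n)\<^sup>2) ^ ((n - 1) div 2))))"
        by (rule correlator_expectation[OF N(1,2) _ \<sigma> a V R0 \<epsilon> n]) (rule law[OF \<sigma> _ n(1)])
      also have "2 * R * (\<beta> n * sqrt ((1 - \<epsilon> / (\<beta> n)\<^sup>2) ^ ((n - 1) div 2))) = b n / 2" by (simp add: b_def)
      finally show "(\<integral>\<^sup>+w. correlator a w k L \<sigma> n R i \<partial>?M) \<le> ennreal (b n / 2)" .
    qed
    also have "\<dots> = ennreal (b n / 2)" by (simp add: Liminf_const)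
    finally show ?thesis .
  qed
  define tl where "tl M = (\<Sum>n. b (n + Suc M))" for M
  have sbs: "summable (\<lambda>n. b (n + Suc M))" for M using sb by (subst summable_iff_shift)
  have W_int: "(\<integral>\<^sup>+w. W M L w \<partial>?M) \<le> ennreal (tl M)" for M L
  proof -
    have "(\<integral>\<^sup>+w. W M L w \<partial>?M) = (\<Sum>n=Suc M..L. (\<integral>\<^sup>+w. c w L 1 n \<partial>?M) + (\<integral>\<^sup>+w. c w L (-1) n \<partial>?M))"
      unfolding W_def by (simp add: nn_integral_sum nn_integral_add)
    also have "\<dots> \<le> (\<Sum>n=Suc M..L. ennreal (b n / 2) + ennreal (b n / 2))"
      by (intro sum_mono add_mono c_int) auto
    also have "\<dots> = (\<Sum>n=Suc M..L. ennreal (b n))"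
      using b0 by (intro sum.cong) (auto simp: ennreal_plus[symmetric] simp del: ennreal_plus)
    also have "\<dots> = ennreal (\<Sum>n=Suc M..L. b n)" using b0 by (intro sum_ennreal) auto
    also have "\<dots> \<le> ennreal (tl M)"
    proof (rule ennreal_leI)
      have "(\<Sum>n=Suc M..L. b n) = (\<Sum>n<L - M. b (n + Suc M))"
        by (rule sum.reindex_bij_witness[of _ "\<lambda>n. n + Suc M" "\<lambda>n. n - Suc M"]) auto
      also have "\<dots> \<le> tl M" unfolding tl_def using b0 by (intro sum_le_suminf sbs) auto
      finally show "(\<Sum>n=Suc M..L. b n) \<le> tl M" .
    qed
    finally show ?thesis .
  qed
  have Y_int: "(\<integral>\<^sup>+w. Y M w \<partial>?M) \<le> ennreal (tl M)" for M
  proof -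
    have "(\<integral>\<^sup>+w. Y M w \<partial>?M) \<le> liminf (\<lambda>L. \<integral>\<^sup>+w. W M L w \<partial>?M)"
      unfolding Y_def by (intro nn_integral_liminf) measurable
    also have "\<dots> \<le> liminf (\<lambda>L::nat. ennreal (tl M))" by (intro Liminf_mono always_eventually allI W_int)
    finally show ?thesis by (simp add: Liminf_const)
  qed
  have tl0: "tl \<longlonglongrightarrow> 0"
    unfolding tl_def using LIMSEQ_Suc[OF suminf_exist_split2[OF sb]] by simp
  have "(\<integral>\<^sup>+w. (INF M. Y M w) \<partial>?M) = 0"
  proof -
    have "(\<integral>\<^sup>+w. (INF M. Y M w) \<partial>?M) \<le> ennreal (tl M)" for M
      by (rule order_trans[OF nn_integral_mono Y_int]) (auto intro: INF_lower)
    moreover have "(\<lambda>M. ennreal (tl M)) \<longlonglongrightarrow> ennreal 0" by (intro tendsto_intros tl0)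
    ultimately have "(\<integral>\<^sup>+w. (INF M. Y M w) \<partial>?M) \<le> ennreal 0" by (intro LIMSEQ_le_const) auto
    then show ?thesis by simp
  qed
  then have "AE w in ?M. (INF M. Y M w) = 0"
    by (subst (asm) nn_integral_0_iff_AE) measurable
  moreover have "AE w in ?M. \<forall>i. \<bar>w i\<bar> \<le> V"
    unfolding AE_all_countable using N by (intro allI AE_PiM_component) auto
  ultimately show ?thesis
  proof eventually_elim
    case (elim w)
    show ?case
    proof (intro allI impI)
      fix \<eta> :: real assume \<eta>: "0 < \<eta>"
      \<comment> \<open>Chosen so that the error \<open>sqrt (2 * \<theta>)\<close> of
        \<open>delta_approximation\<close> is \<eta>.\<close>
      define \<theta> where "\<theta> = \<eta>\<^sup>2 / 2"
      have \<theta>: "0 < \<theta>" "sqrt (2 * \<theta>) = \<eta>" using \<eta> by (auto simp: \<theta>_def)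
      have "(INF M. Y M w) < ennreal \<theta>" using elim \<theta> by simp
      then obtain M where M: "Y M w < ennreal \<theta>" by (auto simp: INF_less_iff)
      have "\<exists>\<^sub>\<infinity>L. W M L w < ennreal \<theta>"
      proof (rule ccontr)
        assume "\<not> ?thesis"
        then have "eventually (\<lambda>L. ennreal \<theta> \<le> W M L w) sequentially"
          by (simp add: not_frequently not_less cofinite_eq_sequentially)
        then have "ennreal \<theta> \<le> Y M w" unfolding Y_def by (rule Liminf_bounded)
        then show False using M by simp
      qed
      then have "\<exists>\<^sub>\<infinity>L. \<exists>F. eigenbasis a w k L F
          \<and> (\<Sum>\<phi>\<in>F. \<Sum>m=Suc M..L. \<bar>\<phi> k * \<phi> (site k 1 m)\<bar> + \<bar>\<phi> k * \<phi> (site k (-1) m)\<bar>) \<le> \<theta>"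
      proof (rule INFM_mono)
        fix L assume L: "W M L w < ennreal \<theta>"
        obtain F where F: "eigenbasis a w k L F" using ex_eigenbasis by blast
        have lb: "ennreal (\<Sum>\<phi>\<in>F. \<bar>\<phi> k * \<phi> (site k \<sigma> n)\<bar>) \<le> c w L \<sigma> n" if "\<sigma> = 1 \<or> \<sigma> = -1" "n \<le> L" for \<sigma> n
          unfolding c_def by (rule correlator_lower_bound[OF F that a _ R]) (use elim in auto)
        have "ennreal (\<Sum>\<phi>\<in>F. \<Sum>m=Suc M..L. \<bar>\<phi> k * \<phi> (site k 1 m)\<bar> + \<bar>\<phi> k * \<phi> (site k (-1) m)\<bar>)
            = (\<Sum>m=Suc M..L. ennreal (\<Sum>\<phi>\<in>F. \<bar>\<phi> k * \<phi> (site k 1 m)\<bar>) + ennreal (\<Sum>\<phi>\<in>F. \<bar>\<phi> k * \<phi> (site k (-1) m)\<bar>))"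
          by (subst sum.swap) (simp add: sum.distrib sum_nonneg ennreal_plus[symmetric] del: ennreal_plus)
        also have "\<dots> \<le> W M L w" unfolding W_def by (intro sum_mono add_mono lb) auto
        finally have "ennreal (\<Sum>\<phi>\<in>F. \<Sum>m=Suc M..L. \<bar>\<phi> k * \<phi> (site k 1 m)\<bar> + \<bar>\<phi> k * \<phi> (site k (-1) m)\<bar>) \<le> ennreal \<theta>"
          using L by simp
        then show "\<exists>F. eigenbasis a w k L F
          \<and> (\<Sum>\<phi>\<in>F. \<Sum>m=Suc M..L. \<bar>\<phi> k * \<phi> (site k 1 m)\<bar> + \<bar>\<phi> k * \<phi> (site k (-1) m)\<bar>) \<le> \<theta>"
          using F \<theta> by (intro exI[of _ F]) (simp add: ennreal_le_iff)
      qed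
      from delta_approximation[OF a _ less_imp_le[OF \<theta>(1)] this] elim \<theta>
      show "\<exists>g. eigenspan (jacobi a w) g \<and> l2_le (\<lambda>n. (if n = k then 1 else 0) - g n) \<eta>" by auto
    qed
  qed
qed

section \<open>Summability and the choice of parameters\<close>

lemma summable_stretched:
  fixes D z \<epsilon> :: real and k0 :: nat
  assumes D: "1 \<le> D" and z: "0 \<le> z" "z < 1 / 2" and \<epsilon>: "0 < \<epsilon>" "\<epsilon> \<le> 1"
  defines "\<beta> \<equiv> \<lambda>n. D * real (k0 + n) powr z"
  shows "summable (\<lambda>n. \<beta> n * sqrt ((1 - \<epsilon> / (\<beta> n)\<^sup>2) ^ ((n - 1) div 2)))"
proof -
  define p where "p = 1 - 2 * z"
  \<comment> \<open>The 8 combines the 4 in \<open>x / 4 \<le> (n - 1) div 2\<close> with the 2 from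
    the square root of the exponential.\<close>
  define q where "q = \<epsilon> / (8 * D\<^sup>2)"
  \<comment> \<open>The stretched exponential is dominated by
    \<open>x powr (- (p * real j))\<close>. With \<open>p * real j \<ge> 3\<close> the growth
    \<open>x powr z\<close> of \<beta> is absorbed and \<open>x powr (- 2)\<close> remains.\<close>
  obtain j :: nat where j: "3 / p < real j" using reals_Archimedean2 by blast
  have p: "0 < p" using z by (simp add: p_def)
  have q: "0 < q" using \<epsilon> D by (simp add: q_def)
  have j0: "0 < real j" using j p by (smt (verit) divide_pos_pos)
  have jp: "3 \<le> p * real j" using j p by (simp add: field_simps)
  \<comment> \<open>\<open>k0 + 6 \<le> n\<close> ensures that \<open>(n - 1) div 2\<close> is at
    least a quarter of \<open>k0 + n\<close>, despite the offset and the rounding.\<close>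
  have bound: "norm (\<beta> n * sqrt ((1 - \<epsilon> / (\<beta> n)\<^sup>2) ^ ((n - 1) div 2))) \<le> D * (real j / q) ^ j * (1 / (real n)\<^sup>2)"
    if n: "k0 + 6 \<le> n" for n
  proof -
    define x where "x = real (k0 + n)"
    have bx: "\<beta> n = D * x powr z" unfolding \<beta>_def x_def ..
    have x1: "1 \<le> x" "real n \<le> x" using n by (auto simp: x_def)
    have b1: "1 \<le> \<beta> n"
    proof -
      have "1 \<le> x powr z" using x1 z by (intro ge_one_powr_ge_zero)
      then show ?thesis using D unfolding \<beta>_def x_def[symmetric] by (intro mult_ge1_I)
    qed
    define u where "u = \<epsilon> / (\<beta> n)\<^sup>2"
    have b2: "(\<beta> n)\<^sup>2 = D\<^sup>2 * x powr (2 * z)"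
    proof -
      have "x powr (2 * z) = x powr z * x powr z" by (simp add: powr_add[symmetric])
      then show ?thesis unfolding \<beta>_def x_def[symmetric] by (simp add: power2_eq_square)
    qed
    have u: "0 \<le> u" "u \<le> 1"
    proof -
      have "\<epsilon> \<le> (\<beta> n)\<^sup>2" using \<epsilon>(2) one_le_power[OF b1, of 2] by linarith
      then show "0 \<le> u" "u \<le> 1" using \<epsilon> b1 by (auto simp: u_def divide_le_eq)
    qed
    let ?m = "(n - 1) div 2"
    have "(1 - u) ^ ?m \<le> exp (- u) ^ ?m" using u exp_ge_add_one_self[of "- u"] by (intro power_mono) auto
    also have "\<dots> = exp (- (u * real ?m))" by (simp add: exp_of_nat_mult[symmetric] mult.commute)
    finally have "sqrt ((1 - u) ^ ?m) \<le> sqrt (exp (- (u * real ?m)))" by (rule real_sqrt_le_mono)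
    also have "\<dots> = exp (- (u * real ?m) / 2)"
      by (rule real_sqrt_unique) (auto simp: power2_eq_square exp_add[symmetric])
    also have "\<dots> \<le> exp (- (q * x powr p))"
    proof -
      have "x / 4 \<le> real ?m"
      proof -
        have "real (n - 1) \<le> 2 * real ?m + 1" by linarith
        moreover have "x \<le> 2 * real n - 6" using n unfolding x_def by linarith
        ultimately show ?thesis using n by linarith
      qed
      then have "u * (x / 4) \<le> u * real ?m" using u by (intro mult_left_mono)
      moreover have "u * (x / 4) = 2 * (q * x powr p)"
      proof -
        have "x powr p = x / x powr (2 * z)" using x1 by (simp add: p_def powr_diff)
        then show ?thesis unfolding u_def b2 q_def by (simp add: field_simps)
      qed
      ultimately show ?thesis by simp
    qed
    also have "\<dots> \<le> (real j / (q * x powr p)) ^ j"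
    proof -
      let ?t = "q * x powr p"
      have t: "0 < ?t" using q x1 by simp
      have "?t / real j \<le> exp (?t / real j)" using exp_ge_add_one_self[of "?t / real j"] by linarith
      then have "(?t / real j) ^ j \<le> exp (?t / real j) ^ j" using t j0 by (intro power_mono) auto
      also have "\<dots> = exp ?t" using j0 by (simp add: exp_of_nat_mult[symmetric])
      finally have "inverse (exp ?t) \<le> inverse ((?t / real j) ^ j)" using t j0 by (intro le_imp_inverse_le) auto
      then show ?thesis by (simp add: exp_minus power_inverse[symmetric])
    qed
    also have "\<dots> = (real j / q) ^ j * x powr (- (p * real j))"
      using x1 by (simp add: power_divide power_mult_distrib powr_minus powr_realpow[symmetric] powr_powr field_simps)
    finally have s: "sqrt ((1 - u) ^ ?m) \<le> (real j / q) ^ j * x powr (- (p * real j))" .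
    have "\<beta> n * sqrt ((1 - u) ^ ?m) \<le> \<beta> n * ((real j / q) ^ j * x powr (- (p * real j)))"
      using s b1 by (intro mult_left_mono) auto
    also have "\<dots> = D * (real j / q) ^ j * x powr (z - p * real j)"
      using x1 by (simp add: bx powr_diff powr_minus field_simps)
    also have "\<dots> \<le> D * (real j / q) ^ j * x powr (- 2)"
      using x1 jp z D q by (intro mult_left_mono powr_mono) auto
    also have "\<dots> \<le> D * (real j / q) ^ j * (1 / (real n)\<^sup>2)"
    proof (intro mult_left_mono)
      have "x powr (- 2) = 1 / x\<^sup>2" using x1 by (simp add: powr_minus_divide powr_numeral)
      also have "\<dots> \<le> 1 / (real n)\<^sup>2" using x1 n by (intro divide_left_mono power_mono mult_pos_pos) auto
      finally show "x powr (- 2) \<le> 1 / (real n)\<^sup>2" .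
    qed (use D q in auto)
    finally show ?thesis using b1 u by (simp add: u_def[symmetric])
  qed
  have "summable (\<lambda>n. D * (real j / q) ^ j * (1 / (real n)\<^sup>2))"
    using inverse_power_summable[of 2, where ?'a = real] by (intro summable_mult) (simp add: inverse_eq_divide)
  then show ?thesis
    by (rule summable_comparison_test'[OF _ bound])
qed

text \<open>Rescaling by \<open>d\<close> raises the density bound to \<open>B / d\<close>; as d
  \<le> 1 it does not enlarge the support, so one \<open>V\<close> serves all sites.\<close>

lemma bounded_law_scaled_density:
  fixes r :: "real \<Rightarrow> real"
  assumes r_meas [measurable]: "r \<in> borel_measurable borel" and r0: "\<And>x. 0 \<le> r x" and rB: "\<And>x. r x \<le> B"
    and supp: "\<And>x. K < \<bar>x\<bar> \<Longrightarrow> r x = 0" and int: "(\<integral>\<^sup>+ x. ennreal (r x) \<partial>lborel) = 1"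
    and d: "0 < d" "d \<le> 1" and c: "\<bar>c\<bar> \<le> Bc" and \<beta>: "1 \<le> \<beta>" "B / d \<le> \<beta>"
  shows "bounded_law (density lborel (\<lambda>x. ennreal (r ((x - c) / d) / d))) \<beta> (Bc + K)"
proof -
  let ?\<rho> = "\<lambda>x. ennreal (r ((x - c) / d) / d)"
  have "(\<integral>\<^sup>+x. ?\<rho> x \<partial>lborel) = (\<integral>\<^sup>+x. ennreal (1 / d) * ennreal (r (- c / d + (1 / d) * x)) \<partial>lborel)"
    using d r0 by (intro nn_integral_cong) (simp add: ennreal_mult[symmetric] diff_divide_distrib add.commute)
  also have "\<dots> = ennreal \<bar>1 / d\<bar> * (\<integral>\<^sup>+x. ennreal (r (- c / d + (1 / d) * x)) \<partial>lborel)"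
    using d by (subst nn_integral_cmult) auto
  also have "\<dots> = 1"
    using nn_integral_real_affine[of "\<lambda>x. ennreal (r x)" "1 / d" "- c / d"] d int by simp
  finally have "prob_space (density lborel ?\<rho>)"
    by (intro prob_spaceI) (simp add: emeasure_density)
  then show ?thesis
  proof (intro bounded_law.intro bounded_law_axioms.intro)
    fix h :: "real \<Rightarrow> ennreal" assume [measurable]: "h \<in> borel_measurable borel"
    have "(\<integral>\<^sup>+x. h x \<partial>density lborel ?\<rho>) = (\<integral>\<^sup>+x. ?\<rho> x * h x \<partial>lborel)"
      by (subst nn_integral_density) auto
    also have "\<dots> \<le> (\<integral>\<^sup>+x. ennreal \<beta> * h x \<partial>lborel)"
    proof (intro nn_integral_mono mult_right_mono ennreal_leI)
      fix x
      have "r ((x - c) / d) / d \<le> B / d" using rB d by (intro divide_right_mono) auto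
      then show "r ((x - c) / d) / d \<le> \<beta>" using \<beta> by simp
    qed simp
    also have "\<dots> = ennreal \<beta> * (\<integral>\<^sup>+x. h x \<partial>lborel)" by (subst nn_integral_cmult) auto
    finally show "(\<integral>\<^sup>+x. h x \<partial>density lborel ?\<rho>) \<le> ennreal \<beta> * (\<integral>\<^sup>+x. h x \<partial>lborel)" .
  next
    show "AE x in density lborel ?\<rho>. \<bar>x\<bar> \<le> Bc + K"
    proof (subst AE_density, measurable, rule AE_I2, rule impI, rule ccontr)
      fix x assume p: "0 < ?\<rho> x" and x: "\<not> \<bar>x\<bar> \<le> Bc + K"
      have "K < \<bar>x - c\<bar>" using x c by linarith
      also have "\<dots> \<le> \<bar>x - c\<bar> / d" using d by (simp add: pos_le_divide_eq mult_left_le)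
      also have "\<dots> = \<bar>(x - c) / d\<bar>" using d by simp
      finally show False using p supp by simp
    qed
  qed (use \<beta> in auto)
qed

theorem theorem2p2:
  fixes r :: "real \<Rightarrow> real" and d c a :: "int \<Rightarrow> real" and \<delta> C \<zeta> :: real
  assumes r_meas: "r \<in> borel_measurable borel"
    and r_nonneg: "\<And>x. r x \<ge> 0"
    and r_bdd: "\<exists>B. \<forall>x. r x \<le> B"
    and r_supp: "\<exists>K. \<forall>x. \<bar>x\<bar> > K \<longrightarrow> r x = 0"
    and r_int: "(\<integral>\<^sup>+ x. ennreal (r x) \<partial>lborel) = 1"
    and d_pos: "\<And>n. 0 < d n" and d_le1: "\<And>n. d n \<le> 1"
    and C_pos: "C > 0" and zeta: "\<zeta> < 1/2"
    and d_lower: "\<And>n. n \<noteq> 0 \<Longrightarrow> d n \<ge> C * \<bar>real_of_int n\<bar> powr (- \<zeta>)"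
    and c_bdd: "\<exists>B. \<forall>n. \<bar>c n\<bar> \<le> B"
    and a_bdd: "\<exists>B. \<forall>n. \<bar>a n\<bar> \<le> B"
    and \<delta>_pos: "\<delta> > 0" and a_lower: "\<And>n. a n \<ge> \<delta>"
  shows "AE \<omega> in anderson_measure r d c. pure_point_spectrum (jacobi a \<omega>)"
proof -
  obtain B0 where B0: "\<And>x. r x \<le> B0" using r_bdd by blast
  obtain K0 where K0: "\<And>x. K0 < \<bar>x\<bar> \<Longrightarrow> r x = 0" using r_supp by blast
  obtain Bc where Bc: "\<And>n. \<bar>c n\<bar> \<le> Bc" using c_bdd by blast
  obtain A where A: "\<And>n. \<bar>a n\<bar> \<le> A" using a_bdd by blast
  define B where "B = max 1 B0"
  define K where "K = max 0 K0"
  have rB: "r x \<le> B" and supp: "K < \<bar>x\<bar> \<Longrightarrow> r x = 0" for x using B0[of x] K0 by (auto simp: B_def K_def)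
  have B1: "1 \<le> B" by (simp add: B_def)
  define V where "V = Bc + K"
  have V: "0 \<le> V" using order_trans[OF abs_ge_zero Bc] by (simp add: V_def K_def)
  have a: "0 < a i" "a i \<le> A" for i using a_lower[of i] \<delta>_pos A[of i] by auto
  have A0: "0 < A" using a[of 0] by simp
  \<comment> \<open>Any energy window beyond the common eigenvalue bound \<open>2 * A + V\<close>
    would do.\<close>
  define R where "R = 2 * A + V + 1"
  define \<epsilon> where "\<epsilon> = 1 / (131072 * (8 * (R + V + A) + 2)\<^sup>2)"
  have \<epsilon>: "0 < \<epsilon>" "\<epsilon> \<le> 1"
  proof -
    have "1 \<le> 131072 * (8 * (R + V + A) + 2)\<^sup>2"
      using one_le_power[of "8 * (R + V + A) + 2" 2] A0 V by (intro mult_ge1_I) (auto simp: R_def)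
    then show "0 < \<epsilon>" "\<epsilon> \<le> 1" by (auto simp: \<epsilon>_def divide_le_eq)
  qed
  define N where "N n = density lborel (\<lambda>x. ennreal (r ((x - c n) / d n) / d n))" for n
  have law: "bounded_law (N n) \<beta> V" if "1 \<le> \<beta>" "B / d n \<le> \<beta>" for n \<beta>
    unfolding N_def V_def
    by (rule bounded_law_scaled_density[OF r_meas r_nonneg rB supp r_int d_pos d_le1 Bc that])
  have law0: "bounded_law (N n) (max 1 (B / d n)) V" for n by (rule law) auto
  have N: "prob_space (N n)" "sets (N n) = sets borel" "AE x in N n. \<bar>x\<bar> \<le> V" for n
    using law0[of n] by (auto simp: bounded_law_def bounded_law_axioms_def)
  \<comment> \<open>Replacing a negative \<zeta> by 0 weakens the lower bound on \<open>d n\<close>,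
    but makes it decreasing in the distance.\<close>
  define z where "z = max \<zeta> 0"
  have z: "0 \<le> z" "z < 1 / 2" using zeta by (auto simp: z_def)
  \<comment> \<open>Site 0 is not covered by the power bound, so \<open>d 0\<close> enters the
    constant.\<close>
  define C' where "C' = min C (d 0)"
  have C': "0 < C'" using C_pos d_pos by (simp add: C'_def)
  have d_low: "C' * real x powr (- z) \<le> d n" if n: "\<bar>n\<bar> \<le> int x" and x: "1 \<le> x" for n x
  proof (cases "n = 0")
    case True
    have "real x powr (- z) \<le> real x powr 0" using x z by (intro powr_mono) auto
    then have "C' * real x powr (- z) \<le> C' * 1" using C' x by (intro mult_left_mono) auto
    then show ?thesis using True by (simp add: C'_def)
  next
    case False
    have n1: "1 \<le> \<bar>real_of_int n\<bar>" "\<bar>real_of_int n\<bar> \<le> real x" using False n by linarith+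
    have "real x powr (- z) \<le> \<bar>real_of_int n\<bar> powr (- z)" using n1 z by (intro powr_mono2') auto
    also have "\<dots> \<le> \<bar>real_of_int n\<bar> powr (- \<zeta>)" using n1 by (intro powr_mono) (auto simp: z_def)
    finally have "C' * real x powr (- z) \<le> C * \<bar>real_of_int n\<bar> powr (- \<zeta>)"
      using C' by (intro mult_mono) (auto simp: C'_def)
    then show ?thesis using d_lower[OF False] by simp
  qed
  \<comment> \<open>Sites within distance \<open>n\<close> of \<open>k\<close> have absolute value
    at most \<bar>k\<bar> + n, so all their densities are bounded by \<open>D\<close> times
    (\<bar>k\<bar> + n) powr z.\<close>
  define D where "D = max 1 (B / C')"
  have "AE w in PiM UNIV N. \<forall>\<eta>>0. \<exists>g. eigenspan (jacobi a w) g \<and> l2_le (\<lambda>n. (if n = k then 1 else 0) - g n) \<eta>" for k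
  proof (rule AE_delta_approximation[where \<beta> = "\<lambda>n. D * real (nat \<bar>k\<bar> + n) powr z", OF N _ a V _ \<epsilon>_def])
    show "2 * A + V < R" by (simp add: R_def)
    show "summable (\<lambda>n. D * real (nat \<bar>k\<bar> + n) powr z * sqrt ((1 - \<epsilon> / (D * real (nat \<bar>k\<bar> + n) powr z)\<^sup>2) ^ ((n - 1) div 2)))"
      by (rule summable_stretched[OF _ z \<epsilon>]) (simp add: D_def)
    fix n i :: nat and \<sigma> :: int
    assume h: "\<sigma> = 1 \<or> \<sigma> = -1" "i \<le> n" "1 \<le> n"
    let ?x = "nat \<bar>k\<bar> + n"
    have x1: "1 \<le> ?x" using h by simp
    have p1: "1 \<le> real ?x powr z" using x1 z by (intro ge_one_powr_ge_zero) auto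
    show "bounded_law (N (site k \<sigma> i)) (D * real ?x powr z) V"
    proof (rule law)
      show "1 \<le> D * real ?x powr z" using p1 by (intro mult_ge1_I) (auto simp: D_def)
      have "C' * real ?x powr (- z) \<le> d (site k \<sigma> i)" using h by (intro d_low x1) (auto simp: site_def)
      then have "B / d (site k \<sigma> i) \<le> B / (C' * real ?x powr (- z))"
        using B1 C' x1 d_pos by (intro divide_left_mono mult_pos_pos) auto
      also have "\<dots> = B / C' * real ?x powr z" by (simp add: powr_minus field_simps)
      also have "\<dots> \<le> D * real ?x powr z" by (intro mult_right_mono) (auto simp: D_def)
      finally show "B / d (site k \<sigma> i) \<le> D * real ?x powr z" .
    qed
  qed
  then have "AE w in PiM UNIV N. \<forall>k. \<forall>\<eta>>0. \<exists>g. eigenspan (jacobi a w) g \<and> l2_le (\<lambda>n. (if n = k then 1 else 0) - g n) \<eta>"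
    unfolding AE_all_countable by blast
  then show ?thesis
    unfolding anderson_measure_def N_def[symmetric]
    by eventually_elim (rule pure_point_spectrumI, blast)
qed

end
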